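(* Let $h>0$ and let $\nu_1(h)$ be the infimum of $Q(f\otimes g)$ over all $f\in L^2([0,h])$, $g\in L^2([0,1])$ with $\|f\|_2=\|g\|_2=1$, where $Q$ is the quadratic form of the Dirichlet biharmonic operator on $[0,h]\times[0,1]$. Then $$\nu_1(h)=\rho_1(h^2\alpha)h^{-4}+\rho_1\left(\tfrac12\rho_1'(h^2\alpha)h^{-2}\right)-\rho_1'(h^2\alpha)h^{-2}\alpha,$$ where $\alpha\in[\pi^2,dc^2]$ is a solution of the equation $$2\alpha=\rho_1'\left(\tfrac12\rho_1'(h^2\alpha)h^{-2}\right).$$ (That is, there exists a solution $\alpha\in[\pi^2,dc^2]$ of the second equation for which the first equation holds.)
   Context: For $f\in L^2([0,h])$, $g\in L^2([0,1])$ define $$\mathcal E(f,g)=Q(f\otimes g)=\int_0^h\!\int_0^1|\Delta(f(x)g(y))|^2\,dy\,dx$$ if $f\in W^{2,2}_0([0,h])$ and $g\in W^{2,2}_0([0,1])$, and $\mathcal E(f,g)=\infty$ otherwise; here $(f\otimes g)(x,y)=f(x)g(y)$. Define $$\nu_1(h)=\inf\{\mathcal E(f,g):f\in L^2([0,h]),\ g\in L^2([0,1]),\ \|f\|_2=\|g\|_2=1\},$$ the norms being taken in $L^2([0,h])$ and $L^2([0,1])$ respectively. For $\alpha\in\mathbb R$, $\rho_1(\alpha)$ is the first (smallest) eigenvalue of the self-adjoint operator $H(1,\alpha)=\frac{d^4}{dx^4}-2\alpha\frac{d^2}{dx^2}$ acting in $L^2([0,1])$ with quadratic form domain $W^{2,2}_0([0,1])$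 (quadratic form $\int_0^1|f''|^2+2\alpha\int_0^1|f'|^2$). The function $\rho_1$ is analytic on $(0,\infty)$ and $\rho_1'$ is its derivative. The constant $c\approx4.73004$ is the first positive solution of $\cosh c\cos c=1$ and $d=\dfrac{2\tanh c\tan c-c\tanh c-c\tan c}{c\tanh c-c\tan c}\approx0.54988$. *)

theory Defs
  imports "HOL-Analysis.Analysis"
begin

text \<open>
  Elements of \<open>L2 \<Omega>\<close> are represented by complex-valued functions on the whole space of which only
  the restriction to \<open>\<Omega>\<close> matters, up to null sets. Every class of Lebesgue measurable functions has a
  Borel representative, so measurability is taken with respect to \<open>lborel\<close>.
\<close>

definition L2 :: "'a::euclidean_space set \<Rightarrow> ('a \<Rightarrow> complex) set" where
  "L2 \<Omega> = {u. set_borel_measurable lborel \<Omega> u \<and>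
               set_integrable lborel \<Omega> (\<lambda>x. (cmod (u x))\<^sup>2)}"

definition L2_norm :: "'a::euclidean_space set \<Rightarrow> ('a \<Rightarrow> complex) \<Rightarrow> real" where
  "L2_norm \<Omega> u = sqrt (LINT x:\<Omega>|lborel. (cmod (u x))\<^sup>2)"

definition pderiv_at :: "'a::euclidean_space \<Rightarrow> ('a \<Rightarrow> complex) \<Rightarrow> 'a \<Rightarrow> complex" where
  "pderiv_at i \<phi> x = frechet_derivative \<phi> (at x) i"

primrec Ck :: "nat \<Rightarrow> ('a::euclidean_space \<Rightarrow> complex) \<Rightarrow> bool" where
  "Ck 0 \<phi> \<longleftrightarrow> continuous_on UNIV \<phi>"
| "Ck (Suc k) \<phi> \<longleftrightarrow> \<phi> differentiable_on UNIV \<and> (\<forall>i\<in>Basis. Ck k (pderiv_at i \<phi>))"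

text \<open>Using the interior allows \<open>\<Omega>\<close> to be given as a closed box.\<close>

definition test_function :: "'a::euclidean_space set \<Rightarrow> ('a \<Rightarrow> complex) \<Rightarrow> bool" where
  "test_function \<Omega> \<phi> \<longleftrightarrow>
     (\<forall>k. Ck k \<phi>) \<and> compact (closure {x. \<phi> x \<noteq> 0}) \<and> closure {x. \<phi> x \<noteq> 0} \<subseteq> interior \<Omega>"

definition has_weak_pderiv ::
    "'a::euclidean_space set \<Rightarrow> 'a \<Rightarrow> ('a \<Rightarrow> complex) \<Rightarrow> ('a \<Rightarrow> complex) \<Rightarrow> bool" where
  "has_weak_pderiv \<Omega> i u v \<longleftrightarrow> u \<in> L2 \<Omega> \<and> v \<in> L2 \<Omega> \<and>
     (\<forall>\<phi>. test_function \<Omega> \<phi> \<longrightarrow>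
        (LINT x:\<Omega>|lborel. u x * pderiv_at i \<phi> x) = - (LINT x:\<Omega>|lborel. v x * \<phi> x))"

text \<open>Weak derivatives are determined only up to null sets; some representative is chosen.\<close>

definition weak_pderiv ::
    "'a::euclidean_space set \<Rightarrow> 'a \<Rightarrow> ('a \<Rightarrow> complex) \<Rightarrow> 'a \<Rightarrow> complex" where
  "weak_pderiv \<Omega> i u = (SOME v. has_weak_pderiv \<Omega> i u v)"

definition W22 :: "'a::euclidean_space set \<Rightarrow> ('a \<Rightarrow> complex) set" where
  "W22 \<Omega> = {u \<in> L2 \<Omega>. \<forall>i\<in>Basis. (\<exists>v. has_weak_pderiv \<Omega> i u v) \<and>
               (\<forall>j\<in>Basis. \<exists>w. has_weak_pderiv \<Omega> j (weak_pderiv \<Omega> i u) w)}"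

definition W22_norm :: "'a::euclidean_space set \<Rightarrow> ('a \<Rightarrow> complex) \<Rightarrow> real" where
  "W22_norm \<Omega> u = sqrt ((L2_norm \<Omega> u)\<^sup>2 + (\<Sum>i\<in>Basis. (L2_norm \<Omega> (weak_pderiv \<Omega> i u))\<^sup>2)
     + (\<Sum>i\<in>Basis. \<Sum>j\<in>Basis. (L2_norm \<Omega> (weak_pderiv \<Omega> j (weak_pderiv \<Omega> i u)))\<^sup>2))"

definition W22_0 :: "'a::euclidean_space set \<Rightarrow> ('a \<Rightarrow> complex) set" where
  "W22_0 \<Omega> = {u \<in> W22 \<Omega>. \<forall>e>0. \<exists>\<phi>. test_function \<Omega> \<phi> \<and> W22_norm \<Omega> (\<lambda>x. u x - \<phi> x) < e}"

definition weak_laplacian ::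
    "'a::euclidean_space set \<Rightarrow> ('a \<Rightarrow> complex) \<Rightarrow> 'a \<Rightarrow> complex" where
  "weak_laplacian \<Omega> u x = (\<Sum>i\<in>Basis. weak_pderiv \<Omega> i (weak_pderiv \<Omega> i u) x)"

definition biharmonic_form :: "'a::euclidean_space set \<Rightarrow> ('a \<Rightarrow> complex) \<Rightarrow> ereal" where
  "biharmonic_form \<Omega> u =
     (if u \<in> W22_0 \<Omega> then ereal (LINT x:\<Omega>|lborel. (cmod (weak_laplacian \<Omega> u x))\<^sup>2) else \<infinity>)"

definition tensor :: "(real \<Rightarrow> complex) \<Rightarrow> (real \<Rightarrow> complex) \<Rightarrow> real \<times> real \<Rightarrow> complex" where
  "tensor f g = (\<lambda>(x, y). f x * g y)"

definition tensor_energy :: "real \<Rightarrow> (real \<Rightarrow> complex) \<Rightarrow> (real \<Rightarrow> complex) \<Rightarrow> ereal" where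
  "tensor_energy h f g =
     (if f \<in> W22_0 {0..h} \<and> g \<in> W22_0 {0..1}
      then biharmonic_form ({0..h} \<times> {0..1}) (tensor f g) else \<infinity>)"

definition nu1 :: "real \<Rightarrow> ereal" where
  "nu1 h = Inf {tensor_energy h f g | f g.
     f \<in> L2 {0..h} \<and> g \<in> L2 {0..1} \<and> L2_norm {0..h} f = 1 \<and> L2_norm {0..1} g = 1}"

text \<open>For functions on the real line the only element of \<open>Basis\<close> is \<open>1\<close>.\<close>

definition D01 :: "(real \<Rightarrow> complex) \<Rightarrow> real \<Rightarrow> complex" where
  "D01 = weak_pderiv {0..1} 1"

definition H_form :: "real \<Rightarrow> (real \<Rightarrow> complex) \<Rightarrow> (real \<Rightarrow> complex) \<Rightarrow> complex" where
  "H_form \<alpha> u v = (LINT x:{0..1}|lborel. D01 (D01 u) x * cnj (D01 (D01 v) x))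
     + 2 * of_real \<alpha> * (LINT x:{0..1}|lborel. D01 u x * cnj (D01 v x))"

text \<open>
  The graph of the self-adjoint operator \<open>d^4/dx^4 - 2 \<alpha> d^2/dx^2\<close> associated with the closed form
  \<open>H_form \<alpha>\<close> on \<open>W22_0 {0..1}\<close> (first representation theorem): \<open>u\<close> is in the operator domain and is
  mapped to \<open>w\<close>.
\<close>

definition H_op :: "real \<Rightarrow> (real \<Rightarrow> complex) \<Rightarrow> (real \<Rightarrow> complex) \<Rightarrow> bool" where
  "H_op \<alpha> u w \<longleftrightarrow> u \<in> W22_0 {0..1} \<and> w \<in> L2 {0..1} \<and>
     (\<forall>v\<in>W22_0 {0..1}. H_form \<alpha> u v = (LINT x:{0..1}|lborel. w x * cnj (v x)))"

definition H_eigenvalue :: "real \<Rightarrow> complex \<Rightarrow> bool" where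
  "H_eigenvalue \<alpha> z \<longleftrightarrow> (\<exists>u. L2_norm {0..1} u \<noteq> 0 \<and> H_op \<alpha> u (\<lambda>x. z * u x))"

text \<open>The operator is self-adjoint, so all its eigenvalues are real.\<close>

definition rho1 :: "real \<Rightarrow> real" where
  "rho1 \<alpha> = (LEAST l. H_eigenvalue \<alpha> (complex_of_real l))"

definition c_const :: real where
  "c_const = (LEAST c. 0 < c \<and> cosh c * cos c = 1)"

definition d_const :: real where
  "d_const = (let c = c_const in
     (2 * tanh c * tan c - c * tanh c - c * tan c) / (c * tanh c - c * tan c))"

end

theory Submission
  imports Defs "HOL-Complex_Analysis.Complex_Analysis"
begin

text \<open>
  For \<open>f\<close>, \<open>g\<close> in \<open>W22_0\<close> of norm 1 one has
  \<open>E(f, g) = |f''|\<^sup>2 + |g''|\<^sup>2 + 2 |f'|\<^sup>2 |g'|\<^sup>2\<close>, so for fixed \<open>g\<close> the best \<open>f\<close> is a rescaled ground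
  state of \<open>H(1, \<alpha>)\<close>, and conversely. Ground states exist by compactness, and they are simple: every
  solution of the eigenvalue equation with \<open>u(0) = u'(0) = u(1) = 0\<close> is a multiple of one explicit
  function. Hence \<open>|u'|\<^sup>2\<close> of the normalised ground state \<open>u\<close> of \<open>H(1, \<alpha>)\<close> is a well-defined, decreasing,
  continuous function of \<open>\<alpha>\<close>, which is \<open>\<rho>\<^sub>1'(\<alpha>) / 2\<close> because \<open>\<rho>\<^sub>1\<close> is an infimum of affine functions.
  Minimising the energy over pairs of ground states is a problem on a compact rectangle. Replacing one
  member of a minimising pair by the best response to the other cannot lower the energy, so both are best
  responses, which is the equation for \<open>\<alpha> = |g'|\<^sup>2\<close>. The bounds on \<open>\<alpha>\<close> are Wirtinger's inequality and
  the value of \<open>|u'|\<^sup>2\<close> for the clamped beam \<open>\<alpha> = 0\<close>.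
\<close>

section \<open>Square-integrable functions\<close>

text \<open>The cross term of the energy is twice the real part of <f'', f> <g, g''>, and
  integration by parts turns it into the product 2 |f'|^2 |g'|^2; this is why f and g interact only
  through the two numbers |f'|^2 and |g'|^2. The derivative of \<open>rho1\<close> comes from
  comparison: a ground state at one parameter is a trial function at any other, which gives
  supporting lines from above, and continuity of |u'|^2 makes them tangents. That continuity rests
  on uniqueness, since compactness alone yields subsequences with possibly different limits. Hence
  the eigenvalue equation is solved explicitly, which in turn requires weak solutions to be
  classical. The same explicit solution at \<alpha> = 0 produces c and d. A second obstacle is that
  the weak derivatives of the definitions are arbitrary choices; the function spaces are therefore
  handled through sequences of test functions whose derivatives converge in L2, and identities are
  proved for test functions and passed to the limit.\<close>

definition sq_int :: "'a measure \<Rightarrow> ('a \<Rightarrow> complex) \<Rightarrow> bool" where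
  "sq_int M f \<longleftrightarrow> f \<in> borel_measurable M \<and> integrable M (\<lambda>x. (cmod (f x))\<^sup>2)"

definition nsq :: "'a measure \<Rightarrow> ('a \<Rightarrow> complex) \<Rightarrow> real" where
  "nsq M f = (\<integral>x. (cmod (f x))\<^sup>2 \<partial>M)"

definition ip :: "'a measure \<Rightarrow> ('a \<Rightarrow> complex) \<Rightarrow> ('a \<Rightarrow> complex) \<Rightarrow> complex" where
  "ip M f g = (\<integral>x. f x * cnj (g x) \<partial>M)"

text \<open>Square integrability of the terms and of the limit is part of the notion, so that limits
  of sums and inner products need no side conditions.\<close>

definition L2_lim :: "'a measure \<Rightarrow> (nat \<Rightarrow> 'a \<Rightarrow> complex) \<Rightarrow> ('a \<Rightarrow> complex) \<Rightarrow> bool" where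
  "L2_lim M F u \<longleftrightarrow> (\<forall>n. sq_int M (F n)) \<and> sq_int M u \<and> (\<lambda>n. nsq M (\<lambda>x. F n x - u x)) \<longlonglongrightarrow> 0"

lemma sq_int_measurable [measurable_dest]: "sq_int M f \<Longrightarrow> f \<in> borel_measurable M"
  by (simp add: sq_int_def)

lemma cmod_add_sq_le: "(cmod (a + b))\<^sup>2 \<le> 2 * (cmod a)\<^sup>2 + 2 * (cmod b)\<^sup>2"
proof -
  have "(cmod (a + b))\<^sup>2 \<le> (cmod a + cmod b)\<^sup>2"
    by (intro power_mono norm_triangle_ineq) auto
  also have "\<dots> \<le> 2 * (cmod a)\<^sup>2 + 2 * (cmod b)\<^sup>2"
    using sum_squares_bound[of "cmod a" "cmod b"] by (simp add: power2_sum)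
  finally show ?thesis .
qed

lemma sq_int_add: assumes "sq_int M f" "sq_int M g" shows "sq_int M (\<lambda>x. f x + g x)"
proof -
  have [measurable]: "f \<in> borel_measurable M" "g \<in> borel_measurable M"
    using assms by (auto simp: sq_int_def)
  have "integrable M (\<lambda>x. (cmod (f x + g x))\<^sup>2)"
    by (rule Bochner_Integration.integrable_bound[where f="\<lambda>x. 2 * (cmod (f x))\<^sup>2 + 2 * (cmod (g x))\<^sup>2"])
       (use assms cmod_add_sq_le in \<open>auto simp: sq_int_def\<close>)
  thus ?thesis by (auto simp: sq_int_def)
qed

lemma sq_int_cmult: assumes "sq_int M f" shows "sq_int M (\<lambda>x. c * f x)"
  using assms by (auto simp: sq_int_def norm_mult power_mult_distrib)

lemma sq_int_uminus: "sq_int M f \<Longrightarrow> sq_int M (\<lambda>x. - f x)"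
  using sq_int_cmult[of M f "-1"] by simp

lemma sq_int_diff: "sq_int M f \<Longrightarrow> sq_int M g \<Longrightarrow> sq_int M (\<lambda>x. f x - g x)"
  using sq_int_add[OF _ sq_int_uminus, of M f g] by simp

lemma sq_int_zero [simp]: "sq_int M (\<lambda>x. 0)"
  by (simp add: sq_int_def)

lemma sq_int_cong_AE:
  assumes "f \<in> borel_measurable M" "sq_int M g" "AE x in M. f x = g x" shows "sq_int M f"
proof -
  have [measurable]: "f \<in> borel_measurable M" "g \<in> borel_measurable M"
    using assms by (auto simp: sq_int_def)
  have "integrable M (\<lambda>x. (cmod (f x))\<^sup>2) \<longleftrightarrow> integrable M (\<lambda>x. (cmod (g x))\<^sup>2)"
    by (rule integrable_cong_AE) (use assms(3) in auto)
  thus ?thesis using assms by (auto simp: sq_int_def)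
qed

lemma nsq_cong_AE:
  assumes "f \<in> borel_measurable M" "g \<in> borel_measurable M" "AE x in M. f x = g x"
  shows "nsq M f = nsq M g"
  unfolding nsq_def by (rule integral_cong_AE) (use assms in auto)

lemma integrable_mult_sq:
  fixes f g :: "'a \<Rightarrow> complex"
  assumes "sq_int M f" "sq_int M g" shows "integrable M (\<lambda>x. f x * g x)"
proof -
  have [measurable]: "f \<in> borel_measurable M" "g \<in> borel_measurable M"
    using assms by (auto simp: sq_int_def)
  have *: "cmod (a * b) \<le> (cmod a)\<^sup>2 + (cmod b)\<^sup>2" for a b
    using sum_squares_bound[of "cmod a" "cmod b"]
          mult_nonneg_nonneg[OF norm_ge_zero[of a] norm_ge_zero[of b]]
    unfolding norm_mult by linarith
  show ?thesis
    by (rule Bochner_Integration.integrable_bound[where f="\<lambda>x. (cmod (f x))\<^sup>2 + (cmod (g x))\<^sup>2"])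
       (use assms * in \<open>auto simp: sq_int_def\<close>)
qed

lemma sq_int_cnj: "sq_int M f \<Longrightarrow> sq_int M (\<lambda>x. cnj (f x))"
  unfolding sq_int_def
  using measurable_compose[of f M borel cnj borel, OF _ borel_measurable_continuous_onI[OF continuous_on_cnj[OF continuous_on_id]]]
  by auto

lemma integrable_ip:
  assumes "sq_int M f" "sq_int M g" shows "integrable M (\<lambda>x. f x * cnj (g x))"
  using integrable_mult_sq[OF assms(1) sq_int_cnj[OF assms(2)]] .

lemma nsq_nonneg [simp]: "nsq M f \<ge> 0"
  by (simp add: nsq_def)

lemma nsq_zero [simp]: "nsq M (\<lambda>x. 0) = 0"
  by (simp add: nsq_def)

lemma nsq_cmult: "nsq M (\<lambda>x. c * f x) = (cmod c)\<^sup>2 * nsq M f"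
  by (simp add: nsq_def norm_mult power_mult_distrib)

lemma nsq_uminus [simp]: "nsq M (\<lambda>x. - f x) = nsq M f"
  by (simp add: nsq_def)

lemma nsq_minus_commute: "nsq M (\<lambda>x. f x - g x) = nsq M (\<lambda>x. g x - f x)"
  by (simp add: nsq_def norm_minus_commute)

lemma cmod_add_sq: "(cmod (a + b))\<^sup>2 = (cmod a)\<^sup>2 + (cmod b)\<^sup>2 + 2 * Re (a * cnj b)"
  unfolding cmod_power2 by (simp add: algebra_simps power2_eq_square)

lemma nsq_add:
  assumes "sq_int M f" "sq_int M g"
  shows "nsq M (\<lambda>x. f x + g x) = nsq M f + nsq M g + 2 * Re (ip M f g)"
proof -
  define R where "R = (\<lambda>x. Re (f x * cnj (g x)))"
  note i = integrable_ip[OF assms]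
  have "(\<integral>x. R x \<partial>M) = Re (ip M f g)"
    unfolding ip_def R_def by (rule integral_Re[OF i])
  moreover have "integrable M R" unfolding R_def using i by (rule integrable_Re)
  moreover have "nsq M (\<lambda>x. f x + g x) = (\<integral>x. (cmod (f x))\<^sup>2 + (cmod (g x))\<^sup>2 + 2 * R x \<partial>M)"
    by (simp only: nsq_def R_def cmod_add_sq)
  ultimately show ?thesis
    using assms by (simp add: nsq_def sq_int_def)
qed

lemma nsq_add_le:
  assumes "sq_int M f" "sq_int M g"
  shows "nsq M (\<lambda>x. f x + g x) \<le> 2 * nsq M f + 2 * nsq M g"
proof -
  have "nsq M (\<lambda>x. f x + g x) \<le> (\<integral>x. 2 * (cmod (f x))\<^sup>2 + 2 * (cmod (g x))\<^sup>2 \<partial>M)"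
    unfolding nsq_def
    by (rule integral_mono)
       (use assms cmod_add_sq_le sq_int_add[OF assms] in \<open>auto simp: sq_int_def\<close>)
  also have "\<dots> = 2 * nsq M f + 2 * nsq M g"
    using assms unfolding nsq_def sq_int_def by simp
  finally show ?thesis .
qed

lemma ip_uminus_right [simp]: "ip M f (\<lambda>x. - g x) = - ip M f g"
  by (simp add: ip_def)

lemma nsq_diff:
  assumes "sq_int M f" "sq_int M g"
  shows "nsq M (\<lambda>x. f x - g x) = nsq M f + nsq M g - 2 * Re (ip M f g)"
  using nsq_add[OF assms(1) sq_int_uminus[OF assms(2)]] by simp

lemma nsq_parallelogram:
  assumes "sq_int M f" "sq_int M g"
  shows "nsq M (\<lambda>x. f x - g x) = 2 * nsq M f + 2 * nsq M g - nsq M (\<lambda>x. f x + g x)"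
  unfolding nsq_add[OF assms] nsq_diff[OF assms] by simp

lemma ip_diff_left:
  assumes "sq_int M f" "sq_int M g" "sq_int M k"
  shows "ip M (\<lambda>x. f x - g x) k = ip M f k - ip M g k"
  using integrable_ip[OF assms(1,3)] integrable_ip[OF assms(2,3)]
  by (simp add: ip_def left_diff_distrib)

lemma ip_cmult_right: "ip M f (\<lambda>x. c * k x) = cnj c * ip M f k"
  by (simp add: ip_def mult.left_commute)

lemma ip_cnj: "ip M g f = cnj (ip M f g)"
  unfolding ip_def Bochner_Integration.integral_cnj[symmetric] by (simp add: mult.commute)

lemma ip_self: "ip M f f = of_real (nsq M f)"
  unfolding ip_def nsq_def
  by (simp only: complex_norm_square[symmetric] of_real_power[symmetric] integral_complex_of_real)

text \<open>Expand the nonnegative squared norm of f - t <f, g> g for real t and choose t = 1 /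
  |g|^2; if |g| = 0, large t forces <f, g> = 0.\<close>

lemma ip_CS:
  assumes "sq_int M f" "sq_int M g"
  shows "(cmod (ip M f g))\<^sup>2 \<le> nsq M f * nsq M g"
proof -
  have main: "2 * t * (cmod (ip M f g))\<^sup>2 \<le> nsq M f + t\<^sup>2 * (cmod (ip M f g))\<^sup>2 * nsq M g" for t
  proof -
    \<comment> \<open>The factor \<open>ip M f g\<close> rotates the cross term onto the real axis,
      so that a real parameter t suffices.\<close>
    let ?c = "of_real t * ip M f g"
    have "0 \<le> nsq M (\<lambda>x. f x - ?c * g x)" by simp
    also have "\<dots> = nsq M f + (cmod ?c)\<^sup>2 * nsq M g - 2 * Re (cnj ?c * ip M f g)"
      by (subst nsq_diff) (use assms sq_int_cmult in \<open>auto simp: nsq_cmult ip_cmult_right\<close>)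
    also have "cnj ?c * ip M f g = of_real (t * (cmod (ip M f g))\<^sup>2)"
      using complex_norm_square[of "ip M f g"] by (simp add: mult.commute)
    finally show ?thesis by (simp add: norm_mult power_mult_distrib)
  qed
  show ?thesis
  proof (cases "nsq M g = 0")
    case True
    define s where "s = (cmod (ip M f g))\<^sup>2"
    have "s \<ge> 0" by (simp add: s_def)
    have "2 * t * s \<le> nsq M f" for t
      using main[of t] True by (simp add: s_def)
    from this[of "(nsq M f + 1) / s"] have "s = 0"
      using \<open>s \<ge> 0\<close> nsq_nonneg[of M f] by (cases "s = 0") auto
    thus ?thesis using True by (simp add: s_def)
  next
    case False
    hence p: "nsq M g > 0" using nsq_nonneg[of M g] by linarith
    from main[of "1 / nsq M g"] show ?thesis
      using p by (simp add: field_simps power2_eq_square)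
  qed
qed

section \<open>Convergence in L2 and completeness\<close>

lemma L2_limD: assumes "L2_lim M F u"
  shows "sq_int M (F n)" "sq_int M u" "(\<lambda>n. nsq M (\<lambda>x. F n x - u x)) \<longlonglongrightarrow> 0"
  using assms by (auto simp: L2_lim_def)

lemma tendsto_0_squeeze:
  fixes f :: "nat \<Rightarrow> real"
  assumes "\<And>n. 0 \<le> f n" "\<And>n. f n \<le> g n" "g \<longlonglongrightarrow> 0" shows "f \<longlonglongrightarrow> 0"
  by (rule tendsto_sandwich[OF _ _ tendsto_const assms(3)]) (use assms in auto)

lemma L2_lim_add:
  assumes "L2_lim M F u" "L2_lim M G v"
  shows "L2_lim M (\<lambda>n x. F n x + G n x) (\<lambda>x. u x + v x)"
  unfolding L2_lim_def
proof (intro conjI allI)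
  note F = L2_limD[OF assms(1)] and G = L2_limD[OF assms(2)]
  show "sq_int M (\<lambda>x. u x + v x)" "\<And>n. sq_int M (\<lambda>x. F n x + G n x)"
    by (intro sq_int_add F G)+
  show "(\<lambda>n. nsq M (\<lambda>x. F n x + G n x - (u x + v x))) \<longlonglongrightarrow> 0"
  proof (rule tendsto_0_squeeze)
    fix n
    have eq: "(\<lambda>x. F n x + G n x - (u x + v x)) = (\<lambda>x. (F n x - u x) + (G n x - v x))"
      by (auto simp: fun_eq_iff)
    show "nsq M (\<lambda>x. F n x + G n x - (u x + v x)) \<le>
      2 * nsq M (\<lambda>x. F n x - u x) + 2 * nsq M (\<lambda>x. G n x - v x)"
      unfolding eq by (intro nsq_add_le sq_int_diff F G)
  next
    show "(\<lambda>n. 2 * nsq M (\<lambda>x. F n x - u x) + 2 * nsq M (\<lambda>x. G n x - v x)) \<longlonglongrightarrow> 0"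
      using tendsto_add[OF tendsto_mult_left[OF F(3), of 2] tendsto_mult_left[OF G(3), of 2]] by simp
  qed auto
qed

lemma L2_lim_cmult: assumes "L2_lim M F u" shows "L2_lim M (\<lambda>n x. c * F n x) (\<lambda>x. c * u x)"
  using L2_limD[OF assms] tendsto_mult_left[OF L2_limD(3)[OF assms], of "(cmod c)\<^sup>2"]
  by (auto simp: L2_lim_def sq_int_cmult nsq_cmult right_diff_distrib[symmetric])

lemma L2_lim_diff:
  assumes "L2_lim M F u" "L2_lim M G v"
  shows "L2_lim M (\<lambda>n x. F n x - G n x) (\<lambda>x. u x - v x)"
  using L2_lim_add[OF assms(1) L2_lim_cmult[OF assms(2), of "-1"]] by simp

lemma L2_lim_const: "sq_int M u \<Longrightarrow> L2_lim M (\<lambda>n. u) u"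
  by (simp add: L2_lim_def)

lemma ip_lim:
  assumes "L2_lim M F u" "L2_lim M G v"
  shows "(\<lambda>n. ip M (F n) (G n)) \<longlonglongrightarrow> ip M u v"
proof -
  note F = L2_limD[OF assms(1)] and G = L2_limD[OF assms(2)]
  \<comment> \<open>Each of the three summands has a factor tending to 0 in norm, so Cauchy-Schwarz
    disposes of all of them.\<close>
  have eq: "ip M (F n) (G n) - ip M u v =
      ip M (\<lambda>x. F n x - u x) (\<lambda>x. G n x - v x) + ip M (\<lambda>x. F n x - u x) v + ip M u (\<lambda>x. G n x - v x)" for n
  proof -
    have 1: "ip M u (\<lambda>x. G n x - v x) = ip M u (G n) - ip M u v"
      using ip_diff_left[OF G(1) G(2) F(2), of n] ip_cnj by (metis complex_cnj_diff)
    have 2: "ip M (F n) (\<lambda>x. G n x - v x) = ip M (F n) (G n) - ip M (F n) v"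
      using ip_diff_left[OF G(1) G(2) F(1), of n n] ip_cnj by (metis complex_cnj_diff)
    show ?thesis
      using ip_diff_left[OF F(1) F(2) sq_int_diff[OF G(1) G(2)], of n n]
            ip_diff_left[OF F(1) F(2) G(2), of n] 1 2 by simp
  qed
  have z: "(\<lambda>n. ip M (A n) (B n)) \<longlonglongrightarrow> 0"
    if "\<And>n. sq_int M (A n)" "\<And>n. sq_int M (B n)" "(\<lambda>n. nsq M (A n) * nsq M (B n)) \<longlonglongrightarrow> 0" for A B
  proof -
    have "(\<lambda>n. (cmod (ip M (A n) (B n)))\<^sup>2) \<longlonglongrightarrow> 0"
      by (rule tendsto_0_squeeze[OF _ _ that(3)]) (use ip_CS[OF that(1,2)] in auto)
    from tendsto_real_sqrt[OF this] have "(\<lambda>n. cmod (ip M (A n) (B n))) \<longlonglongrightarrow> 0" by simp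
    thus ?thesis by (rule tendsto_norm_zero_cancel)
  qed
  have "(\<lambda>n. ip M (F n) (G n) - ip M u v) \<longlonglongrightarrow> 0 + 0 + 0"
    unfolding eq
    by (intro tendsto_add z sq_int_diff F G)
       (use tendsto_mult[OF F(3) G(3)] tendsto_mult_right[OF F(3), of "nsq M v"]
            tendsto_mult_left[OF G(3), of "nsq M u"] in auto)
  thus ?thesis using LIM_zero_iff by force
qed

lemma nsq_lim: assumes "L2_lim M F u" shows "(\<lambda>n. nsq M (F n)) \<longlonglongrightarrow> nsq M u"
  using tendsto_Re[OF ip_lim[OF assms assms]] by (simp add: ip_self)

lemma lint_mult_lim:
  assumes "L2_lim M F u" "sq_int M g"
  shows "(\<lambda>n. \<integral>x. F n x * g x \<partial>M) \<longlonglongrightarrow> (\<integral>x. u x * g x \<partial>M)"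
  using ip_lim[OF assms(1) L2_lim_const[OF sq_int_cnj[OF assms(2)]]] by (simp add: ip_def)

text \<open>Cauchy-Schwarz against the constant 1, which is square integrable because the measure is
  finite.\<close>

lemma nsq_integral_norm:
  assumes "sq_int M f" "finite_measure M"
  shows "integrable M (\<lambda>x. cmod (f x))" "(\<integral>x. cmod (f x) \<partial>M)\<^sup>2 \<le> nsq M f * measure M (space M)"
proof -
  interpret finite_measure M by fact
  note [measurable] = sq_int_measurable[OF assms(1)]
  have 1: "sq_int M (\<lambda>x. of_real (cmod (f x)))" "sq_int M (\<lambda>x. 1)"
    using assms by (auto simp: sq_int_def)
  have "nsq M (\<lambda>x. 1) = measure M (space M)" by (simp add: nsq_def)
  thus "(\<integral>x. cmod (f x) \<partial>M)\<^sup>2 \<le> nsq M f * measure M (space M)"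
    using ip_CS[OF 1] by (simp add: ip_def nsq_def)
  show "integrable M (\<lambda>x. cmod (f x))"
    using integrable_Re[OF integrable_ip[OF 1]] by simp
qed

text \<open>Riesz-Fischer: a subsequence with rapidly decreasing increments converges almost
  everywhere, and Fatou's lemma turns the pointwise limit into an L2 limit of the whole sequence.
  Finiteness of the measure lets the increments be summed in L1.\<close>

lemma L2_complete:
  assumes F: "\<And>n. sq_int M (F n)" and fin: "finite_measure M"
    and Cau: "\<And>e. e > 0 \<Longrightarrow> \<exists>N. \<forall>m\<ge>N. \<forall>n\<ge>N. nsq M (\<lambda>x. F m x - F n x) < e"
  shows "\<exists>u. L2_lim M F u"
proof -
  interpret finite_measure M by (rule fin)
  note [measurable] = sq_int_measurable[OF F]
  \<comment> \<open>Squared increments below 4^-n give L1 norms of order 2^-n, which are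
    summable.\<close>
  have "\<exists>r. \<forall>n. (\<forall>m\<ge>r n. nsq M (\<lambda>x. F m x - F (r n) x) < (1/4)^n) \<and> r n < r (Suc n)"
  proof (rule dependent_nat_choice)
    show "\<exists>x. \<forall>m\<ge>x. nsq M (\<lambda>y. F m y - F x y) < (1 / 4) ^ 0"
      using Cau[of 1] by auto
  next
    fix x n
    obtain N where N: "\<forall>m\<ge>N. \<forall>k\<ge>N. nsq M (\<lambda>x. F m x - F k x) < (1/4) ^ Suc n"
      using Cau[of "(1/4) ^ Suc n"] by auto
    thus "\<exists>y. (\<forall>m\<ge>y. nsq M (\<lambda>x. F m x - F y x) < (1 / 4) ^ Suc n) \<and> x < y"
      by (intro exI[of _ "max N (Suc x)"]) auto
  qed
  then obtain r where r: "\<And>n m. m \<ge> r n \<Longrightarrow> nsq M (\<lambda>x. F m x - F (r n) x) < (1/4)^n"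
    and r': "\<And>n. r n < r (Suc n)" by blast
  have mono: "strict_mono r" using r' by (simp add: strict_mono_Suc_iff)
  define d where "d = (\<lambda>n x. F (r (Suc n)) x - F (r n) x)"
  have dsq: "sq_int M (d n)" for n unfolding d_def by (intro sq_int_diff F)
  note [measurable] = sq_int_measurable[OF dsq]
  define C where "C = sqrt (measure M (space M))"
  have dint: "(\<integral>x. cmod (d n x) \<partial>M) \<le> C * (1/2)^n" for n
  proof -
    have "(\<integral>x. cmod (d n x) \<partial>M)\<^sup>2 \<le> nsq M (d n) * measure M (space M)"
      by (rule nsq_integral_norm[OF dsq fin])
    also have "\<dots> \<le> (1/4)^n * measure M (space M)"
      using r[of n "r (Suc n)"] r'[of n] by (intro mult_right_mono) (auto simp: d_def)
    also have "\<dots> = (C * (1/2)^n)\<^sup>2"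
    proof -
      have "((1/2::real)^n)\<^sup>2 = (1/4)^n"
        by (simp add: power2_eq_square flip: power_mult_distrib)
      thus ?thesis by (simp add: C_def power_mult_distrib)
    qed
    finally show ?thesis by (rule power2_le_imp_le) (simp add: C_def)
  qed
  have "(\<integral>\<^sup>+x. (\<Sum>n. ennreal (cmod (d n x))) \<partial>M) = (\<Sum>n. \<integral>\<^sup>+x. ennreal (cmod (d n x)) \<partial>M)"
    by (rule nn_integral_suminf) simp
  also have "\<dots> = (\<Sum>n. ennreal (\<integral>x. cmod (d n x) \<partial>M))"
    using nsq_integral_norm(1)[OF dsq fin] by (subst nn_integral_eq_integral) auto
  also have "\<dots> \<le> (\<Sum>n. ennreal (C * (1/2)^n))"
    by (intro suminf_le ennreal_leI dint) auto
  also have "\<dots> = ennreal (\<Sum>n. C * (1/2)^n)"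
    by (rule suminf_ennreal2) (auto simp: C_def intro!: summable_mult)
  also have "\<dots> < \<infinity>" by simp
  finally have "AE x in M. (\<Sum>n. ennreal (cmod (d n x))) \<noteq> \<infinity>"
    by (intro nn_integral_PInf_AE) (auto simp: less_top)
  hence sm: "AE x in M. summable (\<lambda>n. d n x)"
    by eventually_elim (auto intro!: summable_norm_cancel[of "\<lambda>n. d n _"] summable_suminf_not_top)
  define u where "u = (\<lambda>x. F (r 0) x + (\<Sum>n. d n x))"
  have [measurable]: "u \<in> borel_measurable M" unfolding u_def by measurable
  have ulim: "AE x in M. (\<lambda>n. F (r n) x) \<longlonglongrightarrow> u x"
    using sm
  proof eventually_elim
    case (elim x)
    have "(\<Sum>i<n. d i x) = F (r n) x - F (r 0) x" for n
      unfolding d_def by (rule sum_lessThan_telescope)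
    thus ?case using summable_LIMSEQ[OF elim] tendsto_add[OF tendsto_const[of "F (r 0) x"]]
      unfolding u_def by fastforce
  qed
  \<comment> \<open>Fatou along the subsequence: the Cauchy bound between \<open>F m\<close> and
    \<open>F (r n)\<close> survives the passage of n to infinity.\<close>
  have bound: "(\<integral>\<^sup>+x. ennreal ((cmod (F m x - u x))\<^sup>2) \<partial>M) \<le> ennreal e"
    if N: "\<forall>m\<ge>N. \<forall>n\<ge>N. nsq M (\<lambda>x. F m x - F n x) < e" and "m \<ge> N" for m N e
  proof -
    have "(\<integral>\<^sup>+x. ennreal ((cmod (F m x - u x))\<^sup>2) \<partial>M)
        = (\<integral>\<^sup>+x. liminf (\<lambda>n. ennreal ((cmod (F m x - F (r n) x))\<^sup>2)) \<partial>M)"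
    proof (rule nn_integral_cong_AE)
      show "AE x in M. ennreal ((cmod (F m x - u x))\<^sup>2) = liminf (\<lambda>n. ennreal ((cmod (F m x - F (r n) x))\<^sup>2))"
        using ulim
      proof eventually_elim
        case (elim x)
        have "(\<lambda>n. ennreal ((cmod (F m x - F (r n) x))\<^sup>2)) \<longlonglongrightarrow> ennreal ((cmod (F m x - u x))\<^sup>2)"
          by (intro tendsto_ennrealI tendsto_intros elim)
        thus ?case by (rule lim_imp_Liminf[OF sequentially_bot, symmetric])
      qed
    qed
    also have "\<dots> \<le> liminf (\<lambda>n. \<integral>\<^sup>+x. ennreal ((cmod (F m x - F (r n) x))\<^sup>2) \<partial>M)"
      by (rule nn_integral_liminf) simp
    also have "\<dots> \<le> ennreal e"
    proof (rule order_trans[OF Liminf_le_Limsup Limsup_bounded])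
      have "(\<integral>\<^sup>+x. ennreal ((cmod (F m x - F (r n) x))\<^sup>2) \<partial>M) \<le> ennreal e" if "n \<ge> N" for n
      proof -
        have "nsq M (\<lambda>x. F m x - F (r n) x) \<le> e"
          using N \<open>m \<ge> N\<close> seq_suble[OF mono, of n] that by (intro less_imp_le) auto
        moreover have "integrable M (\<lambda>x. (cmod (F m x - F (r n) x))\<^sup>2)"
          using sq_int_diff[OF F F, of m "r n"] by (simp add: sq_int_def)
        ultimately show ?thesis
          by (subst nn_integral_eq_integral) (auto simp: nsq_def intro: ennreal_leI)
      qed
      thus "\<forall>\<^sub>F n in sequentially. (\<integral>\<^sup>+x. ennreal ((cmod (F m x - F (r n) x))\<^sup>2) \<partial>M) \<le> ennreal e"
        by (rule eventually_sequentiallyI)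
    qed simp
    finally show ?thesis .
  qed
  have sqd: "sq_int M (\<lambda>x. F m x - u x)" "nsq M (\<lambda>x. F m x - u x) \<le> e"
    if N: "\<forall>m\<ge>N. \<forall>n\<ge>N. nsq M (\<lambda>x. F m x - F n x) < e" and "m \<ge> N" for m N e
  proof -
    note b = bound[OF that]
    have "0 \<le> e" using N \<open>m \<ge> N\<close> nsq_nonneg[of M "\<lambda>x. F m x - F m x"] by (metis less_imp_le order_trans)
    have int: "integrable M (\<lambda>x. (cmod (F m x - u x))\<^sup>2)"
      by (rule integrableI_bounded) (use b in \<open>auto simp: le_less_trans[OF _ ennreal_less_top]\<close>)
    thus "sq_int M (\<lambda>x. F m x - u x)" by (simp add: sq_int_def)
    show "nsq M (\<lambda>x. F m x - u x) \<le> e"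
      using b \<open>0 \<le> e\<close> by (subst (asm) nn_integral_eq_integral[OF int]) (auto simp: nsq_def)
  qed
  obtain N1 where N1: "\<forall>m\<ge>N1. \<forall>n\<ge>N1. nsq M (\<lambda>x. F m x - F n x) < 1" using Cau[of 1] by auto
  have usq: "sq_int M u"
    using sq_int_diff[OF F sqd(1)[OF N1 order_refl], of N1] by simp
  moreover have "(\<lambda>m. nsq M (\<lambda>x. F m x - u x)) \<longlonglongrightarrow> 0"
  proof (rule LIMSEQ_I)
    fix e :: real assume "0 < e"
    obtain N where "\<forall>m\<ge>N. \<forall>n\<ge>N. nsq M (\<lambda>x. F m x - F n x) < e/2" using Cau[of "e/2"] \<open>0<e\<close> by auto
    from sqd(2)[OF this] show "\<exists>no. \<forall>n\<ge>no. norm (nsq M (\<lambda>x. F n x - u x) - 0) < e"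
      using \<open>0 < e\<close> by (intro exI[of _ N]) (fastforce)
  qed
  ultimately show ?thesis using F by (auto simp: L2_lim_def)
qed

section \<open>Smooth functions and test functions\<close>

definition smooth :: "('a::euclidean_space \<Rightarrow> complex) \<Rightarrow> bool" where
  "smooth \<phi> \<longleftrightarrow> (\<forall>k. Ck k \<phi>)"

lemma smoothD1: assumes "smooth \<phi>"
  shows "(\<phi> has_derivative frechet_derivative \<phi> (at x)) (at x)"
proof -
  have "Ck (Suc 0) \<phi>" using assms by (simp only: smooth_def)
  thus ?thesis by (auto simp: differentiable_on_def frechet_derivative_works)
qed

lemma Ck_Suc_imp: "Ck (Suc k) \<phi> \<Longrightarrow> Ck k \<phi>"
proof (induction k arbitrary: \<phi>)
  case 0 thus ?case by (simp add: differentiable_imp_continuous_on)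
next
  case (Suc k) thus ?case by (metis Ck.simps(2))
qed

lemma Ck_imp_continuous: "Ck k \<phi> \<Longrightarrow> continuous_on UNIV \<phi>"
  by (induction k) (auto dest: differentiable_imp_continuous_on)

lemma smooth_continuous: "smooth \<phi> \<Longrightarrow> continuous_on A \<phi>"
  unfolding smooth_def using Ck_imp_continuous continuous_on_subset by blast

lemma smooth_pderiv: "smooth \<phi> \<Longrightarrow> i \<in> Basis \<Longrightarrow> smooth (pderiv_at i \<phi>)"
  unfolding smooth_def by (metis Ck.simps(2))

lemma smoothI:
  assumes "\<And>x. \<phi> differentiable (at x)" "\<And>i. i \<in> Basis \<Longrightarrow> smooth (pderiv_at i \<phi>)"
  shows "smooth \<phi>"
proof -
  have "Ck (Suc k) \<phi>" for k
    using assms unfolding smooth_def by (auto simp: differentiable_on_def intro: differentiable_at_withinI)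
  thus ?thesis unfolding smooth_def using Ck_Suc_imp by blast
qed

lemma pderiv_at_eq: "(\<phi> has_derivative D) (at x) \<Longrightarrow> pderiv_at i \<phi> x = D i"
  unfolding pderiv_at_def using frechet_derivative_at by metis

lemma pderiv_at_add:
  assumes "f differentiable at x" "g differentiable at x"
  shows "pderiv_at i (\<lambda>x. f x + g x) x = pderiv_at i f x + pderiv_at i g x"
  using has_derivative_add[of f "frechet_derivative f (at x)" "at x" g "frechet_derivative g (at x)"] assms
  by (subst pderiv_at_eq) (auto simp: frechet_derivative_works pderiv_at_def)

lemma pderiv_at_mult:
  assumes "f differentiable at x" "g differentiable at x"
  shows "pderiv_at i (\<lambda>x. f x * g x) x = f x * pderiv_at i g x + pderiv_at i f x * g x"
  using has_derivative_mult[of f "frechet_derivative f (at x)" x UNIV g "frechet_derivative g (at x)"] assms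
  by (subst pderiv_at_eq) (auto simp: frechet_derivative_works pderiv_at_def)

lemma pderiv_at_const [simp]: "pderiv_at i (\<lambda>x. c) = (\<lambda>x. 0)"
  by (auto simp: fun_eq_iff intro: pderiv_at_eq)

lemma Ck_const [simp]: "Ck k (\<lambda>x. c)"
  by (induction k arbitrary: c) auto

lemma Ck_add: "Ck k f \<Longrightarrow> Ck k g \<Longrightarrow> Ck k (\<lambda>x. f x + g x)"
proof (induction k arbitrary: f g)
  case 0 thus ?case by (auto intro: continuous_intros)
next
  case (Suc k)
  hence d: "f differentiable at x" "g differentiable at x" for x
    by (auto simp: differentiable_on_def)
  have "pderiv_at i (\<lambda>x. f x + g x) = (\<lambda>x. pderiv_at i f x + pderiv_at i g x)" for i
    using pderiv_at_add[OF d] by auto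
  thus ?case using Suc d by (auto simp: differentiable_on_def)
qed

lemma Ck_mult: "Ck k f \<Longrightarrow> Ck k g \<Longrightarrow> Ck k (\<lambda>x. f x * g x)"
proof (induction k arbitrary: f g)
  case 0 thus ?case by (auto intro: continuous_intros)
next
  case (Suc k)
  hence d: "f differentiable at x" "g differentiable at x" for x
    by (auto simp: differentiable_on_def)
  have "pderiv_at i (\<lambda>x. f x * g x) = (\<lambda>x. f x * pderiv_at i g x + pderiv_at i f x * g x)" for i
    using pderiv_at_mult[OF d] by auto
  moreover have "Ck k f" "Ck k g" using Suc.prems by (auto intro: Ck_Suc_imp)
  ultimately show ?case using Suc d by (auto simp: differentiable_on_def intro!: Ck_add)
qed

lemma smooth_const [simp]: "smooth (\<lambda>x. c)" by (simp add: smooth_def)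
lemma smooth_add: "smooth f \<Longrightarrow> smooth g \<Longrightarrow> smooth (\<lambda>x. f x + g x)" by (simp add: smooth_def Ck_add)
lemma smooth_mult: "smooth f \<Longrightarrow> smooth g \<Longrightarrow> smooth (\<lambda>x. f x * g x)" by (simp add: smooth_def Ck_mult)
lemma smooth_uminus: "smooth f \<Longrightarrow> smooth (\<lambda>x. - f x)" using smooth_mult[of "\<lambda>x. -1" f] by simp
lemma smooth_diff: "smooth f \<Longrightarrow> smooth g \<Longrightarrow> smooth (\<lambda>x. f x - g x)"
  using smooth_add[of f "\<lambda>x. - g x"] smooth_uminus[of g] by simp
lemma smooth_prod: "(\<And>i. i \<in> I \<Longrightarrow> smooth (f i)) \<Longrightarrow> smooth (\<lambda>x. \<Prod>i\<in>I. f i x)"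
  by (induction I rule: infinite_finite_induct) (auto intro: smooth_mult)

lemma smooth_differentiable: "smooth \<phi> \<Longrightarrow> \<phi> differentiable at x"
  using smoothD1 differentiable_def by blast

text \<open>A tower of successive derivatives on the line makes every ridge function
  \<open>D n (x \<bullet> i)\<close> smooth, since each partial derivative is a constant times the
  ridge function one level up. It serves the bump functions as well as the exponentials.\<close>

lemma smooth_inner:
  fixes i :: "'a::euclidean_space"
  assumes D: "\<And>n x. (D n has_vector_derivative D (Suc n) x) (at (x::real))"
  shows "smooth (\<lambda>x. D n (x \<bullet> i) :: complex)"
proof -
  have der: "((\<lambda>x. D n (x \<bullet> i)) has_derivative (\<lambda>h. (h \<bullet> i) *\<^sub>R D (Suc n) (x \<bullet> i))) (at x)" for n x
  proof -
    have g: "(D n has_derivative (\<lambda>h. h *\<^sub>R D (Suc n) (x \<bullet> i))) (at (x \<bullet> i))"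
      using D[of n "x \<bullet> i"] by (simp add: has_vector_derivative_def)
    have l: "((\<lambda>x. x \<bullet> i) has_derivative (\<lambda>h. h \<bullet> i)) (at x)" by (auto intro: derivative_eq_intros)
    show ?thesis by (rule has_derivative_compose[OF l g])
  qed
  have "Ck k (\<lambda>x. D n (x \<bullet> i))" for k n
  proof (induction k arbitrary: n)
    case 0
    show ?case using der by (auto intro!: has_derivative_continuous continuous_at_imp_continuous_on)
  next
    case (Suc k)
    have "pderiv_at j (\<lambda>x. D n (x \<bullet> i)) = (\<lambda>x. of_real (j \<bullet> i) * D (Suc n) (x \<bullet> i))" for j
      by (auto simp: fun_eq_iff scaleR_conv_of_real intro!: pderiv_at_eq[OF der, THEN trans])
    moreover have "(\<lambda>x. D n (x \<bullet> i)) differentiable at x" for x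
      using der differentiable_def by blast
    ultimately show ?case using Suc by (auto simp: differentiable_on_def intro: Ck_mult)
  qed
  thus ?thesis by (simp add: smooth_def)
qed

section \<open>Smooth cutoff functions on boxes\<close>

definition pexp :: "real poly \<Rightarrow> real \<Rightarrow> real" where
  "pexp p x = (if x > 0 then poly p (1/x) * exp (- (1/x)) else 0)"

lemma poly_div_exp_tendsto_0: "((\<lambda>t. poly p t * exp (- t)) \<longlongrightarrow> (0::real)) at_top"
proof -
  have "((\<lambda>t. \<Sum>i\<le>degree p. coeff p i * (t ^ i / exp t)) \<longlongrightarrow> (\<Sum>i\<le>degree p. coeff p i * 0)) at_top"
    by (intro tendsto_intros tendsto_power_div_exp_0)
  thus ?thesis by (simp add: poly_altdef exp_minus divide_inverse sum_distrib_right mult.assoc)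
qed

text \<open>With t = 1/x the derivative of p(t) exp(-t) is t^2 (p - p')(t) exp(-t), so the family is
  closed under differentiation and derivatives of all orders come at once. At 0 the right difference
  quotient is the member belonging to X p, which tends to 0.\<close>

lemma pexp_has_derivative:
  "(pexp p has_field_derivative pexp ([:0,0,1:] * (p - pderiv p)) x) (at x)"
proof -
  consider "x < 0" | "x = 0" | "x > 0" by linarith
  thus ?thesis
  proof cases
    case 1
    have "((\<lambda>x. 0) has_field_derivative pexp ([:0,0,1:] * (p - pderiv p)) x) (at x)"
      using 1 by (simp add: pexp_def)
    thus ?thesis
      by (rule has_field_derivative_transform_within_open[of _ _ _ "{..<0}"]) (use 1 in \<open>auto simp: pexp_def\<close>)
  next
    case 3
    have "((\<lambda>x. poly p (1/x) * exp (- (1/x))) has_field_derivative pexp ([:0,0,1:] * (p - pderiv p)) x) (at x)"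
      using 3 by (auto intro!: derivative_eq_intros poly_DERIV[THEN DERIV_chain2]
        simp: pexp_def field_simps power2_eq_square)
    thus ?thesis
      by (rule has_field_derivative_transform_within_open[of _ _ _ "{0<..}"]) (use 3 in \<open>auto simp: pexp_def\<close>)
  next
    case 2
    have r: "((\<lambda>h. poly ([:0,1:]*p) (1/h) * exp (- (1/h))) \<longlongrightarrow> 0) (at_right (0::real))"
      by (rule filterlim_compose[OF poly_div_exp_tendsto_0])
         (simp add: filterlim_inverse_at_top_right flip: inverse_eq_divide)
    have "((\<lambda>h. pexp p h / h) \<longlongrightarrow> 0) (at_right 0)"
      by (rule Lim_transform_eventually[OF r]) (auto simp: pexp_def eventually_at_filter)
    moreover have "((\<lambda>h. pexp p h / h) \<longlongrightarrow> 0) (at_left 0)"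
      by (rule Lim_transform_eventually[OF tendsto_const]) (auto simp: pexp_def eventually_at_filter)
    ultimately have "((\<lambda>h. pexp p h / h) \<longlongrightarrow> 0) (at 0)"
      by (simp add: filterlim_split_at)
    thus ?thesis using 2 by (simp add: has_field_derivative_iff pexp_def)
  qed
qed

definition bump :: "real \<Rightarrow> real" where "bump = pexp 1"

lemma bump_simps: "x \<le> 0 \<Longrightarrow> bump x = 0" "x > 0 \<Longrightarrow> bump x = exp (- (1/x))"
  by (auto simp: bump_def pexp_def)

lemma bump_bounds: "0 \<le> bump x" "bump x \<le> 1"
  by (auto simp: bump_def pexp_def)

lemma smooth_bump_affine:
  fixes i :: "'a::euclidean_space"
  shows "smooth (\<lambda>x. complex_of_real (bump (s * (x \<bullet> i) + t)))"
proof -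
  \<comment> \<open>\<open>P n\<close> is the polynomial of the n-th derivative of
    \<open>bump\<close>; the powers of s in \<open>D\<close> come from the chain rule.\<close>
  define P where "P = rec_nat 1 (\<lambda>n p. [:0,0,1:] * (p - pderiv p) :: real poly)"
  define D where "D = (\<lambda>n y. complex_of_real (s^n * pexp (P n) (s * y + t)))"
  have "(D n has_vector_derivative D (Suc n) y) (at y)" for n y
    unfolding D_def
    by (intro has_vector_derivative_of_real)
       (auto intro!: derivative_eq_intros DERIV_chain2[OF pexp_has_derivative]
          simp: P_def has_real_derivative_iff_has_vector_derivative[symmetric])
  from smooth_inner[of D, OF this, where n=0] show ?thesis
    by (simp add: D_def P_def bump_def)
qed

text \<open>In each coordinate the two factors vanish within distance 1/n of the faces, so the
  support is compact inside the open box. At a point of the open box the arguments of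
  \<open>bump\<close> tend to infinity with n, hence the values to 1. Together with the bounds 0 and
  1 this suits dominated convergence.\<close>

definition cutoff :: "'a::euclidean_space \<Rightarrow> 'a \<Rightarrow> nat \<Rightarrow> 'a \<Rightarrow> real" where
  "cutoff a b n x = (\<Prod>i\<in>Basis. bump (real n * (x \<bullet> i) + (- real n * (a \<bullet> i) - 1)) *
                               bump (- real n * (x \<bullet> i) + (real n * (b \<bullet> i) - 1)))"

lemma cutoff_bounds: "0 \<le> cutoff a b n x" "cutoff a b n x \<le> 1"
  unfolding cutoff_def
  by (auto intro!: prod_nonneg prod_le_1 mult_nonneg_nonneg bump_bounds mult_le_one)

lemma cutoff_zero: assumes "x \<notin> box a b" shows "cutoff a b n x = 0"
proof -
  obtain i where i: "i \<in> Basis" "x \<bullet> i \<le> a \<bullet> i \<or> x \<bullet> i \<ge> b \<bullet> i" using assms by (force simp: mem_box)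
  hence "real n * (x \<bullet> i) \<le> real n * (a \<bullet> i) \<or> real n * (b \<bullet> i) \<le> real n * (x \<bullet> i)"
    by (auto intro: mult_left_mono)
  thus ?thesis unfolding cutoff_def using i(1)
    by (intro prod_zero bexI[of _ i]) (auto simp: bump_simps)
qed

lemma bump_tendsto_1: "c > 0 \<Longrightarrow> (\<lambda>n. bump (real n * c - 1)) \<longlonglongrightarrow> 1"
proof -
  assume c: "c > 0"
  have lin: "filterlim (\<lambda>n. real n * c - 1) at_top sequentially"
    using c by real_asymp
  have "((\<lambda>x::real. exp (- (1/x))) \<longlongrightarrow> 1) at_top" by real_asymp
  hence "(bump \<longlongrightarrow> 1) at_top"
    by (rule Lim_transform_eventually) (auto simp: bump_simps eventually_at_top_linorder intro!: exI[of _ 1])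
  from filterlim_compose[OF this lin] show ?thesis .
qed

lemma cutoff_tendsto: assumes "x \<in> box a b" shows "(\<lambda>n. cutoff a b n x) \<longlonglongrightarrow> 1"
proof -
  have "(\<lambda>n. cutoff a b n x) \<longlonglongrightarrow> (\<Prod>i\<in>(Basis::'a set). 1 * 1)"
    unfolding cutoff_def
  proof (intro tendsto_prod tendsto_mult)
    fix i :: 'a assume i: "i \<in> Basis"
    have eq: "real n * (x \<bullet> i) + (- real n * (a \<bullet> i) - 1) = real n * (x \<bullet> i - a \<bullet> i) - 1"
         "- real n * (x \<bullet> i) + (real n * (b \<bullet> i) - 1) = real n * (b \<bullet> i - x \<bullet> i) - 1" for n
      by (auto simp: algebra_simps)
    show "(\<lambda>n. bump (real n * (x \<bullet> i) + (- real n * (a \<bullet> i) - 1))) \<longlonglongrightarrow> 1"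
         "(\<lambda>n. bump (- real n * (x \<bullet> i) + (real n * (b \<bullet> i) - 1))) \<longlonglongrightarrow> 1"
      unfolding eq by (intro bump_tendsto_1; use assms i in \<open>auto simp: mem_box\<close>)+
  qed
  thus ?thesis by simp
qed

lemma smooth_cutoff: "smooth (\<lambda>x. complex_of_real (cutoff a b n x))"
  unfolding cutoff_def of_real_prod of_real_mult
  by (intro smooth_prod smooth_mult smooth_bump_affine)

lemma cutoff_nz_bounds:
  assumes "cutoff a b n x \<noteq> 0"
  shows "x \<in> cbox (a + (1 / real n) *\<^sub>R One) (b - (1 / real n) *\<^sub>R One)" "n > 0"
proof -
  have *: "bump (real n * (x \<bullet> i) + (- real n * (a \<bullet> i) - 1)) \<noteq> 0"
    "bump (- real n * (x \<bullet> i) + (real n * (b \<bullet> i) - 1)) \<noteq> 0" if "i \<in> Basis" for i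
    using assms that unfolding cutoff_def by (auto simp: prod_zero_iff)
  hence ** : "real n * (x \<bullet> i) + (- real n * (a \<bullet> i) - 1) > 0"
    "- real n * (x \<bullet> i) + (real n * (b \<bullet> i) - 1) > 0" if "i \<in> Basis" for i
    using bump_simps(1) that by (meson not_le)+
  show "n > 0" using **(1)[OF SOME_Basis] by (cases n) auto
  thus "x \<in> cbox (a + (1 / real n) *\<^sub>R One) (b - (1 / real n) *\<^sub>R One)"
    using ** by (force simp: mem_box inner_add_left inner_diff_left field_simps)
qed

lemma test_functionI:
  assumes "smooth \<phi>" "compact K" "K \<subseteq> interior \<Omega>" "\<And>x. x \<notin> K \<Longrightarrow> \<phi> x = 0"
  shows "test_function \<Omega> \<phi>"
proof -
  have "{x. \<phi> x \<noteq> 0} \<subseteq> K" using assms(4) by auto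
  moreover from this have "closure {x. \<phi> x \<noteq> 0} \<subseteq> K"
    by (intro closure_minimal compact_imp_closed assms)
  ultimately show ?thesis using assms(1,3) compact_imp_bounded[OF assms(2)]
    unfolding test_function_def smooth_def compact_closure by (auto intro: bounded_subset)
qed

lemma test_function_mult_cutoff:
  assumes "smooth f" "box a b \<subseteq> \<Omega>"
  shows "test_function \<Omega> (\<lambda>x. f x * complex_of_real (cutoff a b n x))"
proof -
  \<comment> \<open>For n = 0 every factor is \<open>bump\<close> at -1 and the cutoff vanishes
    identically; the general formula, with 1 / 0 = 0, would give the whole closed box.\<close>
  define S where "S = (if n = 0 then {} else cbox (a + (1 / real n) *\<^sub>R One) (b - (1 / real n) *\<^sub>R One))"
  have S: "compact S" by (auto simp: S_def)
  have "S \<subseteq> box a b"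
  proof
    fix x assume "x \<in> S"
    hence n: "1 / real n > 0" and x: "x \<in> cbox (a + (1 / real n) *\<^sub>R One) (b - (1 / real n) *\<^sub>R One)"
      by (auto simp: S_def split: if_splits)
    show "x \<in> box a b" unfolding mem_box
    proof (intro ballI conjI)
      fix i :: 'a assume i: "i \<in> Basis"
      hence "a \<bullet> i + 1 / real n \<le> x \<bullet> i" "x \<bullet> i \<le> b \<bullet> i - 1 / real n"
        using x by (auto simp: mem_box inner_add_left inner_diff_left)
      thus "a \<bullet> i < x \<bullet> i" "x \<bullet> i < b \<bullet> i" using n by linarith+
    qed
  qed
  also have "\<dots> \<subseteq> interior \<Omega>" by (rule interior_maximal[OF assms(2) open_box])
  finally show ?thesis
    by (intro test_functionI[OF smooth_mult[OF assms(1) smooth_cutoff] S])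
       (use cutoff_nz_bounds[of a b n] in \<open>auto simp: S_def split: if_splits\<close>)
qed

text \<open>The restricted measure replaces set integrals over the domain, so that the L2 facts for
  arbitrary measures apply verbatim.\<close>

abbreviation leb :: "'a::euclidean_space set \<Rightarrow> 'a measure" where
  "leb \<Omega> \<equiv> restrict_space lborel \<Omega>"

lemma L2_iff: assumes "\<Omega> \<in> sets borel" shows "u \<in> L2 \<Omega> \<longleftrightarrow> sq_int (leb \<Omega>) u"
  using assms unfolding L2_def sq_int_def set_borel_measurable_def
  by (simp add: borel_measurable_restrict_space_iff integrable_restrict_space set_integrable_def)

lemma set_lint_leb:
  fixes f :: "'a::euclidean_space \<Rightarrow> 'b::{banach,second_countable_topology}"
  assumes "\<Omega> \<in> sets borel" shows "(LINT x:\<Omega>|lborel. f x) = (\<integral>x. f x \<partial>leb \<Omega>)"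
  using assms by (simp add: set_lebesgue_integral_def integral_restrict_space)

section \<open>Test functions and integration by parts\<close>

lemma test_functionD:
  assumes "test_function \<Omega> \<phi>"
  shows "smooth \<phi>" "compact (closure {x. \<phi> x \<noteq> 0})" "closure {x. \<phi> x \<noteq> 0} \<subseteq> interior \<Omega>"
  using assms by (auto simp: test_function_def smooth_def)

lemma test_function_support:
  assumes "test_function \<Omega> \<phi>"
  obtains K where "compact K" "K \<subseteq> interior \<Omega>" "\<And>x. x \<notin> K \<Longrightarrow> \<phi> x = 0"
proof
  show "compact (closure {x. \<phi> x \<noteq> 0})" "closure {x. \<phi> x \<noteq> 0} \<subseteq> interior \<Omega>"
    using test_functionD[OF assms] by auto
  show "\<And>x. x \<notin> closure {x. \<phi> x \<noteq> 0} \<Longrightarrow> \<phi> x = 0" using closure_subset[of "{x. \<phi> x \<noteq> 0}"] by auto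
qed

lemma pderiv_zero_outside:
  assumes "closed K" "\<And>x. x \<notin> K \<Longrightarrow> \<phi> x = 0" "x \<notin> K" shows "pderiv_at i \<phi> x = 0"
proof -
  have "(\<phi> has_derivative (\<lambda>h. 0)) (at x)"
    by (rule has_derivative_transform_within_open[of "\<lambda>x. 0" _ _ _ "- K"]) (use assms in auto)
  thus ?thesis by (rule pderiv_at_eq)
qed

lemma test_function_pderiv:
  assumes "test_function \<Omega> \<phi>" "i \<in> Basis" shows "test_function \<Omega> (pderiv_at i \<phi>)"
proof -
  obtain K where K: "compact K" "K \<subseteq> interior \<Omega>" "\<And>x. x \<notin> K \<Longrightarrow> \<phi> x = 0"
    using test_function_support[OF assms(1)] by blast
  show ?thesis
    by (rule test_functionI[OF smooth_pderiv[OF test_functionD(1)[OF assms(1)] assms(2)] K(1,2)])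
       (rule pderiv_zero_outside[OF compact_imp_closed[OF K(1)] K(3)])
qed

lemma test_function_mult:
  assumes "test_function \<Omega> \<phi>" "smooth \<psi>" shows "test_function \<Omega> (\<lambda>x. \<phi> x * \<psi> x)"
proof -
  obtain K where K: "compact K" "K \<subseteq> interior \<Omega>" "\<And>x. x \<notin> K \<Longrightarrow> \<phi> x = 0"
    using test_function_support[OF assms(1)] by blast
  show ?thesis
    by (rule test_functionI[OF _ K(1,2)]) (use K assms(2) test_functionD(1)[OF assms(1)] in \<open>auto intro: smooth_mult\<close>)
qed

lemma test_function_add:
  assumes "test_function \<Omega> \<phi>" "test_function \<Omega> \<psi>" shows "test_function \<Omega> (\<lambda>x. \<phi> x + \<psi> x)"
proof -
  obtain K where K: "compact K" "K \<subseteq> interior \<Omega>" "\<And>x. x \<notin> K \<Longrightarrow> \<phi> x = 0"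
    using test_function_support[OF assms(1)] by blast
  obtain L where L: "compact L" "L \<subseteq> interior \<Omega>" "\<And>x. x \<notin> L \<Longrightarrow> \<psi> x = 0"
    using test_function_support[OF assms(2)] by blast
  show ?thesis
    by (rule test_functionI[of _ "K \<union> L"])
       (use K L test_functionD(1)[OF assms(1)] test_functionD(1)[OF assms(2)] in \<open>auto intro: smooth_add\<close>)
qed

lemma test_function_cmult: "test_function \<Omega> \<phi> \<Longrightarrow> test_function \<Omega> (\<lambda>x. c * \<phi> x)"
  using test_function_mult[of \<Omega> \<phi> "\<lambda>_. c"] by (simp add: mult.commute)

lemma test_function_diff:
  "test_function \<Omega> \<phi> \<Longrightarrow> test_function \<Omega> \<psi> \<Longrightarrow> test_function \<Omega> (\<lambda>x. \<phi> x - \<psi> x)"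
  using test_function_add[of \<Omega> \<phi> "\<lambda>x. -1 * \<psi> x"] test_function_cmult[of \<Omega> \<psi> "-1"] by simp

lemma test_function_integrable: assumes "test_function \<Omega> \<phi>" shows "integrable lborel \<phi>"
proof -
  obtain K where K: "compact K" "K \<subseteq> interior \<Omega>" "\<And>x. x \<notin> K \<Longrightarrow> \<phi> x = 0"
    using test_function_support[OF assms(1)] by blast
  have "integrable lborel (\<lambda>x. indicator K x *\<^sub>R \<phi> x)"
    by (rule borel_integrable_compact[OF K(1) smooth_continuous[OF test_functionD(1)[OF assms]]])
  also have "(\<lambda>x. indicator K x *\<^sub>R \<phi> x) = \<phi>" using K by (auto simp: fun_eq_iff indicator_def)
  finally show ?thesis .
qed

lemma test_function_bounded:
  assumes "test_function \<Omega> \<phi>" obtains B where "B > 0" "\<And>x. cmod (\<phi> x) \<le> B"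
proof -
  obtain K where K: "compact K" "K \<subseteq> interior \<Omega>" "\<And>x. x \<notin> K \<Longrightarrow> \<phi> x = 0"
    using test_function_support[OF assms(1)] by blast
  have "bounded (\<phi> ` K)"
    by (intro compact_imp_bounded compact_continuous_image K smooth_continuous test_functionD[OF assms])
  then obtain B where B: "B > 0" "\<And>x. x \<in> K \<Longrightarrow> cmod (\<phi> x) \<le> B" by (auto simp: bounded_pos)
  hence "cmod (\<phi> x) \<le> B" for x using K(3)[of x] B by (cases "x \<in> K") auto
  thus ?thesis by (rule that[OF \<open>B > 0\<close>])
qed

lemma smooth_directional:
  assumes "smooth \<phi>"
  shows "((\<lambda>s. \<phi> (x + s *\<^sub>R i)) has_vector_derivative pderiv_at i \<phi> (x + s *\<^sub>R i)) (at s)"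
proof -
  have "((\<lambda>s. \<phi> (x + s *\<^sub>R i)) has_derivative (\<lambda>h. frechet_derivative \<phi> (at (x + s *\<^sub>R i)) (h *\<^sub>R i))) (at s)"
  proof (rule has_derivative_compose[OF _ smoothD1[OF assms]])
    show "((\<lambda>s. x + s *\<^sub>R i) has_derivative (\<lambda>h. h *\<^sub>R i)) (at s)"
      by (auto intro!: derivative_eq_intros)
  qed
  moreover have "linear (frechet_derivative \<phi> (at (x + s *\<^sub>R i)))"
    using smoothD1[OF assms] has_derivative_linear by blast
  ultimately show ?thesis
    by (simp add: has_vector_derivative_def pderiv_at_def linear_scale)
qed

text \<open>Translation invariance makes the integral of each difference quotient vanish.\<close>

lemma integral_pderiv_test:
  assumes "test_function \<Omega> \<phi>" "i \<in> Basis"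
  shows "(\<integral>x. pderiv_at i \<phi> x \<partial>lborel) = 0"
proof -
  note sm = test_functionD(1)[OF assms(1)]
  define q where "q = (\<lambda>n x. (\<phi> (x + (1 / real (Suc n)) *\<^sub>R i) - \<phi> x) * of_real (real (Suc n)))"
  obtain K where K: "compact K" "K \<subseteq> interior \<Omega>" "\<And>x. x \<notin> K \<Longrightarrow> \<phi> x = 0"
    using test_function_support[OF assms(1)] by blast
  obtain R where R: "\<And>x. x \<in> K \<Longrightarrow> norm x \<le> R" using compact_imp_bounded[OF K(1)] by (auto simp: bounded_iff)
  obtain B where B: "B > 0" "\<And>x. cmod (pderiv_at i \<phi> x) \<le> B"
    using test_function_bounded[OF test_function_pderiv[OF assms]] by metis
  have ph: "integrable lborel \<phi>" by (rule test_function_integrable[OF assms(1)])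
  have [measurable]: "\<phi> \<in> borel_measurable borel" "pderiv_at i \<phi> \<in> borel_measurable borel"
    by (intro borel_measurable_continuous_onI smooth_continuous sm smooth_pderiv assms(2))+
  have tr: "integrable lborel (\<lambda>x. \<phi> (x + c))" "(\<integral>x. \<phi> (x + c) \<partial>lborel) = (\<integral>x. \<phi> x \<partial>lborel)" for c
  proof -
    have "integrable (distr lborel borel ((+) c)) \<phi>" by (simp add: lborel_distr_plus ph)
    thus "integrable lborel (\<lambda>x. \<phi> (x + c))" by (subst (asm) integrable_distr_eq) (auto simp: add.commute)
    have "(\<integral>x. \<phi> x \<partial>lborel) = (\<integral>x. \<phi> x \<partial>distr lborel borel ((+) c))" by (simp add: lborel_distr_plus)
    also have "\<dots> = (\<integral>x. \<phi> (x + c) \<partial>lborel)" by (subst integral_distr) (auto simp: add.commute)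
    finally show "(\<integral>x. \<phi> (x + c) \<partial>lborel) = (\<integral>x. \<phi> x \<partial>lborel)" by simp
  qed
  have q0: "(\<integral>x. q n x \<partial>lborel) = 0" for n
    unfolding q_def by (simp add: tr ph)
  have lim: "(\<lambda>n. \<integral>x. q n x \<partial>lborel) \<longlonglongrightarrow> (\<integral>x. pderiv_at i \<phi> x \<partial>lborel)"
  proof (rule integral_dominated_convergence)
    \<comment> \<open>The mean value theorem bounds the quotients by B, and steps of length at most
      1 keep their supports in the ball of radius R + 1: one integrable majorant for all n.\<close>
    show "integrable lborel (\<lambda>x. indicator (cball 0 (R + 1)) x *\<^sub>R B)"
      by (rule borel_integrable_compact) auto
    show "AE x in lborel. (\<lambda>n. q n x) \<longlonglongrightarrow> pderiv_at i \<phi> x"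
    proof (rule AE_I2)
      fix x
      have "((\<lambda>s. \<phi> (x + s *\<^sub>R i)) has_vector_derivative pderiv_at i \<phi> x) (at 0)"
        using smooth_directional[OF sm, of x i 0] by simp
      hence d: "((\<lambda>h. cmod (\<phi> (x + h *\<^sub>R i) - \<phi> x - h *\<^sub>R pderiv_at i \<phi> x) / \<bar>h\<bar>) \<longlongrightarrow> 0) (at 0)"
        by (simp add: has_vector_derivative_def has_derivative_at)
      have "((\<lambda>h. cmod ((\<phi> (x + h *\<^sub>R i) - \<phi> x) /\<^sub>R h - pderiv_at i \<phi> x)) \<longlongrightarrow> 0) (at 0)"
      proof (rule Lim_transform_eventually[OF d])
        have "cmod (a - h *\<^sub>R b) / \<bar>h\<bar> = cmod (a /\<^sub>R h - b)" if "h \<noteq> 0" for a b h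
        proof -
          have "a /\<^sub>R h - b = (a - h *\<^sub>R b) /\<^sub>R h" using that by (simp add: scaleR_diff_right)
          thus ?thesis by (simp add: divide_inverse mult.commute)
        qed
        thus "\<forall>\<^sub>F h in at 0. cmod (\<phi> (x + h *\<^sub>R i) - \<phi> x - h *\<^sub>R pderiv_at i \<phi> x) / \<bar>h\<bar> =
               cmod ((\<phi> (x + h *\<^sub>R i) - \<phi> x) /\<^sub>R h - pderiv_at i \<phi> x)"
          by (auto simp: eventually_at_filter)
      qed
      hence "((\<lambda>h. (\<phi> (x + h *\<^sub>R i) - \<phi> x) /\<^sub>R h) \<longlongrightarrow> pderiv_at i \<phi> x) (at 0)"
        using Lim_null tendsto_norm_zero_iff by blast
      moreover have "filterlim (\<lambda>n. 1 / real (Suc n)) (at 0) sequentially"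
        unfolding filterlim_at using LIMSEQ_Suc[OF lim_1_over_n] by auto
      ultimately have "(\<lambda>n. (\<phi> (x + (1 / real (Suc n)) *\<^sub>R i) - \<phi> x) /\<^sub>R (1 / real (Suc n))) \<longlonglongrightarrow> pderiv_at i \<phi> x"
        by (rule filterlim_compose)
      thus "(\<lambda>n. q n x) \<longlonglongrightarrow> pderiv_at i \<phi> x"
        by (simp add: q_def scaleR_conv_of_real mult.commute)
    qed
    fix n
    show "AE x in lborel. norm (q n x) \<le> indicator (cball 0 (R + 1)) x *\<^sub>R B"
    proof (rule AE_I2)
      fix x :: 'a
      let ?t = "1 / real (Suc n)"
      show "norm (q n x) \<le> indicator (cball 0 (R + 1)) x *\<^sub>R B"
      proof (cases "norm x \<le> R + 1")
        case True
        have "\<exists>s\<in>{0<..<?t}. norm (\<phi> (x + ?t *\<^sub>R i) - \<phi> (x + 0 *\<^sub>R i)) \<le> norm ((?t - 0) *\<^sub>R pderiv_at i \<phi> (x + s *\<^sub>R i))"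
          by (rule mvt_general)
             (use smooth_directional[OF sm, of x i] in \<open>auto simp: has_vector_derivative_def
               intro!: continuous_at_imp_continuous_on has_derivative_continuous\<close>)
        then obtain s where "norm (\<phi> (x + ?t *\<^sub>R i) - \<phi> x) \<le> ?t * norm (pderiv_at i \<phi> (x + s *\<^sub>R i))" by auto
        also have "\<dots> \<le> ?t * B" by (intro mult_left_mono B) auto
        finally have "norm (\<phi> (x + ?t *\<^sub>R i) - \<phi> x) * real (Suc n) \<le> B"
          by (simp add: field_simps)
        moreover have "norm (q n x) = norm (\<phi> (x + ?t *\<^sub>R i) - \<phi> x) * real (Suc n)"
          by (simp only: q_def norm_mult norm_of_real abs_of_nat)
        ultimately show ?thesis using True by simp
      next
        case False
        have "norm (x + ?t *\<^sub>R i) \<ge> norm x - norm (?t *\<^sub>R i)"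
          using norm_diff_ineq by blast
        moreover have "norm (?t *\<^sub>R i) \<le> 1" using assms(2) by simp
        ultimately have "x + ?t *\<^sub>R i \<notin> K" "x \<notin> K" using False R by (smt (verit))+
        thus ?thesis using K(3) False by (simp add: q_def)
      qed
    qed
  qed (auto simp: q_def)
  thus ?thesis using q0 by (simp add: LIMSEQ_const_iff)
qed

lemma integral_by_parts_test:
  assumes "test_function \<Omega> \<phi>" "smooth \<psi>" "i \<in> Basis"
  shows "(\<integral>x. \<psi> x * pderiv_at i \<phi> x \<partial>lborel) = - (\<integral>x. pderiv_at i \<psi> x * \<phi> x \<partial>lborel)"
proof -
  have d: "\<phi> differentiable at x" "\<psi> differentiable at x" for x
    using smooth_differentiable test_functionD(1) assms by blast+
  have "integrable lborel (\<lambda>x. pderiv_at i \<phi> x * \<psi> x)" "integrable lborel (\<lambda>x. \<phi> x * pderiv_at i \<psi> x)"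
    by (rule test_function_integrable[OF test_function_mult[OF test_function_pderiv[OF assms(1,3)] assms(2)]]
             test_function_integrable[OF test_function_mult[OF assms(1) smooth_pderiv[OF assms(2,3)]]])+
  moreover have "(\<integral>x. \<phi> x * pderiv_at i \<psi> x + pderiv_at i \<phi> x * \<psi> x \<partial>lborel) = 0"
    using integral_pderiv_test[OF test_function_mult[OF assms(1,2)] assms(3)] by (simp add: pderiv_at_mult[OF d])
  ultimately show ?thesis by (simp add: mult.commute add_eq_0_iff)
qed

text \<open>Cutoffs converge boundedly to indicators of boxes, so v has zero integral over every
  open subbox. Open boxes are stable under intersection and generate the Borel sets, hence the
  integrals over all Borel sets vanish. The boundary of the closed box is a null set.\<close>

lemma fundamental_lemma:
  fixes a b :: "'a::euclidean_space"
  assumes int: "integrable (leb (cbox a b)) v"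
    and orth: "\<And>\<phi>. test_function (cbox a b) \<phi> \<Longrightarrow> (\<integral>x. v x * \<phi> x \<partial>leb (cbox a b)) = 0"
  shows "AE x in leb (cbox a b). v x = 0"
proof -
  define V where "V = (\<lambda>x. indicator (cbox a b) x *\<^sub>R v x)"
  define V' where "V' = (\<lambda>x. indicator (box a b) x *\<^sub>R v x)"
  have intV: "integrable lborel V"
    using int unfolding V_def by (simp add: integrable_restrict_space)
  have [measurable]: "V \<in> borel_measurable borel" using intV by simp
  have V'eq: "V' = (\<lambda>x. indicator (box a b) x *\<^sub>R V x)"
    using box_subset_cbox[of a b] by (auto simp: V_def V'_def indicator_def fun_eq_iff)
  have [measurable]: "V' \<in> borel_measurable borel" unfolding V'eq by measurable
  have intV': "integrable lborel V'"
    by (rule Bochner_Integration.integrable_bound[OF intV]) (auto simp: V'eq indicator_def)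
  have orthV: "(\<integral>x. V x * \<phi> x \<partial>lborel) = 0" if "test_function (cbox a b) \<phi>" for \<phi>
    using orth[OF that] by (simp add: integral_restrict_space V_def)
  have box0: "(\<integral>x. indicator (box c d) x *\<^sub>R V' x \<partial>lborel) = 0" for c d
  proof -
    \<comment> \<open>The second cutoff keeps the product a test function of the given box even when
      \<open>box c d\<close> sticks out of it.\<close>
    have "(\<lambda>n. \<integral>x. V x * (complex_of_real (cutoff c d n x) * complex_of_real (cutoff a b n x)) \<partial>lborel)
        \<longlonglongrightarrow> (\<integral>x. indicator (box c d) x *\<^sub>R V' x \<partial>lborel)"
    proof (rule integral_dominated_convergence[where w="\<lambda>x. norm (V x)"])
      show "AE x in lborel. (\<lambda>n. V x * (complex_of_real (cutoff c d n x) * complex_of_real (cutoff a b n x)))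
             \<longlonglongrightarrow> indicator (box c d) x *\<^sub>R V' x"
      proof (rule AE_I2)
        fix x
        have ind: "(\<lambda>n. complex_of_real (cutoff c d n x)) \<longlonglongrightarrow> indicator (box c d) x" for c d :: 'a
        proof (cases "x \<in> box c d")
          case True
          thus ?thesis using tendsto_of_real[OF cutoff_tendsto[OF True]] by simp
        qed (simp add: cutoff_zero)
        have "(\<lambda>n. V x * (complex_of_real (cutoff c d n x) * complex_of_real (cutoff a b n x)))
           \<longlonglongrightarrow> V x * (indicator (box c d) x * indicator (box a b) x)"
          by (intro tendsto_intros ind)
        also have "V x * (indicator (box c d) x * indicator (box a b) x) = indicator (box c d) x *\<^sub>R V' x"
          by (simp add: V'eq indicator_def)
        finally show "(\<lambda>n. V x * (complex_of_real (cutoff c d n x) * complex_of_real (cutoff a b n x)))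
             \<longlonglongrightarrow> indicator (box c d) x *\<^sub>R V' x" .
      qed
      show "AE x in lborel. norm (V x * (complex_of_real (cutoff c d n x) * complex_of_real (cutoff a b n x))) \<le> norm (V x)" for n
        by (intro AE_I2) (auto simp: norm_mult cutoff_bounds intro!: mult_right_le_one_le mult_le_one)
      have [measurable]: "(\<lambda>x. complex_of_real (cutoff c d n x)) \<in> borel_measurable borel" for c d :: 'a and n
        by (intro borel_measurable_continuous_onI smooth_continuous smooth_cutoff)
      show "(\<lambda>x. V x * (complex_of_real (cutoff c d n x) * complex_of_real (cutoff a b n x))) \<in> borel_measurable lborel" for n
        by measurable
    qed (use intV in auto)
    moreover have "(\<integral>x. V x * (complex_of_real (cutoff c d n x) * complex_of_real (cutoff a b n x)) \<partial>lborel) = 0" for n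
      by (rule orthV, rule test_function_mult_cutoff) (auto simp: smooth_cutoff box_subset_cbox)
    ultimately show ?thesis by (simp add: LIMSEQ_const_iff)
  qed
  have set0: "(\<integral>x. indicator A x *\<^sub>R V' x \<partial>lborel) = 0" if "A \<in> sets borel" for A
  proof -
    have A: "A \<in> sigma_sets UNIV (range (\<lambda>(a, b). box a b :: 'a set))"
      using that by (simp add: borel_eq_box)
    show ?thesis
    proof (rule sigma_sets_induct_disjoint[OF _ _ A])
      show "Int_stable (range (\<lambda>(a, b). box a b :: 'a set))"
        by (auto simp: Int_stable_def box_Int_box)
      show "(\<integral>x. indicator A x *\<^sub>R V' x \<partial>lborel) = 0" if "A \<in> range (\<lambda>(a, b). box a b)" for A
        using that box0 by auto
      have UN: "(\<integral>x. V' x \<partial>lborel) = 0"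
      proof -
        have "V' = (\<lambda>x. indicator (box a b) x *\<^sub>R V' x)" by (auto simp: V'_def indicator_def)
        thus ?thesis using box0[of a b] by simp
      qed
      fix A assume A: "A \<in> sigma_sets UNIV (range (\<lambda>(a, b). box a b :: 'a set))"
         and z: "(\<integral>x. indicator A x *\<^sub>R V' x \<partial>lborel) = 0"
      have [measurable]: "A \<in> sets borel" using A by (simp add: borel_eq_box)
      have "integrable lborel (\<lambda>x. indicator A x *\<^sub>R V' x)"
        by (rule Bochner_Integration.integrable_bound[OF intV']) (auto simp: indicator_def)
      moreover have "(\<lambda>x. indicator (UNIV - A) x *\<^sub>R V' x) = (\<lambda>x. V' x - indicator A x *\<^sub>R V' x)"
        by (auto simp: indicator_def)
      ultimately show "(\<integral>x. indicator (UNIV - A) x *\<^sub>R V' x \<partial>lborel) = 0"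
        using UN z intV' by simp
    next
      fix A :: "nat \<Rightarrow> 'a set"
      assume dis: "disjoint_family A" and A: "range A \<subseteq> sigma_sets UNIV (range (\<lambda>(a, b). box a b :: 'a set))"
         and z: "\<And>i. (\<integral>x. indicator (A i) x *\<^sub>R V' x \<partial>lborel) = 0"
      have [measurable]: "A i \<in> sets borel" for i using A by (auto simp: borel_eq_box)
      have "set_integrable lborel (\<Union>i. A i) V'" unfolding set_integrable_def
        by (rule Bochner_Integration.integrable_bound[OF intV']) (auto simp: indicator_def)
      from lebesgue_integral_countable_add[OF _ _ this]
      show "(\<integral>x. indicator (\<Union>i. A i) x *\<^sub>R V' x \<partial>lborel) = 0"
        using z dis by (simp add: set_lebesgue_integral_def disjoint_family_on_def)
    qed auto
  qed
  have set1: "integrable lborel (\<lambda>x. indicator A x *\<^sub>R V' x)" if [measurable]: "A \<in> sets borel" for A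
    by (rule Bochner_Integration.integrable_bound[OF intV']) (auto simp: indicator_def)
  have "AE x in lborel. Re (V' x) = 0"
  proof (rule density_unique_real)
    fix A :: "'a set" assume A: "A \<in> sets lborel"
    have "(\<integral>x. Re (indicator A x *\<^sub>R V' x) \<partial>lborel) = 0"
      using integral_Re[OF set1, of A] set0[of A] A by simp
    thus "(LINT x:A|lborel. Re (V' x)) = (LINT x:A|lborel. 0)"
      by (simp add: set_lebesgue_integral_def)
  qed (use intV' in auto)
  moreover have "AE x in lborel. Im (V' x) = 0"
  proof (rule density_unique_real)
    fix A :: "'a set" assume A: "A \<in> sets lborel"
    have "(\<integral>x. Im (indicator A x *\<^sub>R V' x) \<partial>lborel) = 0"
      using integral_Im[OF set1, of A] set0[of A] A by simp
    thus "(LINT x:A|lborel. Im (V' x)) = (LINT x:A|lborel. 0)"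
      by (simp add: set_lebesgue_integral_def)
  qed (use intV' in auto)
  moreover have "AE x in lborel. x \<notin> cbox a b - box a b"
    by (rule AE_not_in)
       (simp add: null_sets_def emeasure_Diff box_subset_cbox emeasure_lborel_cbox_eq emeasure_lborel_box_eq)
  ultimately have "AE x in lborel. x \<in> cbox a b \<longrightarrow> v x = 0"
    by eventually_elim (auto simp: V'_def complex_eq_iff split: split_indicator_asm)
  thus ?thesis by (simp add: AE_restrict_space_iff)
qed

section \<open>Weak derivatives as limits of test functions\<close>

lemma sq_int_restrict: assumes "sq_int lborel f" "\<Omega> \<in> sets borel" shows "sq_int (leb \<Omega>) f"
proof -
  have [measurable]: "f \<in> borel_measurable borel" "\<Omega> \<in> sets borel" using assms by (auto simp: sq_int_def)
  have "integrable lborel (\<lambda>x. indicator \<Omega> x *\<^sub>R (cmod (f x))\<^sup>2)"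
    by (rule Bochner_Integration.integrable_bound[of lborel "\<lambda>x. (cmod (f x))\<^sup>2"])
       (use assms in \<open>auto simp: sq_int_def indicator_def\<close>)
  thus ?thesis using assms(2) by (auto simp: sq_int_def integrable_restrict_space measurable_restrict_space1)
qed

lemma test_function_sq_int_lborel: assumes "test_function \<Omega> \<phi>" shows "sq_int lborel \<phi>"
proof -
  obtain B where B: "B > 0" "\<And>x. cmod (\<phi> x) \<le> B" using test_function_bounded[OF assms] by blast
  have i: "integrable lborel \<phi>" by (rule test_function_integrable[OF assms])
  have "integrable lborel (\<lambda>x. (cmod (\<phi> x))\<^sup>2)"
    by (rule Bochner_Integration.integrable_bound[of lborel "\<lambda>x. of_real B * \<phi> x"])
       (use i B in \<open>auto simp: norm_mult power2_eq_square intro!: mult_right_mono\<close>)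
  thus ?thesis using i by (auto simp: sq_int_def)
qed

lemma test_function_sq_int:
  assumes "test_function \<Omega> \<phi>" "\<Omega>' \<in> sets borel" shows "sq_int (leb \<Omega>') \<phi>"
  by (rule sq_int_restrict[OF test_function_sq_int_lborel[OF assms(1)] assms(2)])

lemma test_function_zero_outside: "test_function \<Omega> \<phi> \<Longrightarrow> x \<notin> \<Omega> \<Longrightarrow> \<phi> x = 0"
  using test_function_support[of \<Omega> \<phi>] interior_subset by (metis subsetD)

lemma test_function_lint:
  fixes f :: "'a::euclidean_space \<Rightarrow> complex"
  assumes "test_function \<Omega> \<phi>" "\<Omega> \<in> sets borel"
  shows "(\<integral>x. f x * \<phi> x \<partial>leb \<Omega>) = (\<integral>x. f x * \<phi> x \<partial>lborel)"
proof -
  have "indicator \<Omega> x *\<^sub>R (f x * \<phi> x) = f x * \<phi> x" for x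
    using test_function_zero_outside[OF assms(1), of x] by (auto simp: indicator_def)
  thus ?thesis using assms(2) by (simp add: integral_restrict_space)
qed

lemma integral_by_parts_test_leb:
  assumes "test_function \<Omega> \<phi>" "smooth \<psi>" "i \<in> Basis" "\<Omega> \<in> sets borel"
  shows "(\<integral>x. \<psi> x * pderiv_at i \<phi> x \<partial>leb \<Omega>) = - (\<integral>x. pderiv_at i \<psi> x * \<phi> x \<partial>leb \<Omega>)"
  by (simp only: test_function_lint[OF test_function_pderiv[OF assms(1,3)] assms(4)]
       test_function_lint[OF assms(1,4)] integral_by_parts_test[OF assms(1-3)])

lemma finite_measure_leb [simp]: "finite_measure (leb (cbox a b))"
  by (rule finite_measureI) (use emeasure_lborel_cbox_finite[of a b] in \<open>auto simp: emeasure_restrict_space space_restrict_space less_top\<close>)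

lemma sq_int_integrable:
  assumes "sq_int M f" "finite_measure M" shows "integrable M f"
  using nsq_integral_norm(1)[OF assms] assms(1) by (subst integrable_norm_iff[symmetric]) (auto simp: sq_int_def)

section \<open>Calculus of weak derivatives\<close>

lemma has_weak_pderiv_iff:
  assumes "\<Omega> \<in> sets borel"
  shows "has_weak_pderiv \<Omega> i u v \<longleftrightarrow> sq_int (leb \<Omega>) u \<and> sq_int (leb \<Omega>) v \<and>
     (\<forall>\<phi>. test_function \<Omega> \<phi> \<longrightarrow>
        (\<integral>x. u x * pderiv_at i \<phi> x \<partial>leb \<Omega>) = - (\<integral>x. v x * \<phi> x \<partial>leb \<Omega>))"
  by (simp add: has_weak_pderiv_def L2_iff[OF assms] set_lint_leb[OF assms])

lemma has_weak_pderiv_test: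
  assumes "test_function \<Omega> \<phi>" "i \<in> Basis" "\<Omega> \<in> sets borel"
  shows "has_weak_pderiv \<Omega> i \<phi> (pderiv_at i \<phi>)"
  unfolding has_weak_pderiv_iff[OF assms(3)]
  using test_function_sq_int[OF assms(1,3)] test_function_sq_int[OF test_function_pderiv[OF assms(1,2)] assms(3)]
        integral_by_parts_test_leb[OF _ test_functionD(1)[OF assms(1)] assms(2,3)] by blast

text \<open>Weak differentiation is a closed operator: both sides of its defining identity are L2
  pairings with a fixed test function.\<close>

lemma has_weak_pderiv_lim:
  assumes "\<And>n. has_weak_pderiv \<Omega> i (F n) (G n)" "L2_lim (leb \<Omega>) F u" "L2_lim (leb \<Omega>) G v"
    "i \<in> Basis" "\<Omega> \<in> sets borel"
  shows "has_weak_pderiv \<Omega> i u v"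
  unfolding has_weak_pderiv_iff[OF assms(5)]
proof (intro conjI allI impI)
  show "sq_int (leb \<Omega>) u" "sq_int (leb \<Omega>) v" using assms L2_limD(2) by blast+
  fix \<phi> :: "'a \<Rightarrow> complex" assume t: "test_function \<Omega> \<phi>"
  have "(\<lambda>n. \<integral>x. F n x * pderiv_at i \<phi> x \<partial>leb \<Omega>) \<longlonglongrightarrow> (\<integral>x. u x * pderiv_at i \<phi> x \<partial>leb \<Omega>)"
    by (rule lint_mult_lim[OF assms(2) test_function_sq_int[OF test_function_pderiv[OF t assms(4)] assms(5)]])
  moreover have "(\<lambda>n. - (\<integral>x. G n x * \<phi> x \<partial>leb \<Omega>)) \<longlonglongrightarrow> - (\<integral>x. v x * \<phi> x \<partial>leb \<Omega>)"
    by (intro tendsto_minus lint_mult_lim[OF assms(3) test_function_sq_int[OF t assms(5)]])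
  moreover have "(\<integral>x. F n x * pderiv_at i \<phi> x \<partial>leb \<Omega>) = - (\<integral>x. G n x * \<phi> x \<partial>leb \<Omega>)" for n
    using assms(1) t unfolding has_weak_pderiv_iff[OF assms(5)] by blast
  ultimately show "(\<integral>x. u x * pderiv_at i \<phi> x \<partial>leb \<Omega>) = - (\<integral>x. v x * \<phi> x \<partial>leb \<Omega>)"
    using LIMSEQ_unique by auto
qed

lemma has_weak_pderiv_diff:
  assumes "has_weak_pderiv \<Omega> i u v" "has_weak_pderiv \<Omega> i u' v'" "\<Omega> \<in> sets borel" "i \<in> Basis"
  shows "has_weak_pderiv \<Omega> i (\<lambda>x. u x - u' x) (\<lambda>x. v x - v' x)"
  unfolding has_weak_pderiv_iff[OF assms(3)]
proof (intro conjI allI impI)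
  note A = assms(1,2)[unfolded has_weak_pderiv_iff[OF assms(3)]]
  show "sq_int (leb \<Omega>) (\<lambda>x. u x - u' x)" "sq_int (leb \<Omega>) (\<lambda>x. v x - v' x)"
    using A by (blast intro: sq_int_diff)+
  fix \<phi> :: "'a \<Rightarrow> complex" assume t: "test_function \<Omega> \<phi>"
  note t0 = test_function_sq_int[OF t assms(3)]
  note t1 = test_function_sq_int[OF test_function_pderiv[OF t assms(4)] assms(3)]
  have i: "integrable (leb \<Omega>) (\<lambda>x. u x * pderiv_at i \<phi> x)" "integrable (leb \<Omega>) (\<lambda>x. u' x * pderiv_at i \<phi> x)"
     "integrable (leb \<Omega>) (\<lambda>x. v x * \<phi> x)" "integrable (leb \<Omega>) (\<lambda>x. v' x * \<phi> x)"
    using A by (blast intro: integrable_mult_sq t0 t1)+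
  show "(\<integral>x. (u x - u' x) * pderiv_at i \<phi> x \<partial>leb \<Omega>) = - (\<integral>x. (v x - v' x) * \<phi> x \<partial>leb \<Omega>)"
    unfolding left_diff_distrib using A t i by simp
qed

lemma has_weak_pderiv_cong_AE:
  assumes "has_weak_pderiv \<Omega> i u v" "u' \<in> borel_measurable (leb \<Omega>)" "AE x in leb \<Omega>. u' x = u x"
    "\<Omega> \<in> sets borel" "i \<in> Basis"
  shows "has_weak_pderiv \<Omega> i u' v"
proof -
  note A = assms(1)[unfolded has_weak_pderiv_iff[OF assms(4)]]
  have u': "sq_int (leb \<Omega>) u'" using sq_int_cong_AE[OF assms(2) _ assms(3)] A by blast
  have "(\<integral>x. u' x * pderiv_at i \<phi> x \<partial>leb \<Omega>) = (\<integral>x. u x * pderiv_at i \<phi> x \<partial>leb \<Omega>)"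
    if t: "test_function \<Omega> \<phi>" for \<phi>
  proof (rule integral_cong_AE)
    note t1 = test_function_sq_int[OF test_function_pderiv[OF t assms(5)] assms(4)]
    note [measurable] = assms(2) sq_int_measurable[OF A[THEN conjunct1]] sq_int_measurable[OF t1]
    show "(\<lambda>x. u' x * pderiv_at i \<phi> x) \<in> borel_measurable (leb \<Omega>)"
         "(\<lambda>x. u x * pderiv_at i \<phi> x) \<in> borel_measurable (leb \<Omega>)" by measurable
  qed (use assms(3) in auto)
  thus ?thesis using A u' unfolding has_weak_pderiv_iff[OF assms(4)] by metis
qed

lemma has_weak_pderiv_unique:
  assumes "has_weak_pderiv (cbox a b) i u v" "has_weak_pderiv (cbox a b) i u v'"
  shows "AE x in leb (cbox a b). v x = v' x"
proof -
  have B: "cbox a b \<in> sets borel" by simp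
  note A = assms[unfolded has_weak_pderiv_iff[OF B]]
  have sq: "sq_int (leb (cbox a b)) (\<lambda>x. v x - v' x)" using A by (blast intro: sq_int_diff)
  have "AE x in leb (cbox a b). v x - v' x = 0"
  proof (rule fundamental_lemma)
    show "integrable (leb (cbox a b)) (\<lambda>x. v x - v' x)" by (rule sq_int_integrable[OF sq]) simp
    fix \<phi> assume t: "test_function (cbox a b) \<phi>"
    have "integrable (leb (cbox a b)) (\<lambda>x. v x * \<phi> x)" "integrable (leb (cbox a b)) (\<lambda>x. v' x * \<phi> x)"
      using A by (blast intro: integrable_mult_sq test_function_sq_int[OF t B])+
    moreover have "(\<integral>x. v x * \<phi> x \<partial>leb (cbox a b)) = (\<integral>x. v' x * \<phi> x \<partial>leb (cbox a b))"
      using A t by (metis neg_equal_iff_equal)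
    ultimately show "(\<integral>x. (v x - v' x) * \<phi> x \<partial>leb (cbox a b)) = 0" by (simp add: left_diff_distrib)
  qed
  thus ?thesis by auto
qed

lemma weak_pderivI: "has_weak_pderiv \<Omega> i u v \<Longrightarrow> has_weak_pderiv \<Omega> i u (weak_pderiv \<Omega> i u)"
  unfolding weak_pderiv_def by (rule someI[of "has_weak_pderiv \<Omega> i u"])

text \<open>The function picked by \<open>SOME\<close> is again a weak derivative, so uniqueness
  ties it to any derivative that is known explicitly.\<close>

lemma weak_pderiv_eq_AE:
  assumes "has_weak_pderiv (cbox a b) i u v"
  shows "AE x in leb (cbox a b). weak_pderiv (cbox a b) i u x = v x"
  by (rule has_weak_pderiv_unique[OF weak_pderivI[OF assms] assms])

text \<open>The inner derivative is itself a choice, but it differs from v only on a null set, which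
  the weak derivative does not see.\<close>

lemma weak_pderiv_weak_eq_AE:
  assumes "has_weak_pderiv (cbox a b) i u v" "has_weak_pderiv (cbox a b) j v w" "j \<in> Basis"
  shows "has_weak_pderiv (cbox a b) j (weak_pderiv (cbox a b) i u) w"
    "AE x in leb (cbox a b). weak_pderiv (cbox a b) j (weak_pderiv (cbox a b) i u) x = w x"
proof -
  have B: "cbox a b \<in> sets borel" by simp
  show "has_weak_pderiv (cbox a b) j (weak_pderiv (cbox a b) i u) w"
    by (rule has_weak_pderiv_cong_AE[OF assms(2) _ weak_pderiv_eq_AE[OF assms(1)] _ assms(3)])
       (use weak_pderivI[OF assms(1)] in \<open>auto simp: has_weak_pderiv_iff sq_int_def\<close>)
  thus "AE x in leb (cbox a b). weak_pderiv (cbox a b) j (weak_pderiv (cbox a b) i u) x = w x"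
    by (rule weak_pderiv_eq_AE)
qed

text \<open>An explicit certificate for membership in \<open>W22_0\<close>: test functions
  converging to u together with all first and second derivatives. The limits v and w may be any
  convenient representatives. \<open>W22_approx_W22_0\<close> and \<open>W22_0_imp_approx\<close>
  translate to and from the original definition.\<close>

definition W22_approx ::
  "'a::euclidean_space set \<Rightarrow> (nat \<Rightarrow> 'a \<Rightarrow> complex) \<Rightarrow> ('a \<Rightarrow> complex) \<Rightarrow>
    ('a \<Rightarrow> 'a \<Rightarrow> complex) \<Rightarrow> ('a \<Rightarrow> 'a \<Rightarrow> 'a \<Rightarrow> complex) \<Rightarrow> bool" where
  "W22_approx \<Omega> \<phi> u v w \<longleftrightarrow> (\<forall>n. test_function \<Omega> (\<phi> n)) \<and> L2_lim (leb \<Omega>) \<phi> u \<and>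
     (\<forall>i\<in>Basis. L2_lim (leb \<Omega>) (\<lambda>n. pderiv_at i (\<phi> n)) (v i) \<and>
       (\<forall>j\<in>Basis. L2_lim (leb \<Omega>) (\<lambda>n. pderiv_at j (pderiv_at i (\<phi> n))) (w i j)))"

lemma W22_approxD:
  assumes "W22_approx \<Omega> \<phi> u v w"
  shows "test_function \<Omega> (\<phi> n)" "L2_lim (leb \<Omega>) \<phi> u"
    "i \<in> Basis \<Longrightarrow> L2_lim (leb \<Omega>) (\<lambda>n. pderiv_at i (\<phi> n)) (v i)"
    "i \<in> Basis \<Longrightarrow> j \<in> Basis \<Longrightarrow> L2_lim (leb \<Omega>) (\<lambda>n. pderiv_at j (pderiv_at i (\<phi> n))) (w i j)"
  using assms by (auto simp: W22_approx_def)

lemma L2_norm_sq: assumes "\<Omega> \<in> sets borel" shows "(L2_norm \<Omega> u)\<^sup>2 = nsq (leb \<Omega>) u"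
  unfolding L2_norm_def set_lint_leb[OF assms] nsq_def by simp

lemma W22_approx_has_weak:
  assumes "W22_approx (cbox a b) \<phi> u v w" "i \<in> Basis"
  shows "has_weak_pderiv (cbox a b) i u (v i)"
    and "j \<in> Basis \<Longrightarrow> has_weak_pderiv (cbox a b) j (v i) (w i j)"
proof -
  have B: "cbox a b \<in> sets borel" by simp
  have t: "test_function (cbox a b) (\<phi> n)" for n using assms(1) by (simp add: W22_approx_def)
  show "has_weak_pderiv (cbox a b) i u (v i)"
    by (rule has_weak_pderiv_lim[of _ _ \<phi> "\<lambda>n. pderiv_at i (\<phi> n)"])
       (use assms has_weak_pderiv_test[OF t assms(2) B] in \<open>auto simp: W22_approx_def\<close>)
  show "has_weak_pderiv (cbox a b) j (v i) (w i j)" if "j \<in> Basis"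
    by (rule has_weak_pderiv_lim[of _ _ "\<lambda>n. pderiv_at i (\<phi> n)" "\<lambda>n. pderiv_at j (pderiv_at i (\<phi> n))"])
       (use assms that has_weak_pderiv_test[OF test_function_pderiv[OF t assms(2)] that B] in \<open>auto simp: W22_approx_def\<close>)
qed

lemma W22_approx_AE:
  assumes "W22_approx (cbox a b) \<phi> u v w" "i \<in> Basis"
  shows "AE x in leb (cbox a b). weak_pderiv (cbox a b) i u x = v i x"
    and "j \<in> Basis \<Longrightarrow>
      AE x in leb (cbox a b). weak_pderiv (cbox a b) j (weak_pderiv (cbox a b) i u) x = w i j x"
  using weak_pderiv_eq_AE[OF W22_approx_has_weak(1)[OF assms]]
    weak_pderiv_weak_eq_AE(2)[OF W22_approx_has_weak(1)[OF assms] W22_approx_has_weak(2)[OF assms]] by auto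

lemma W22_approx_W22:
  assumes "W22_approx (cbox a b) \<phi> u v w" shows "u \<in> W22 (cbox a b)"
  using W22_approx_has_weak(1)[OF assms] weak_pderiv_weak_eq_AE(1)[OF W22_approx_has_weak(1)[OF assms] W22_approx_has_weak(2)[OF assms]]
    assms L2_limD(2) unfolding W22_def by (auto simp: L2_iff W22_approx_def)

lemma W22_approx_diff_test:
  assumes "W22_approx (cbox a b) \<phi> u v w" "test_function (cbox a b) \<psi>"
  shows "W22_approx (cbox a b) (\<lambda>n x. \<phi> n x - \<psi> x) (\<lambda>x. u x - \<psi> x)
     (\<lambda>i x. v i x - pderiv_at i \<psi> x) (\<lambda>i j x. w i j x - pderiv_at j (pderiv_at i \<psi>) x)"
proof -
  have B: "cbox a b \<in> sets borel" by simp
  have pd: "pderiv_at i (\<lambda>x. f x - g x) = (\<lambda>x. pderiv_at i f x - pderiv_at i g x)"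
    if "smooth f" "smooth g" for f g :: "'a \<Rightarrow> complex" and i
  proof
    fix x
    have g: "(\<lambda>x. -1 * g x) differentiable at x"
      by (intro smooth_differentiable smooth_mult that smooth_const)
    show "pderiv_at i (\<lambda>x. f x - g x) x = pderiv_at i f x - pderiv_at i g x"
      using pderiv_at_add[OF smooth_differentiable[OF that(1)] g, of i]
            pderiv_at_mult[OF differentiable_const smooth_differentiable[OF that(2)], of i "-1" x] by simp
  qed
  have t: "test_function (cbox a b) (\<phi> n)" for n using assms(1) by (simp add: W22_approx_def)
  note s = test_functionD(1)[OF t] test_functionD(1)[OF assms(2)]
  have p1: "pderiv_at i (\<lambda>x. \<phi> n x - \<psi> x) = (\<lambda>x. pderiv_at i (\<phi> n) x - pderiv_at i \<psi> x)" for i n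
    by (rule pd[OF s])
  have p2: "pderiv_at j (pderiv_at i (\<lambda>x. \<phi> n x - \<psi> x)) = (\<lambda>x. pderiv_at j (pderiv_at i (\<phi> n)) x - pderiv_at j (pderiv_at i \<psi>) x)"
    if "i \<in> Basis" for i j n
    unfolding p1 by (intro pd smooth_pderiv s that)
  note W = W22_approxD[OF assms(1)]
  show ?thesis unfolding W22_approx_def
    by (intro conjI allI ballI)
       (auto simp only: p1 p2[unfolded p1] intro!: test_function_diff L2_lim_diff L2_lim_const W assms(2) B
       test_function_sq_int[where \<Omega>="cbox a b"] test_function_pderiv)
qed

lemma nsq_cong_AE_sq:
  assumes "has_weak_pderiv \<Omega> i u f" "sq_int (leb \<Omega>) g" "AE x in leb \<Omega>. f x = g x" "\<Omega> \<in> sets borel"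
  shows "nsq (leb \<Omega>) f = nsq (leb \<Omega>) g"
  using assms by (intro nsq_cong_AE) (auto simp: has_weak_pderiv_iff sq_int_def)

lemma W22_approx_norm:
  assumes "W22_approx (cbox a b) \<phi> u v w"
  shows "(W22_norm (cbox a b) u)\<^sup>2 = nsq (leb (cbox a b)) u + (\<Sum>i\<in>Basis. nsq (leb (cbox a b)) (v i))
     + (\<Sum>i\<in>Basis. \<Sum>j\<in>Basis. nsq (leb (cbox a b)) (w i j))"
proof -
  have B: "cbox a b \<in> sets borel" by simp
  have 1: "nsq (leb (cbox a b)) (weak_pderiv (cbox a b) i u) = nsq (leb (cbox a b)) (v i)" if "i \<in> Basis" for i
    by (rule nsq_cong_AE_sq[OF weak_pderivI[OF W22_approx_has_weak(1)[OF assms that]] _ W22_approx_AE(1)[OF assms that] B])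
       (rule L2_limD(2)[OF W22_approxD(3)[OF assms that]])
  have 2: "nsq (leb (cbox a b)) (weak_pderiv (cbox a b) j (weak_pderiv (cbox a b) i u)) = nsq (leb (cbox a b)) (w i j)"
    if "i \<in> Basis" "j \<in> Basis" for i j
    by (rule nsq_cong_AE_sq[OF weak_pderivI[OF weak_pderiv_weak_eq_AE(1)[OF W22_approx_has_weak(1)[OF assms that(1)]
           W22_approx_has_weak(2)[OF assms that] that(2)]] _ W22_approx_AE(2)[OF assms that] B])
       (rule L2_limD(2)[OF W22_approxD(4)[OF assms that]])
  show ?thesis
    unfolding W22_norm_def L2_norm_sq[OF B]
    by (subst real_sqrt_pow2) (auto intro!: add_nonneg_nonneg sum_nonneg simp: 1 2)
qed

text \<open>The squared W22 distance to \<open>\<phi> n\<close> is a finite sum of squared L2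
  distances, each of which tends to 0 by assumption.\<close>

lemma W22_approx_W22_0:
  assumes "W22_approx (cbox a b) \<phi> u v w" shows "u \<in> W22_0 (cbox a b)"
  unfolding W22_0_def
proof (intro CollectI conjI allI impI)
  show "u \<in> W22 (cbox a b)" by (rule W22_approx_W22[OF assms])
  fix e :: real assume "e > 0"
  have B: "cbox a b \<in> sets borel" by simp
  have t: "test_function (cbox a b) (\<phi> n)" for n using assms(1) by (simp add: W22_approx_def)
  let ?M = "leb (cbox a b)"
  have "(\<lambda>n. (W22_norm (cbox a b) (\<lambda>x. u x - \<phi> n x))\<^sup>2) \<longlonglongrightarrow> 0 + (\<Sum>i\<in>(Basis::'a set). 0) + (\<Sum>i\<in>(Basis::'a set). \<Sum>j\<in>(Basis::'a set). 0)"
    unfolding W22_approx_norm[OF W22_approx_diff_test[OF assms t]]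
    by (intro tendsto_add tendsto_sum; subst nsq_minus_commute)
       (intro L2_limD(3) W22_approxD[OF assms]; assumption)+
  hence "(\<lambda>n. (W22_norm (cbox a b) (\<lambda>x. u x - \<phi> n x))\<^sup>2) \<longlonglongrightarrow> 0" by simp
  from order_tendstoD(2)[OF this, of "e\<^sup>2"] \<open>e > 0\<close>
  obtain n where "(W22_norm (cbox a b) (\<lambda>x. u x - \<phi> n x))\<^sup>2 < e\<^sup>2"
    by (auto simp: eventually_sequentially)
  hence "W22_norm (cbox a b) (\<lambda>x. u x - \<phi> n x) < e" using \<open>e > 0\<close> by (simp add: power2_less_imp_less)
  thus "\<exists>\<phi>. test_function (cbox a b) \<phi> \<and> W22_norm (cbox a b) (\<lambda>x. u x - \<phi> x) < e" using t by blast
qed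

text \<open>Approximants with W22 distance below 1/(n+1) do the job, because the full norm dominates
  each single L2 distance between derivatives.\<close>

lemma W22_0_imp_approx:
  assumes "u \<in> W22_0 (cbox a b)"
  obtains \<phi> where "W22_approx (cbox a b) \<phi> u (\<lambda>i. weak_pderiv (cbox a b) i u)
     (\<lambda>i j. weak_pderiv (cbox a b) j (weak_pderiv (cbox a b) i u))"
proof -
  let ?\<Omega> = "cbox a b" let ?M = "leb ?\<Omega>"
  let ?D = "weak_pderiv ?\<Omega>"
  have B: "?\<Omega> \<in> sets borel" by simp
  have uW: "u \<in> W22 ?\<Omega>" using assms by (simp add: W22_0_def)
  hence u: "sq_int ?M u" by (simp add: W22_def L2_iff)
  have h1: "has_weak_pderiv ?\<Omega> i u (?D i u)" if "i \<in> Basis" for i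
    using uW that weak_pderivI unfolding W22_def by blast
  have h2: "has_weak_pderiv ?\<Omega> j (?D i u) (?D j (?D i u))" if "i \<in> Basis" "j \<in> Basis" for i j
    using uW that weak_pderivI unfolding W22_def by blast
  have s1: "sq_int ?M (?D i u)" if "i \<in> Basis" for i
    using h1[OF that] by (auto simp: has_weak_pderiv_iff)
  have s2: "sq_int ?M (?D j (?D i u))" if "i \<in> Basis" "j \<in> Basis" for i j
    using h2[OF that] by (auto simp: has_weak_pderiv_iff)
  have "\<exists>\<phi>. test_function ?\<Omega> \<phi> \<and> W22_norm ?\<Omega> (\<lambda>x. u x - \<phi> x) < 1 / real (Suc n)" for n
    using assms by (auto simp: W22_0_def)
  then obtain \<phi> where t: "\<And>n. test_function ?\<Omega> (\<phi> n)"
    and lt: "\<And>n. W22_norm ?\<Omega> (\<lambda>x. u x - \<phi> n x) < 1 / real (Suc n)" by metis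
  let ?d = "\<lambda>n x. u x - \<phi> n x"
  have d1: "has_weak_pderiv ?\<Omega> i (?d n) (\<lambda>x. ?D i u x - pderiv_at i (\<phi> n) x)" if "i \<in> Basis" for i n
    by (rule has_weak_pderiv_diff[OF h1[OF that] has_weak_pderiv_test[OF t that B] B that])
  have d2: "has_weak_pderiv ?\<Omega> j (\<lambda>x. ?D i u x - pderiv_at i (\<phi> n) x)
      (\<lambda>x. ?D j (?D i u) x - pderiv_at j (pderiv_at i (\<phi> n)) x)" if "i \<in> Basis" "j \<in> Basis" for i j n
    by (rule has_weak_pderiv_diff[OF h2[OF that] has_weak_pderiv_test[OF test_function_pderiv[OF t that(1)] that(2) B] B that(2)])
  have q1: "nsq ?M (?D i (?d n)) = nsq ?M (\<lambda>x. ?D i u x - pderiv_at i (\<phi> n) x)" if "i \<in> Basis" for i n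
    by (rule nsq_cong_AE_sq[OF weak_pderivI[OF d1[OF that]] _ weak_pderiv_eq_AE[OF d1[OF that]] B])
       (use d1[OF that, of n] in \<open>auto simp: has_weak_pderiv_iff\<close>)
  have q2: "nsq ?M (?D j (?D i (?d n))) = nsq ?M (\<lambda>x. ?D j (?D i u) x - pderiv_at j (pderiv_at i (\<phi> n)) x)"
    if "i \<in> Basis" "j \<in> Basis" for i j n
    by (rule nsq_cong_AE_sq[OF weak_pderivI[OF weak_pderiv_weak_eq_AE(1)[OF d1[OF that(1)] d2[OF that] that(2)]] _
             weak_pderiv_weak_eq_AE(2)[OF d1[OF that(1)] d2[OF that] that(2)] B])
       (use d2[OF that, of n] in \<open>auto simp: has_weak_pderiv_iff\<close>)
  have lt2: "(W22_norm ?\<Omega> (?d n))\<^sup>2 \<le> (1 / real (Suc n))\<^sup>2" for n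
    using lt[of n] by (intro power_mono) (auto simp: W22_norm_def intro!: add_nonneg_nonneg sum_nonneg)
  have W: "(W22_norm ?\<Omega> (?d n))\<^sup>2 = nsq ?M (?d n) + (\<Sum>i\<in>Basis. nsq ?M (?D i (?d n)))
     + (\<Sum>i\<in>Basis. \<Sum>j\<in>Basis. nsq ?M (?D j (?D i (?d n))))" for n
    unfolding W22_norm_def L2_norm_sq[OF B]
    by (subst real_sqrt_pow2) (auto intro!: add_nonneg_nonneg sum_nonneg)
  have lim: "(\<lambda>n. (1 / real (Suc n))\<^sup>2) \<longlonglongrightarrow> 0"
    using tendsto_power[OF LIMSEQ_Suc[OF lim_1_over_n], of 2] by (simp only: zero_power2)
  have b0: "nsq ?M (?d n) \<le> (1 / real (Suc n))\<^sup>2" for n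
  proof -
    have "nsq ?M (?d n) \<le> (W22_norm ?\<Omega> (?d n))\<^sup>2"
      unfolding W by (auto intro!: add_nonneg_nonneg sum_nonneg)
    thus ?thesis using lt2[of n] by linarith
  qed
  have b1: "nsq ?M (?D i (?d n)) \<le> (1 / real (Suc n))\<^sup>2" if "i \<in> Basis" for i n
  proof -
    have "nsq ?M (?D i (?d n)) \<le> (\<Sum>i\<in>Basis. nsq ?M (?D i (?d n)))"
      using that by (intro member_le_sum) auto
    also have "\<dots> \<le> (W22_norm ?\<Omega> (?d n))\<^sup>2"
      unfolding W by (auto intro!: add_nonneg_nonneg sum_nonneg)
    finally show ?thesis using lt2[of n] by linarith
  qed
  have b2: "nsq ?M (?D j (?D i (?d n))) \<le> (1 / real (Suc n))\<^sup>2" if "i \<in> Basis" "j \<in> Basis" for i j n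
  proof -
    have "nsq ?M (?D j (?D i (?d n))) \<le> (\<Sum>j\<in>Basis. nsq ?M (?D j (?D i (?d n))))"
      using that by (intro member_le_sum) auto
    also have "\<dots> \<le> (\<Sum>i\<in>Basis. \<Sum>j\<in>Basis. nsq ?M (?D j (?D i (?d n))))"
      using that by (intro member_le_sum[where f="\<lambda>i. \<Sum>j\<in>Basis. nsq ?M (?D j (?D i (?d n)))"]) (auto intro: sum_nonneg)
    also have "\<dots> \<le> (W22_norm ?\<Omega> (?d n))\<^sup>2"
      unfolding W by (auto intro!: add_nonneg_nonneg sum_nonneg)
    finally show ?thesis using lt2[of n] by linarith
  qed
  have "W22_approx ?\<Omega> \<phi> u (\<lambda>i. ?D i u) (\<lambda>i j. ?D j (?D i u))"
    unfolding W22_approx_def L2_lim_def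
  proof (intro conjI allI ballI)
    show "(\<lambda>n. nsq ?M (\<lambda>x. \<phi> n x - u x)) \<longlonglongrightarrow> 0"
      by (subst nsq_minus_commute, rule tendsto_0_squeeze[OF _ b0 lim]) simp
    show "(\<lambda>n. nsq ?M (\<lambda>x. pderiv_at i (\<phi> n) x - ?D i u x)) \<longlonglongrightarrow> 0" if "i \<in> Basis" for i
      using tendsto_0_squeeze[OF _ b1[OF that] lim] by (subst nsq_minus_commute) (simp add: q1[OF that])
    show "(\<lambda>n. nsq ?M (\<lambda>x. pderiv_at j (pderiv_at i (\<phi> n)) x - ?D j (?D i u) x)) \<longlonglongrightarrow> 0"
      if "i \<in> Basis" "j \<in> Basis" for i j
      using tendsto_0_squeeze[OF _ b2[OF that] lim] by (subst nsq_minus_commute) (simp add: q2[OF that])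
  qed (auto intro: u s1 s2 t B test_function_sq_int test_function_pderiv)
  thus ?thesis by (rule that)
qed

section \<open>Tensor products\<close>

abbreviation D :: "(real \<Rightarrow> complex) \<Rightarrow> real \<Rightarrow> complex" where "D \<equiv> pderiv_at 1"

text \<open>\<open>v\<close> and \<open>w\<close> are given representatives of the weak derivatives of \<open>u\<close>, which avoids the choice
  made by \<open>weak_pderiv\<close>.\<close>

definition H2 :: "real \<Rightarrow> (real \<Rightarrow> complex) \<Rightarrow> (real \<Rightarrow> complex) \<Rightarrow> (real \<Rightarrow> complex) \<Rightarrow> bool" where
  "H2 a u v w \<longleftrightarrow> (\<exists>\<phi>. (\<forall>n. test_function {0..a} (\<phi> n)) \<and> L2_lim (leb {0..a}) \<phi> u \<and>
     L2_lim (leb {0..a}) (\<lambda>n. D (\<phi> n)) v \<and> L2_lim (leb {0..a}) (\<lambda>n. D (D (\<phi> n))) w)"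

lemma H2I:
  assumes "\<And>n. test_function {0..a} (\<phi> n)" "L2_lim (leb {0..a}) \<phi> u"
    "L2_lim (leb {0..a}) (\<lambda>n. D (\<phi> n)) v" "L2_lim (leb {0..a}) (\<lambda>n. D (D (\<phi> n))) w"
  shows "H2 a u v w"
  using assms by (auto simp: H2_def)

lemma H2E:
  assumes "H2 a u v w"
  obtains \<phi> where "\<forall>n. test_function {0..a} (\<phi> n)" "L2_lim (leb {0..a}) \<phi> u"
    "L2_lim (leb {0..a}) (\<lambda>n. D (\<phi> n)) v" "L2_lim (leb {0..a}) (\<lambda>n. D (D (\<phi> n))) w"
  using assms by (auto simp: H2_def)

lemma H2_sq_int:
  assumes "H2 a u v w"
  shows "sq_int (leb {0..a}) u" "sq_int (leb {0..a}) v" "sq_int (leb {0..a}) w"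
  using assms L2_limD(2) unfolding H2_def by blast+

lemma test_functionD_real [intro]: "test_function \<Omega> \<phi> \<Longrightarrow> test_function \<Omega> (D \<phi>)"
  by (rule test_function_pderiv) auto

lemma H2_imp_approx:
  assumes "H2 a u v w"
  obtains \<phi> where "W22_approx (cbox 0 a) \<phi> u (\<lambda>i. v) (\<lambda>i j. w)"
proof -
  obtain \<phi> where "\<forall>n. test_function {0..a} (\<phi> n)" "L2_lim (leb {0..a}) \<phi> u"
    "L2_lim (leb {0..a}) (\<lambda>n. D (\<phi> n)) v" "L2_lim (leb {0..a}) (\<lambda>n. D (D (\<phi> n))) w"
    using H2E[OF assms] .
  hence "W22_approx (cbox 0 a) \<phi> u (\<lambda>i. v) (\<lambda>i j. w)" by (simp add: W22_approx_def)
  thus ?thesis by (rule that)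
qed

lemma H2_imp_W22_0:
  assumes "H2 a u v w"
  shows "u \<in> W22_0 {0..a}" "AE x in leb {0..a}. weak_pderiv {0..a} 1 u x = v x"
    "AE x in leb {0..a}. weak_pderiv {0..a} 1 (weak_pderiv {0..a} 1 u) x = w x"
    "has_weak_pderiv {0..a} 1 u v" "has_weak_pderiv {0..a} 1 v w"
    "sq_int (leb {0..a}) (weak_pderiv {0..a} 1 u)"
    "sq_int (leb {0..a}) (weak_pderiv {0..a} 1 (weak_pderiv {0..a} 1 u))"
proof -
  obtain \<phi> where W: "W22_approx (cbox 0 a) \<phi> u (\<lambda>i. v) (\<lambda>i j. w)" using H2_imp_approx[OF assms] .
  note h1 = W22_approx_has_weak(1)[OF W, of 1] and h2 = W22_approx_has_weak(2)[OF W, of 1 1]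
  show "u \<in> W22_0 {0..a}" using W22_approx_W22_0[OF W] by simp
  show "AE x in leb {0..a}. weak_pderiv {0..a} 1 u x = v x"
    using W22_approx_AE(1)[OF W, of 1] by (simp only: cbox_interval Basis_real_def insert_iff simp_thms)
  show "AE x in leb {0..a}. weak_pderiv {0..a} 1 (weak_pderiv {0..a} 1 u) x = w x"
    using W22_approx_AE(2)[OF W, of 1 1] by (simp only: cbox_interval Basis_real_def insert_iff simp_thms)
  show "has_weak_pderiv {0..a} 1 u v" "has_weak_pderiv {0..a} 1 v w" using h1 h2 by auto
  show "sq_int (leb {0..a}) (weak_pderiv {0..a} 1 u)"
    using weak_pderivI[OF h1] by (auto simp: has_weak_pderiv_iff)
  show "sq_int (leb {0..a}) (weak_pderiv {0..a} 1 (weak_pderiv {0..a} 1 u))"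
    using weak_pderivI[OF weak_pderiv_weak_eq_AE(1)[OF h1 h2]] by (auto simp: has_weak_pderiv_iff)
qed

lemma W22_0_imp_H2:
  assumes "u \<in> W22_0 {0..a}"
  shows "H2 a u (weak_pderiv {0..a} 1 u) (weak_pderiv {0..a} 1 (weak_pderiv {0..a} 1 u))"
proof -
  obtain \<phi> where W: "W22_approx (cbox 0 a) \<phi> u (\<lambda>i. weak_pderiv (cbox 0 a) i u)
     (\<lambda>i j. weak_pderiv (cbox 0 a) j (weak_pderiv (cbox 0 a) i u))"
    using W22_0_imp_approx[of u 0 a] assms by auto
  show ?thesis
    by (rule H2I[of _ \<phi>]) (use W22_approxD(1,2)[OF W] W22_approxD(3)[OF W, of 1] W22_approxD(4)[OF W, of 1 1] in auto)
qed

lemma Ck_cnj: "Ck k f \<Longrightarrow> Ck k (\<lambda>x. cnj (f x))"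
  and pderiv_at_cnj: "f differentiable at x \<Longrightarrow> pderiv_at i (\<lambda>x. cnj (f x)) x = cnj (pderiv_at i f x)"
proof -
  have d: "((\<lambda>x. cnj (f x)) has_derivative (\<lambda>h. cnj (frechet_derivative f (at x) h))) (at x)"
    if "f differentiable at x" for f :: "'a \<Rightarrow> complex" and x
    using bounded_linear.has_derivative[OF bounded_linear_cnj] that frechet_derivative_works by blast
  show *: "pderiv_at i (\<lambda>x. cnj (f x)) x = cnj (pderiv_at i f x)" if "f differentiable at x" for f :: "'a \<Rightarrow> complex" and i x
    by (subst pderiv_at_eq[OF d[OF that]]) (simp add: pderiv_at_def)
  show "Ck k f \<Longrightarrow> Ck k (\<lambda>x. cnj (f x))" for f :: "'a \<Rightarrow> complex"
  proof (induction k arbitrary: f)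
    case 0 thus ?case by (auto intro: continuous_on_cnj)
  next
    case (Suc k)
    hence df: "f differentiable at x" for x by (auto simp: differentiable_on_def)
    have "pderiv_at i (\<lambda>x. cnj (f x)) = (\<lambda>x. cnj (pderiv_at i f x))" for i using *[OF df] by auto
    thus ?case using Suc d[OF df] by (auto simp: differentiable_on_def differentiable_def)
  qed
qed

lemma smooth_cnj: "smooth f \<Longrightarrow> smooth (\<lambda>x. cnj (f x))"
  by (simp add: smooth_def Ck_cnj)

lemma test_function_ip_by_parts:
  assumes "test_function \<Omega> \<phi>" "smooth \<psi>" "i \<in> Basis" "\<Omega> \<in> sets borel"
  shows "ip (leb \<Omega>) (pderiv_at i \<phi>) \<psi> = - ip (leb \<Omega>) \<phi> (pderiv_at i \<psi>)"
  unfolding ip_def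
  using integral_by_parts_test_leb[OF assms(1) smooth_cnj[OF assms(2)] assms(3,4)]
  by (simp add: pderiv_at_cnj[OF smooth_differentiable[OF assms(2)]] mult.commute)

text \<open>Integration by parts for test functions has no boundary terms, and inner products pass
  to the L2 limit. Both the product form of the energy and the interpolation inequality rest on this
  identity.\<close>

lemma H2_ip:
  assumes "H2 a u v w" shows "ip (leb {0..a}) w u = - of_real (nsq (leb {0..a}) v)"
proof -
  obtain \<phi> where t0: "\<forall>n. test_function {0..a} (\<phi> n)" and L: "L2_lim (leb {0..a}) \<phi> u"
    "L2_lim (leb {0..a}) (\<lambda>n. D (\<phi> n)) v" "L2_lim (leb {0..a}) (\<lambda>n. D (D (\<phi> n))) w" using H2E[OF assms] .
  note t = t0[rule_format]
  have "ip (leb {0..a}) (D (D (\<phi> n))) (\<phi> n) = - ip (leb {0..a}) (D (\<phi> n)) (D (\<phi> n))" for n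
    by (rule test_function_ip_by_parts) (use t test_functionD(1) in auto)
  hence "(\<lambda>n. ip (leb {0..a}) (D (D (\<phi> n))) (\<phi> n)) \<longlonglongrightarrow> - ip (leb {0..a}) v v"
    using tendsto_minus[OF ip_lim[OF L(2,2)]] by simp
  thus ?thesis using ip_lim[OF L(3,1)] LIMSEQ_unique ip_self by metis
qed

section \<open>Derivatives and limits of tensor products\<close>

lemma frechet_derivative_real:
  fixes \<phi> :: "real \<Rightarrow> complex"
  assumes "smooth \<phi>" shows "frechet_derivative \<phi> (at x) s = of_real s * D \<phi> x"
proof -
  have "linear (frechet_derivative \<phi> (at x))" by (rule has_derivative_linear[OF smoothD1[OF assms]])
  from linear_scale[OF this, of s 1] show ?thesis by (simp add: pderiv_at_def scaleR_conv_of_real)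
qed

text \<open>Composition with a bounded linear functional covers the coordinate projections needed
  for tensors as well as the dilations of the line.\<close>

lemma smooth_linear:
  fixes \<phi> :: "real \<Rightarrow> complex" and L :: "'a::euclidean_space \<Rightarrow> real"
  assumes "smooth \<phi>" and L: "bounded_linear L"
  shows "smooth (\<lambda>p. \<phi> (L p))"
    and "pderiv_at i (\<lambda>p. \<phi> (L p)) = (\<lambda>p. of_real (L i) * D \<phi> (L p))"
proof -
  have d: "((\<lambda>p. \<phi> (L p)) has_derivative (\<lambda>h. frechet_derivative \<phi> (at (L p)) (L h))) (at p)"
    if "smooth \<phi>" for \<phi> :: "real \<Rightarrow> complex" and p
    by (rule has_derivative_compose[OF bounded_linear_imp_has_derivative[OF L] smoothD1[OF that]])
  have *: "pderiv_at i (\<lambda>p. \<phi> (L p)) = (\<lambda>p. of_real (L i) * D \<phi> (L p))"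
    if "smooth \<phi>" for \<phi> :: "real \<Rightarrow> complex" and i
    using pderiv_at_eq[OF d[OF that]] frechet_derivative_real[OF that] by fastforce
  have "Ck k (\<lambda>p. \<phi> (L p))" if "smooth \<phi>" for k and \<phi> :: "real \<Rightarrow> complex" using that
  proof (induction k arbitrary: \<phi>)
    case 0 show ?case
      using continuous_on_compose2[OF smooth_continuous[OF 0, of UNIV] linear_continuous_on[OF L, of UNIV]] by auto
  next
    case (Suc k)
    have "smooth (D \<phi>)" using Suc.prems by (rule smooth_pderiv) auto
    note IH = Suc.IH[OF this]
    have "(\<lambda>p. \<phi> (L p)) differentiable_on UNIV"
      using d[OF Suc.prems] unfolding differentiable_on_def differentiable_def by blast
    moreover have "Ck k (pderiv_at i (\<lambda>p. \<phi> (L p)))" for i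
      unfolding *[OF Suc.prems] by (intro Ck_mult Ck_const IH)
    ultimately show ?case by simp
  qed
  thus "smooth (\<lambda>p. \<phi> (L p))" using assms by (simp add: smooth_def)
  show "pderiv_at i (\<lambda>p. \<phi> (L p)) = (\<lambda>p. of_real (L i) * D \<phi> (L p))"
    by (rule *[OF assms(1)])
qed

lemmas smooth_fst = smooth_linear[OF _ bounded_linear_fst]
lemmas smooth_snd = smooth_linear[OF _ bounded_linear_snd]

lemma tensor_eq: "tensor f g = (\<lambda>p. f (fst p) * g (snd p))"
  by (auto simp: tensor_def)

lemma smooth_tensor: "smooth \<phi> \<Longrightarrow> smooth \<psi> \<Longrightarrow> smooth (tensor \<phi> \<psi>)"
  unfolding tensor_eq by (intro smooth_mult smooth_fst smooth_snd)

lemma pderiv_at_tensor: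
  assumes "smooth \<phi>" "smooth \<psi>"
  shows "pderiv_at i (tensor \<phi> \<psi>) =
    (\<lambda>p. of_real (fst i) * tensor (D \<phi>) \<psi> p + of_real (snd i) * tensor \<phi> (D \<psi>) p)"
proof
  fix p
  show "pderiv_at i (tensor \<phi> \<psi>) p =
      of_real (fst i) * tensor (D \<phi>) \<psi> p + of_real (snd i) * tensor \<phi> (D \<psi>) p"
    unfolding tensor_eq
    by (subst pderiv_at_mult)
       (use assms in \<open>auto simp: smooth_fst(2) smooth_snd(2) algebra_simps intro!: smooth_differentiable smooth_fst(1) smooth_snd(1)\<close>)
qed

lemma test_function_tensor:
  assumes "test_function A \<phi>" "test_function B \<psi>" shows "test_function (A \<times> B) (tensor \<phi> \<psi>)"
proof -
  obtain K where K: "compact K" "K \<subseteq> interior A" "\<And>x. x \<notin> K \<Longrightarrow> \<phi> x = 0"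
    using test_function_support[OF assms(1)] by blast
  obtain L where L: "compact L" "L \<subseteq> interior B" "\<And>x. x \<notin> L \<Longrightarrow> \<psi> x = 0"
    using test_function_support[OF assms(2)] by blast
  show ?thesis
    by (rule test_functionI[OF smooth_tensor[OF test_functionD(1)[OF assms(1)] test_functionD(1)[OF assms(2)]] compact_Times[OF K(1) L(1)]])
       (use K L in \<open>auto simp: tensor_eq interior_Times mem_Times_iff\<close>)
qed

lemma leb_Times_integral:
  fixes f g :: "real \<Rightarrow> complex"
  assumes A: "A \<in> sets borel" and B: "B \<in> sets borel" and f: "integrable (leb A) f" and g: "integrable (leb B) g"
  shows "integrable (leb (A \<times> B)) (tensor f g)"
    and "(\<integral>p. tensor f g p \<partial>leb (A \<times> B)) = (\<integral>x. f x \<partial>leb A) * (\<integral>x. g x \<partial>leb B)"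
proof -
  define F where "F = (\<lambda>x. indicator A x *\<^sub>R f x)"
  define G where "G = (\<lambda>x. indicator B x *\<^sub>R g x)"
  have iF: "integrable lborel F" and iG: "integrable lborel G"
    using f g A B by (simp_all add: F_def G_def integrable_restrict_space)
  note [measurable] = borel_measurable_integrable[OF iF] borel_measurable_integrable[OF iG]
  have AB: "A \<times> B \<in> sets borel" using A B by (rule borel_Times)
  have eq: "(\<lambda>p. indicator (A \<times> B) p *\<^sub>R tensor f g p) = (\<lambda>p. F (fst p) * G (snd p))"
    by (auto simp: F_def G_def tensor_eq indicator_def fun_eq_iff)
  have i: "integrable (lborel \<Otimes>\<^sub>M lborel) (\<lambda>p. F (fst p) * G (snd p))"
    by (rule lborel_pair.Fubini_integrable) (use iF iG in \<open>auto simp: norm_mult\<close>)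
  show "integrable (leb (A \<times> B)) (tensor f g)"
    using i AB by (simp add: integrable_restrict_space eq lborel_prod)
  have "(\<integral>p. tensor f g p \<partial>leb (A \<times> B)) = (\<integral>p. F (fst p) * G (snd p) \<partial>(lborel \<Otimes>\<^sub>M lborel))"
    using AB by (simp add: integral_restrict_space eq lborel_prod)
  also have "\<dots> = (\<integral>x. \<integral>y. F x * G y \<partial>lborel \<partial>lborel)"
    using lborel_pair.integral_fst'[OF i] by simp
  also have "\<dots> = (\<integral>x. F x \<partial>lborel) * (\<integral>y. G y \<partial>lborel)" by simp
  finally show "(\<integral>p. tensor f g p \<partial>leb (A \<times> B)) = (\<integral>x. f x \<partial>leb A) * (\<integral>x. g x \<partial>leb B)"
    using A B by (simp add: F_def G_def integral_restrict_space)
qed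

lemma tensor_sq_int:
  assumes A: "A \<in> sets borel" and B: "B \<in> sets borel" and f: "sq_int (leb A) f" and g: "sq_int (leb B) g"
  shows "sq_int (leb (A \<times> B)) (tensor f g)"
proof -
  have AB: "A \<times> B \<in> sets borel" using A B by (rule borel_Times)
  have [measurable]: "(\<lambda>x. indicator A x *\<^sub>R f x) \<in> borel_measurable borel"
                     "(\<lambda>x. indicator B x *\<^sub>R g x) \<in> borel_measurable borel"
    using f g A B by (simp_all add: sq_int_def borel_measurable_restrict_space_iff)
  have eq: "(\<lambda>p. indicator (A \<times> B) p *\<^sub>R tensor f g p) = (\<lambda>p. (indicator A (fst p) *\<^sub>R f (fst p)) * (indicator B (snd p) *\<^sub>R g (snd p)))"
    by (auto simp: tensor_eq indicator_def fun_eq_iff)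
  have "(\<lambda>p. indicator (A \<times> B) p *\<^sub>R tensor f g p) \<in> borel_measurable (lborel \<Otimes>\<^sub>M lborel)"
    unfolding eq by measurable
  hence m: "tensor f g \<in> borel_measurable (leb (A \<times> B))"
    using AB by (simp add: borel_measurable_restrict_space_iff lborel_prod)
  have "integrable (leb (A \<times> B)) (tensor (\<lambda>x. complex_of_real ((cmod (f x))\<^sup>2)) (\<lambda>x. complex_of_real ((cmod (g x))\<^sup>2)))"
    by (rule leb_Times_integral[OF A B]) (use f g in \<open>auto simp: sq_int_def simp del: of_real_power\<close>)
  from integrable_Re[OF this] have "integrable (leb (A \<times> B)) (\<lambda>p. (cmod (tensor f g p))\<^sup>2)"
    by (simp add: tensor_eq norm_mult power_mult_distrib flip: of_real_power of_real_mult)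
  thus ?thesis using m by (simp add: sq_int_def)
qed

lemma ip_tensor:
  assumes A: "A \<in> sets borel" and B: "B \<in> sets borel"
    and "sq_int (leb A) f" "sq_int (leb A) f'" "sq_int (leb B) g" "sq_int (leb B) g'"
  shows "ip (leb (A \<times> B)) (tensor f g) (tensor f' g') = ip (leb A) f f' * ip (leb B) g g'"
  using leb_Times_integral(2)[OF A B integrable_ip[OF assms(3,4)] integrable_ip[OF assms(5,6)]]
  by (simp add: ip_def tensor_eq mult_ac)

lemma nsq_tensor:
  assumes A: "A \<in> sets borel" and B: "B \<in> sets borel" and "sq_int (leb A) f" "sq_int (leb B) g"
  shows "nsq (leb (A \<times> B)) (tensor f g) = nsq (leb A) f * nsq (leb B) g"
  using ip_tensor[OF A B assms(3,3,4,4)] unfolding ip_self of_real_mult[symmetric] of_real_eq_iff .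

lemma L2_lim_tensor:
  assumes A: "A \<in> sets borel" and B: "B \<in> sets borel" and F: "L2_lim (leb A) F u" and G: "L2_lim (leb B) G v"
  shows "L2_lim (leb (A \<times> B)) (\<lambda>n. tensor (F n) (G n)) (tensor u v)"
  unfolding L2_lim_def
proof (intro conjI allI)
  note F' = L2_limD[OF F] and G' = L2_limD[OF G]
  show s: "sq_int (leb (A \<times> B)) (tensor u v)" "\<And>n. sq_int (leb (A \<times> B)) (tensor (F n) (G n))"
    by (intro tensor_sq_int A B F' G')+
  show "(\<lambda>n. nsq (leb (A \<times> B)) (\<lambda>p. tensor (F n) (G n) p - tensor u v p)) \<longlonglongrightarrow> 0"
  proof (rule tendsto_0_squeeze)
    fix n
    \<comment> \<open>One factor is exchanged at a time, so each norm splits into a vanishing factor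
      and a bounded one.\<close>
    have eq: "(\<lambda>p. tensor (F n) (G n) p - tensor u v p) =
       (\<lambda>p. tensor (\<lambda>x. F n x - u x) (G n) p + tensor u (\<lambda>x. G n x - v x) p)"
      by (auto simp: tensor_eq algebra_simps)
    show "nsq (leb (A \<times> B)) (\<lambda>p. tensor (F n) (G n) p - tensor u v p) \<le>
      2 * (nsq (leb A) (\<lambda>x. F n x - u x) * nsq (leb B) (G n)) + 2 * (nsq (leb A) u * nsq (leb B) (\<lambda>x. G n x - v x))"
      unfolding eq
      by (rule order_trans[OF nsq_add_le]; (intro tensor_sq_int A B F' G' sq_int_diff)?)
         (simp add: nsq_tensor[OF A B] F' G' sq_int_diff)
  next
    have "(\<lambda>n. 2 * (nsq (leb A) (\<lambda>x. F n x - u x) * nsq (leb B) (G n)) + 2 * (nsq (leb A) u * nsq (leb B) (\<lambda>x. G n x - v x)))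
      \<longlonglongrightarrow> 2 * (0 * nsq (leb B) v) + 2 * (nsq (leb A) u * 0)"
      by (intro tendsto_intros F' G' nsq_lim G)
    thus "(\<lambda>n. 2 * (nsq (leb A) (\<lambda>x. F n x - u x) * nsq (leb B) (G n)) + 2 * (nsq (leb A) u * nsq (leb B) (\<lambda>x. G n x - v x)))
      \<longlonglongrightarrow> 0" by simp
  qed simp
qed

text \<open>Directional derivatives are linear in the direction, so one formula in the components of
  i and j handles all basis vectors of the plane without a case distinction.\<close>

lemma W22_approx_tensor:
  assumes f: "H2 a f f1 f2" and g: "H2 b g g1 g2"
  obtains \<phi> where "W22_approx ({0..a} \<times> {0..b}) \<phi> (tensor f g)
     (\<lambda>i p. of_real (fst i) * tensor f1 g p + of_real (snd i) * tensor f g1 p)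
     (\<lambda>i j p. of_real (fst i) * (of_real (fst j) * tensor f2 g p + of_real (snd j) * tensor f1 g1 p) +
              of_real (snd i) * (of_real (fst j) * tensor f1 g1 p + of_real (snd j) * tensor f g2 p))"
proof -
  obtain \<phi> where t0: "\<forall>n. test_function {0..a} (\<phi> n)" and L: "L2_lim (leb {0..a}) \<phi> f"
    "L2_lim (leb {0..a}) (\<lambda>n. D (\<phi> n)) f1" "L2_lim (leb {0..a}) (\<lambda>n. D (D (\<phi> n))) f2" using H2E[OF f] .
  note t = t0[rule_format]
  obtain \<psi> where t0': "\<forall>n. test_function {0..b} (\<psi> n)" and L': "L2_lim (leb {0..b}) \<psi> g"
    "L2_lim (leb {0..b}) (\<lambda>n. D (\<psi> n)) g1" "L2_lim (leb {0..b}) (\<lambda>n. D (D (\<psi> n))) g2" using H2E[OF g] .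
  note t' = t0'[rule_format]
  note s = test_functionD(1)[OF t] test_functionD(1)[OF t']
  note s1 = test_functionD(1)[OF test_functionD_real[OF t]] test_functionD(1)[OF test_functionD_real[OF t']]
  have c: "pderiv_at j (\<lambda>p. of_real a * f p + of_real b * g p) = (\<lambda>p. of_real a * pderiv_at j f p + of_real b * pderiv_at j g p)"
    if "smooth f" "smooth g" for j a b and f g :: "real \<times> real \<Rightarrow> complex"
    using that by (auto simp: fun_eq_iff pderiv_at_add pderiv_at_mult smooth_differentiable smooth_mult)
  have "W22_approx ({0..a} \<times> {0..b}) (\<lambda>n. tensor (\<phi> n) (\<psi> n)) (tensor f g)
     (\<lambda>i p. of_real (fst i) * tensor f1 g p + of_real (snd i) * tensor f g1 p)
     (\<lambda>i j p. of_real (fst i) * (of_real (fst j) * tensor f2 g p + of_real (snd j) * tensor f1 g1 p) +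
              of_real (snd i) * (of_real (fst j) * tensor f1 g1 p + of_real (snd j) * tensor f g2 p))"
    unfolding W22_approx_def
  proof (intro conjI allI ballI)
    show "test_function ({0..a} \<times> {0..b}) (tensor (\<phi> n) (\<psi> n))" for n
      by (intro test_function_tensor t t')
    show "L2_lim (leb ({0..a} \<times> {0..b})) (\<lambda>n. tensor (\<phi> n) (\<psi> n)) (tensor f g)"
      by (intro L2_lim_tensor L L') auto
    fix i
    show "L2_lim (leb ({0..a} \<times> {0..b})) (\<lambda>n. pderiv_at i (tensor (\<phi> n) (\<psi> n)))
       (\<lambda>p. of_real (fst i) * tensor f1 g p + of_real (snd i) * tensor f g1 p)"
      unfolding pderiv_at_tensor[OF s]
      by (intro L2_lim_add L2_lim_cmult L2_lim_tensor L L') auto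
    fix j
    show "L2_lim (leb ({0..a} \<times> {0..b})) (\<lambda>n. pderiv_at j (pderiv_at i (tensor (\<phi> n) (\<psi> n))))
        (\<lambda>p. of_real (fst i) * (of_real (fst j) * tensor f2 g p + of_real (snd j) * tensor f1 g1 p) +
              of_real (snd i) * (of_real (fst j) * tensor f1 g1 p + of_real (snd j) * tensor f g2 p))"
      unfolding pderiv_at_tensor[OF s] c[OF smooth_tensor smooth_tensor, OF s1(1) s(2) s(1) s1(2)]
        pderiv_at_tensor[OF s1(1) s(2)] pderiv_at_tensor[OF s(1) s1(2)]
      by (intro L2_lim_add L2_lim_cmult L2_lim_tensor L L') auto
  qed
  thus ?thesis by (rule that)
qed

text \<open>The Laplacian is the tensor of f'' and g plus the tensor of f and g''. The mixed term of
  its squared norm factors into <f'', f> <g, g''>, and each factor is minus a squared norm by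
  \<open>H2_ip\<close>; the two signs cancel.\<close>

lemma tensor_energy_eq:
  assumes f: "H2 h f f1 f2" and g: "H2 1 g g1 g2"
  shows "tensor_energy h f g = ereal (nsq (leb {0..h}) f2 * nsq (leb {0..1}) g + nsq (leb {0..h}) f * nsq (leb {0..1}) g2
     + 2 * nsq (leb {0..h}) f1 * nsq (leb {0..1}) g1)"
proof -
  let ?\<Omega> = "{0..h} \<times> {0..1::real}"
  have cb: "?\<Omega> = cbox (0, 0) (h, 1)" by (simp add: cbox_Pair_eq)
  have B: "?\<Omega> \<in> sets borel" unfolding cb by simp
  obtain \<phi> where W: "W22_approx ?\<Omega> \<phi> (tensor f g)
     (\<lambda>i p. of_real (fst i) * tensor f1 g p + of_real (snd i) * tensor f g1 p)
     (\<lambda>i j p. of_real (fst i) * (of_real (fst j) * tensor f2 g p + of_real (snd j) * tensor f1 g1 p) +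
              of_real (snd i) * (of_real (fst j) * tensor f1 g1 p + of_real (snd j) * tensor f g2 p))"
    using W22_approx_tensor[OF f g] .
  note W' = W[unfolded cb]
  have e: "((1,0)::real\<times>real) \<in> Basis" "((0,1)::real\<times>real) \<in> Basis" by (auto simp: Basis_prod_def)
  have in0: "tensor f g \<in> W22_0 ?\<Omega>" unfolding cb by (rule W22_approx_W22_0[OF W'])
  have ae: "AE p in leb ?\<Omega>. weak_laplacian ?\<Omega> (tensor f g) p = tensor f2 g p + tensor f g2 p"
    using W22_approx_AE(2)[OF W' e(1) e(1)] W22_approx_AE(2)[OF W' e(2) e(2)]
    unfolding cb weak_laplacian_def by eventually_elim (auto simp: Basis_prod_def)
  note S = H2_sq_int[OF f] H2_sq_int[OF g]
  have I: "{0..h} \<in> sets borel" "{0..1::real} \<in> sets borel" by auto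
  have s: "sq_int (leb ?\<Omega>) (tensor f2 g)" "sq_int (leb ?\<Omega>) (tensor f g2)" by (intro tensor_sq_int S I)+
  have m: "weak_laplacian ?\<Omega> (tensor f g) \<in> borel_measurable (leb ?\<Omega>)"
  proof -
    have "weak_pderiv (cbox (0,0) (h,1)) i (weak_pderiv (cbox (0,0) (h,1)) i (tensor f g)) \<in> borel_measurable (leb (cbox (0,0) (h,1)))"
      if "i \<in> Basis" for i
      using weak_pderivI[OF weak_pderiv_weak_eq_AE(1)[OF W22_approx_has_weak(1)[OF W' that] W22_approx_has_weak(2)[OF W' that that] that]]
      by (auto simp: has_weak_pderiv_iff sq_int_def)
    thus ?thesis unfolding weak_laplacian_def cb by (intro borel_measurable_sum) auto
  qed
  have "(LINT x:?\<Omega>|lborel. (cmod (weak_laplacian ?\<Omega> (tensor f g) x))\<^sup>2) = nsq (leb ?\<Omega>) (weak_laplacian ?\<Omega> (tensor f g))"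
    unfolding nsq_def by (rule set_lint_leb[OF B])
  also have "\<dots> = nsq (leb ?\<Omega>) (\<lambda>p. tensor f2 g p + tensor f g2 p)"
    by (rule nsq_cong_AE[OF m _ ae]) (use sq_int_add[OF s] in \<open>auto simp: sq_int_def\<close>)
  also have "\<dots> = nsq (leb {0..h}) f2 * nsq (leb {0..1}) g + nsq (leb {0..h}) f * nsq (leb {0..1}) g2
     + 2 * Re (ip (leb {0..h}) f2 f * ip (leb {0..1}) g g2)"
    by (subst nsq_add[OF s]) (simp add: nsq_tensor ip_tensor S)
  also have "ip (leb {0..1}) g g2 = - of_real (nsq (leb {0..1}) g1)"
    using H2_ip[OF g] ip_cnj[of "leb {0..1}" g g2] by simp
  finally show ?thesis
    using H2_imp_W22_0(1)[OF f] H2_imp_W22_0(1)[OF g] in0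
    by (simp add: tensor_energy_def biharmonic_form_def H2_ip[OF f])
qed

section \<open>Sobolev functions on an interval\<close>

lemma smooth_has_vector_derivative:
  "smooth \<phi> \<Longrightarrow> (\<phi> has_vector_derivative D \<phi> x) (at x within S)"
  using smooth_directional[of \<phi> 0 1 x] by (auto intro: has_vector_derivative_at_within)

lemma smooth_D: "smooth \<phi> \<Longrightarrow> smooth (D \<phi>)"
  by (rule smooth_pderiv) auto

lemma D_add: "smooth f \<Longrightarrow> smooth g \<Longrightarrow> D (\<lambda>x. f x + g x) = (\<lambda>x. D f x + D g x)"
  by (auto simp: fun_eq_iff pderiv_at_add smooth_differentiable)

lemma D_cmult: "smooth f \<Longrightarrow> D (\<lambda>x. c * f x) = (\<lambda>x. c * D f x)"
  by (auto simp: fun_eq_iff pderiv_at_mult smooth_differentiable)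

lemma H2_add:
  assumes "H2 a u v w" "H2 a u' v' w'"
  shows "H2 a (\<lambda>x. u x + u' x) (\<lambda>x. v x + v' x) (\<lambda>x. w x + w' x)"
proof -
  obtain \<phi> where t: "\<forall>n. test_function {0..a} (\<phi> n)" and L: "L2_lim (leb {0..a}) \<phi> u"
    "L2_lim (leb {0..a}) (\<lambda>n. D (\<phi> n)) v" "L2_lim (leb {0..a}) (\<lambda>n. D (D (\<phi> n))) w" using H2E[OF assms(1)] .
  obtain \<psi> where t': "\<forall>n. test_function {0..a} (\<psi> n)" and L': "L2_lim (leb {0..a}) \<psi> u'"
    "L2_lim (leb {0..a}) (\<lambda>n. D (\<psi> n)) v'" "L2_lim (leb {0..a}) (\<lambda>n. D (D (\<psi> n))) w'" using H2E[OF assms(2)] .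
  note s = test_functionD(1)[OF t[rule_format]] test_functionD(1)[OF t'[rule_format]]
  show ?thesis
    by (rule H2I[of _ "\<lambda>n x. \<phi> n x + \<psi> n x"])
       (auto simp only: D_add[OF s] D_add[OF smooth_D[OF s(1)] smooth_D[OF s(2)]]
          intro!: test_function_add t[rule_format] t'[rule_format] L2_lim_add L L')
qed

lemma H2_cmult:
  assumes "H2 a u v w" shows "H2 a (\<lambda>x. c * u x) (\<lambda>x. c * v x) (\<lambda>x. c * w x)"
proof -
  obtain \<phi> where t: "\<forall>n. test_function {0..a} (\<phi> n)" and L: "L2_lim (leb {0..a}) \<phi> u"
    "L2_lim (leb {0..a}) (\<lambda>n. D (\<phi> n)) v" "L2_lim (leb {0..a}) (\<lambda>n. D (D (\<phi> n))) w" using H2E[OF assms] .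
  note s = test_functionD(1)[OF t[rule_format]]
  show ?thesis
    by (rule H2I[of _ "\<lambda>n x. c * \<phi> n x"])
       (auto simp only: D_cmult[OF s] D_cmult[OF smooth_D[OF s]]
          intro!: test_function_cmult t[rule_format] L2_lim_cmult L)
qed

lemma H2_test_function:
  assumes "test_function {0..a} \<phi>" shows "H2 a \<phi> (D \<phi>) (D (D \<phi>))"
  by (rule H2I[of _ "\<lambda>n. \<phi>"]) (auto intro!: L2_lim_const assms test_function_sq_int[where \<Omega>="{0..a}"])

lemma H2_unique:
  assumes "H2 a u v w" "H2 a u v' w'"
  shows "nsq (leb {0..a}) v = nsq (leb {0..a}) v'" "nsq (leb {0..a}) w = nsq (leb {0..a}) w'"
proof -
  note m = H2_sq_int[OF assms(1)] H2_sq_int[OF assms(2)]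
  have "AE x in leb {0..a}. v x = v' x" "AE x in leb {0..a}. w x = w' x"
    using H2_imp_W22_0(2,3)[OF assms(1)] H2_imp_W22_0(2,3)[OF assms(2)] by auto
  thus "nsq (leb {0..a}) v = nsq (leb {0..a}) v'" "nsq (leb {0..a}) w = nsq (leb {0..a}) w'"
    using m by (auto intro!: nsq_cong_AE simp: sq_int_def)
qed

text \<open>Cauchy-Schwarz for <w, u> = - |v|^2. It controls the first derivative by the other two
  norms.\<close>

lemma H2_interpolation:
  assumes "H2 a u v w"
  shows "(nsq (leb {0..a}) v)\<^sup>2 \<le> nsq (leb {0..a}) u * nsq (leb {0..a}) w"
  using ip_CS[OF H2_sq_int(3)[OF assms] H2_sq_int(1)[OF assms]]
  by (simp add: H2_ip[OF assms] norm_power mult.commute)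

lemma leb_FTC:
  fixes F :: "real \<Rightarrow> 'a::euclidean_space"
  assumes "a \<le> b" "\<And>x. a \<le> x \<Longrightarrow> x \<le> b \<Longrightarrow> (F has_vector_derivative f x) (at x within {a..b})"
    and "continuous_on {a..b} f"
  shows "(\<integral>x. f x \<partial>leb {a..b}) = F b - F a"
  using integral_FTC_atLeastAtMost[OF assms] by (simp add: integral_restrict_space)

lemma continuous_integrable_leb:
  fixes f :: "real \<Rightarrow> 'a::euclidean_space"
  assumes "continuous_on {a..b} f" shows "integrable (leb {a..b}) f"
  using borel_integrable_compact[OF _ assms] by (simp add: integrable_restrict_space)

lemma continuous_sq_int:
  fixes f :: "real \<Rightarrow> complex"
  assumes "continuous_on {a..b} f" shows "sq_int (leb {a..b}) f"
  unfolding sq_int_def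
  using borel_measurable_integrable[OF continuous_integrable_leb[OF assms]]
    continuous_integrable_leb[OF continuous_on_power[OF continuous_on_norm[OF assms]]] by blast

lemma nsq_le_const:
  fixes f :: "real \<Rightarrow> complex"
  assumes "sq_int (leb {0..1::real}) f" "\<And>x. 0 \<le> x \<Longrightarrow> x \<le> 1 \<Longrightarrow> (cmod (f x))\<^sup>2 \<le> e"
  shows "nsq (leb {0..1::real}) f \<le> e"
proof -
  have "nsq (leb {0..1::real}) f \<le> (\<integral>x. e \<partial>leb {0..1::real})"
    unfolding nsq_def
  proof (rule integral_mono_AE)
    show "integrable (leb {0..1::real}) (\<lambda>x. (cmod (f x))\<^sup>2)" using assms(1) by (simp add: sq_int_def)
    show "integrable (leb {0..1::real}) (\<lambda>x. e)" by (intro continuous_integrable_leb continuous_intros)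
    show "AE x in leb {0..1::real}. (cmod (f x))\<^sup>2 \<le> e"
      by (rule AE_I2) (use assms(2) in \<open>auto simp: space_restrict_space\<close>)
  qed
  thus ?thesis by (simp add: measure_restrict_space space_restrict_space)
qed

lemma test_function_ends:
  fixes \<phi> :: "real \<Rightarrow> complex"
  assumes "test_function {0..a} \<phi>" shows "\<phi> 0 = 0" "\<phi> a = 0"
proof -
  obtain K where K: "compact K" "K \<subseteq> interior {0..a}" "\<And>x. x \<notin> K \<Longrightarrow> \<phi> x = 0"
    using test_function_support[OF assms] by blast
  have "0 \<notin> K" "a \<notin> K" using K(2) unfolding interior_atLeastAtMost_real by auto
  thus "\<phi> 0 = 0" "\<phi> a = 0" using K(3) by auto
qed

text \<open>Completing the square with a Riccati solution: \<open>\<tau>\<close> satisfies \<tau>' =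
  k^2 + \<tau>^2, hence |\<phi>' + \<tau> \<phi>|^2 = |\<phi>'|^2 - k^2 |\<phi>|^2 + (\<tau>
  |\<phi>|^2)', and the last term integrates to 0. For k < pi the tangent stays finite on the closed
  interval.\<close>

lemma wirtinger_test_function:
  assumes t: "test_function {0..1} \<phi>" and k: "0 < k" "k < pi"
  shows "k\<^sup>2 * nsq (leb {0..1}) \<phi> \<le> nsq (leb {0..1}) (D \<phi>)"
proof -
  note s = test_functionD(1)[OF t]
  define \<tau> where "\<tau> = (\<lambda>x. k * tan (k * (x - 1/2)))"
  define G where "G = (\<lambda>x. (cmod (D \<phi> x + of_real (\<tau> x) * \<phi> x))\<^sup>2)"
  define g where "g = (\<lambda>x. (cmod (D \<phi> x))\<^sup>2 - k\<^sup>2 * (cmod (\<phi> x))\<^sup>2)"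
  have cosp: "cos (k * (x - 1/2)) > 0" if "x \<in> {0..1}" for x
  proof (rule cos_gt_zero_pi)
    have "\<bar>k * (x - 1/2)\<bar> \<le> k * (1/2)"
      unfolding abs_mult using k that by (intro mult_mono) (auto simp: abs_if)
    thus "- (pi / 2) < k * (x - 1/2)" "k * (x - 1/2) < pi / 2" using k by linarith+
  qed
  have der: "((\<lambda>x. \<tau> x * (cmod (\<phi> x))\<^sup>2) has_vector_derivative (G x - g x)) (at x within {0..1})"
    if "0 \<le> x" "x \<le> 1" for x
  proof -
    have c0: "cos (k * (x - 1/2)) \<noteq> 0" using cosp[of x] that by auto
    have d1: "(\<tau> has_real_derivative k\<^sup>2 + (\<tau> x)\<^sup>2) (at x within {0..1})"
    proof -
      have "((\<lambda>x. k * tan (k * (x - 1/2))) has_real_derivative k * ((inverse (cos (k * (x - 1/2))))\<^sup>2 * k)) (at x within {0..1})"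
        using c0 by (auto intro!: derivative_eq_intros simp: power_inverse)
      thus ?thesis
        unfolding \<tau>_def tan_sec[OF c0, symmetric] by (simp add: power_mult_distrib power2_eq_square algebra_simps)
    qed
    have dR: "((\<lambda>x. Re (\<phi> x)) has_real_derivative Re (D \<phi> x)) (at x within {0..1})"
             "((\<lambda>x. Im (\<phi> x)) has_real_derivative Im (D \<phi> x)) (at x within {0..1})"
      using smooth_has_vector_derivative[OF s, of x "{0..1}"]
      unfolding has_vector_derivative_complex_iff by auto
    have "((\<lambda>x. \<tau> x * ((Re (\<phi> x))\<^sup>2 + (Im (\<phi> x))\<^sup>2)) has_real_derivative
       (k\<^sup>2 + (\<tau> x)\<^sup>2) * ((Re (\<phi> x))\<^sup>2 + (Im (\<phi> x))\<^sup>2) + \<tau> x * (2 * Re (\<phi> x) * Re (D \<phi> x) + 2 * Im (\<phi> x) * Im (D \<phi> x)))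
        (at x within {0..1})"
      by (rule DERIV_cong[OF DERIV_mult[OF d1 DERIV_add[OF DERIV_power[OF dR(1), of 2] DERIV_power[OF dR(2), of 2]]]])
         (simp add: algebra_simps)
    moreover have "(k\<^sup>2 + (\<tau> x)\<^sup>2) * ((Re (\<phi> x))\<^sup>2 + (Im (\<phi> x))\<^sup>2)
        + \<tau> x * (2 * Re (\<phi> x) * Re (D \<phi> x) + 2 * Im (\<phi> x) * Im (D \<phi> x)) = G x - g x"
      by (simp only: G_def g_def cmod_power2) (simp add: power2_eq_square algebra_simps)
    ultimately show ?thesis
      by (simp only: has_real_derivative_iff_has_vector_derivative cmod_power2)
  qed
  have ctau: "continuous_on {0..1} \<tau>"
    unfolding \<tau>_def using cosp by (intro continuous_intros) force
  note cs = smooth_continuous[OF s, of "{0..1}"] smooth_continuous[OF smooth_D[OF s], of "{0..1}"]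
  have cG: "continuous_on {0..1} G" unfolding G_def by (intro continuous_intros ctau cs)
  have cg: "continuous_on {0..1} g" unfolding g_def by (intro continuous_intros cs)
  have "(\<integral>x. G x - g x \<partial>leb {0..1}) = 0"
    using leb_FTC[OF _ der, of] test_function_ends[OF t] cG cg by (simp add: continuous_on_diff)
  hence "(\<integral>x. g x \<partial>leb {0..1}) = (\<integral>x. G x \<partial>leb {0..1})"
    using continuous_integrable_leb[OF cG] continuous_integrable_leb[OF cg] by simp
  also have "\<dots> \<ge> 0" by (rule integral_nonneg_AE) (auto simp: G_def)
  finally have "(\<integral>x. g x \<partial>leb {0..1}) \<ge> 0" .
  moreover have "(\<integral>x. g x \<partial>leb {0..1}) = nsq (leb {0..1}) (D \<phi>) - k\<^sup>2 * nsq (leb {0..1}) \<phi>"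
    unfolding g_def nsq_def
    using continuous_sq_int[OF cs(1)] continuous_sq_int[OF cs(2)] by (simp add: sq_int_def)
  ultimately show ?thesis by simp
qed

lemma wirtinger:
  assumes "H2 1 u v w" shows "pi\<^sup>2 * nsq (leb {0..1}) u \<le> nsq (leb {0..1}) v"
proof -
  obtain \<phi> where t: "\<forall>n. test_function {0..1} (\<phi> n)" and L: "L2_lim (leb {0..1}) \<phi> u"
    "L2_lim (leb {0..1}) (\<lambda>n. D (\<phi> n)) v" "L2_lim (leb {0..1}) (\<lambda>n. D (D (\<phi> n))) w" using H2E[OF assms] .
  have "k\<^sup>2 * nsq (leb {0..1}) u \<le> nsq (leb {0..1}) v" if "0 < k" "k < pi" for k
    by (rule LIMSEQ_le[OF tendsto_mult_left[OF nsq_lim[OF L(1)]] nsq_lim[OF L(2)]])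
       (use wirtinger_test_function[OF t[rule_format] that] in auto)
  \<comment> \<open>At k = pi the tangent has poles at both endpoints, so the sharp constant is
    reached as a limit from below.\<close>
  hence "eventually (\<lambda>k. k\<^sup>2 * nsq (leb {0..1}) u \<le> nsq (leb {0..1}) v) (at_left pi)"
    unfolding eventually_at_left[OF pi_gt_zero] by (intro exI[of _ 0]) auto
  moreover have "((\<lambda>k. k\<^sup>2 * nsq (leb {0..1}) u) \<longlongrightarrow> pi\<^sup>2 * nsq (leb {0..1}) u) (at_left pi)"
    by (intro tendsto_intros)
  ultimately show ?thesis by (intro tendsto_upperbound[of _ _ "at_left pi"]) auto
qed

section \<open>Dilations of the interval\<close>

lemma nsq_scale:
  fixes f :: "real \<Rightarrow> complex"
  assumes "s > 0"
  shows "sq_int (leb {0..a}) f \<Longrightarrow> sq_int (leb {0..a/s}) (\<lambda>x. f (s * x))"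
    and "nsq (leb {0..a/s}) (\<lambda>x. f (s * x)) = nsq (leb {0..a}) f / s"
proof -
  have ind: "indicator {0..a/s} x = (indicator {0..a} (s * x) :: real)" for x
    using assms by (auto simp: indicator_def field_simps zero_le_mult_iff)
  have "nsq (leb {0..a}) f = (\<integral>x. indicator {0..a} x *\<^sub>R (cmod (f x))\<^sup>2 \<partial>lborel)"
    by (simp add: nsq_def integral_restrict_space)
  also have "\<dots> = s * (\<integral>x. indicator {0..a} (s * x) *\<^sub>R (cmod (f (s * x)))\<^sup>2 \<partial>lborel)"
    using lborel_integral_real_affine[of s "\<lambda>x. indicator {0..a} x *\<^sub>R (cmod (f x))\<^sup>2" 0] assms by simp
  also have "\<dots> = s * nsq (leb {0..a/s}) (\<lambda>x. f (s * x))"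
    by (simp add: nsq_def integral_restrict_space ind)
  finally show "nsq (leb {0..a/s}) (\<lambda>x. f (s * x)) = nsq (leb {0..a}) f / s" using assms by simp
  show "sq_int (leb {0..a/s}) (\<lambda>x. f (s * x))" if f: "sq_int (leb {0..a}) f"
  proof -
    have m: "(\<lambda>x. indicator {0..a} x *\<^sub>R f x) \<in> borel_measurable borel"
      using f by (simp add: sq_int_def borel_measurable_restrict_space_iff)
    have "(\<lambda>x. indicator {0..a} (s * x) *\<^sub>R f (s * x)) \<in> borel_measurable borel"
      by (rule measurable_compose[OF _ m]) simp
    hence "(\<lambda>x. f (s * x)) \<in> borel_measurable (leb {0..a/s})"
      by (simp add: borel_measurable_restrict_space_iff ind)
    moreover have "integrable lborel (\<lambda>x. indicator {0..a} x *\<^sub>R (cmod (f x))\<^sup>2)"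
      using f by (simp add: sq_int_def integrable_restrict_space)
    from lborel_integrable_real_affine[OF this, of s 0] assms
    have "integrable (leb {0..a/s}) (\<lambda>x. (cmod (f (s * x)))\<^sup>2)"
      by (simp add: integrable_restrict_space ind)
    ultimately show ?thesis by (simp add: sq_int_def)
  qed
qed

lemma L2_lim_scale:
  fixes s :: real
  assumes "s > 0" "L2_lim (leb {0..a}) F u"
  shows "L2_lim (leb {0..a/s}) (\<lambda>n x. F n (s * x)) (\<lambda>x. u (s * x))"
  unfolding L2_lim_def
proof (intro conjI allI nsq_scale(1) assms(1) L2_limD[OF assms(2)])
  show "(\<lambda>n. nsq (leb {0..a/s}) (\<lambda>x. F n (s * x) - u (s * x))) \<longlonglongrightarrow> 0"
    unfolding nsq_scale(2)[OF assms(1), of a "\<lambda>y. F _ y - u y"]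
    using tendsto_divide[OF L2_limD(3)[OF assms(2)] tendsto_const[of s]] assms(1) by simp
qed

lemma test_function_scale:
  assumes "s > 0" "test_function {0..a} \<phi>"
  shows "test_function {0..a/s} (\<lambda>x. \<phi> (s * x))" "D (\<lambda>x. \<phi> (s * x)) = (\<lambda>x. of_real s * D \<phi> (s * x))"
proof -
  note sm = test_functionD(1)[OF assms(2)]
  have L: "bounded_linear (\<lambda>x. s * x)" by (rule bounded_linear_mult_right)
  show "D (\<lambda>x. \<phi> (s * x)) = (\<lambda>x. of_real s * D \<phi> (s * x))"
    using smooth_linear(2)[OF sm L, of 1] by simp
  obtain K where K: "compact K" "K \<subseteq> interior {0..a}" "\<And>x. x \<notin> K \<Longrightarrow> \<phi> x = 0"
    using test_function_support[OF assms(2)] by blast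
  show "test_function {0..a/s} (\<lambda>x. \<phi> (s * x))"
  proof (rule test_functionI[OF smooth_linear(1)[OF sm L]])
    show "compact ((\<lambda>x. (1/s) *\<^sub>R x) ` K)" by (rule compact_scaling[OF K(1)])
    show "(\<lambda>x. (1/s) *\<^sub>R x) ` K \<subseteq> interior {0..a/s}"
      using K(2) assms(1) by (force simp: divide_strict_right_mono)
    fix x assume x: "x \<notin> (\<lambda>x. (1/s) *\<^sub>R x) ` K"
    have "s * x \<notin> K"
    proof
      assume "s * x \<in> K"
      hence "(1/s) *\<^sub>R (s * x) \<in> (\<lambda>x. (1/s) *\<^sub>R x) ` K" by (rule imageI)
      thus False using x assms(1) by simp
    qed
    thus "\<phi> (s * x) = 0" by (rule K(3))
  qed
qed

lemma H2_scale:
  assumes "s > 0" "H2 a u v w"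
  shows "H2 (a/s) (\<lambda>x. u (s * x)) (\<lambda>x. of_real s * v (s * x)) (\<lambda>x. of_real (s\<^sup>2) * w (s * x))"
proof -
  obtain \<phi> where t: "\<forall>n. test_function {0..a} (\<phi> n)" and L: "L2_lim (leb {0..a}) \<phi> u"
    "L2_lim (leb {0..a}) (\<lambda>n. D (\<phi> n)) v" "L2_lim (leb {0..a}) (\<lambda>n. D (D (\<phi> n))) w" using H2E[OF assms(2)] .
  note t = t[rule_format]
  have DD: "D (D (\<lambda>x. \<phi> n (s * x))) = (\<lambda>x. of_real (s\<^sup>2) * D (D (\<phi> n)) (s * x))" for n
  proof -
    have "smooth (\<lambda>x. D (\<phi> n) (s * x))"
      by (rule smooth_linear(1)[OF smooth_D[OF test_functionD(1)[OF t]] bounded_linear_mult_right])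
    thus ?thesis
      unfolding test_function_scale(2)[OF assms(1) t]
      by (subst D_cmult) (auto simp: test_function_scale(2)[OF assms(1) test_functionD_real[OF t]] power2_eq_square)
  qed
  show ?thesis
    by (rule H2I[of _ "\<lambda>n x. \<phi> n (s * x)"])
       (auto simp only: DD[unfolded test_function_scale(2)[OF assms(1) t]] test_function_scale(2)[OF assms(1) t]
          intro!: test_function_scale(1)[OF assms(1) t] L2_lim_cmult L2_lim_scale[OF assms(1)] L)
qed

section \<open>Existence of ground states\<close>

abbreviation I01 :: "real measure" where "I01 \<equiv> leb {0..1}"

text \<open>The variational form of the lowest eigenvalue; \<open>rho1_eq_mu\<close> identifies the
  two for \<alpha> \<ge> 0. Using triples keeps the choice of weak derivatives out of the
  minimisation.\<close>

definition mu :: "real \<Rightarrow> real" where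
  "mu \<alpha> = Inf {nsq I01 w + 2 * \<alpha> * nsq I01 v | u v w. H2 1 u v w \<and> nsq I01 u = 1}"

definition ground_state :: "real \<Rightarrow> (real \<Rightarrow> complex) \<Rightarrow> (real \<Rightarrow> complex) \<Rightarrow> (real \<Rightarrow> complex) \<Rightarrow> bool" where
  "ground_state \<alpha> u v w \<longleftrightarrow> H2 1 u v w \<and> nsq I01 u = 1 \<and> nsq I01 w + 2 * \<alpha> * nsq I01 v = mu \<alpha>"

lemma H2_normalize:
  assumes "H2 1 u v w" "nsq I01 u > 0"
  obtains c :: real where "c > 0" "c\<^sup>2 * nsq I01 u = 1"
    "H2 1 (\<lambda>x. of_real c * u x) (\<lambda>x. of_real c * v x) (\<lambda>x. of_real c * w x)"
proof
  show "1 / sqrt (nsq I01 u) > 0" "(1 / sqrt (nsq I01 u))\<^sup>2 * nsq I01 u = 1"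
    using assms(2) by (auto simp: power_divide)
qed (rule H2_cmult[OF assms(1)])

text \<open>If all test functions had norm 0, the constant 1 would be orthogonal to them and vanish
  by the fundamental lemma. This makes the set in \<open>mu\<close> nonempty.\<close>

lemma exists_test_function_pos: "\<exists>\<phi>. test_function {0..1::real} \<phi> \<and> nsq I01 \<phi> > 0"
proof (rule ccontr)
  assume neg: "\<not> ?thesis"
  have one: "sq_int I01 (\<lambda>x. 1)" by (intro continuous_sq_int continuous_intros)
  have ae: "AE x in leb (cbox 0 (1::real)). (1::complex) = 0"
  proof (rule fundamental_lemma)
    show "integrable (leb (cbox 0 (1::real))) (\<lambda>x. 1::complex)"
      by (rule sq_int_integrable[OF _ finite_measure_leb]) (use one in auto)
    fix \<phi> :: "real \<Rightarrow> complex" assume "test_function (cbox 0 1) \<phi>"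
    hence t: "test_function {0..1} \<phi>" by simp
    hence "nsq I01 \<phi> = 0" using neg nsq_nonneg[of I01 \<phi>] by (metis less_eq_real_def)
    hence "ip I01 \<phi> (\<lambda>x. 1) = 0"
      using ip_CS[OF test_function_sq_int[OF t] one] by simp
    thus "(\<integral>x. 1 * \<phi> x \<partial>leb (cbox 0 1)) = 0" by (simp add: ip_def)
  qed
  have "nsq I01 (\<lambda>x. 1) = nsq I01 (\<lambda>x. 0)"
    by (rule nsq_cong_AE) (use ae in \<open>auto simp only: cbox_interval\<close>, simp_all)
  thus False by (simp add: nsq_def measure_restrict_space space_restrict_space)
qed

lemma exists_H2_unit: obtains u v w where "H2 1 u v w" "nsq I01 u = 1"
proof -
  obtain \<phi> where t: "test_function {0..1::real} \<phi>" "nsq I01 \<phi> > 0" using exists_test_function_pos by blast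
  show ?thesis
    by (rule H2_normalize[OF H2_test_function[OF t(1)] t(2)]) (rule that, auto simp: nsq_cmult)
qed

lemma mu_le:
  assumes "\<alpha> \<ge> 0" "H2 1 u v w"
  shows "mu \<alpha> * nsq I01 u \<le> nsq I01 w + 2 * \<alpha> * nsq I01 v"
proof (cases "nsq I01 u = 0")
  case True thus ?thesis using assms(1) by simp
next
  case False
  hence "nsq I01 u > 0" using nsq_nonneg[of I01 u] by linarith
  then obtain c :: real where c: "c > 0" "c\<^sup>2 * nsq I01 u = 1"
    "H2 1 (\<lambda>x. of_real c * u x) (\<lambda>x. of_real c * v x) (\<lambda>x. of_real c * w x)"
    using H2_normalize[OF assms(2)] by metis
  have "mu \<alpha> \<le> nsq I01 (\<lambda>x. of_real c * w x) + 2 * \<alpha> * nsq I01 (\<lambda>x. of_real c * v x)"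
    unfolding mu_def
  proof (rule cInf_lower)
    show "bdd_below {nsq I01 w + 2 * \<alpha> * nsq I01 v | u v w. H2 1 u v w \<and> nsq I01 u = 1}"
      by (rule bdd_belowI[of _ 0]) (use assms(1) in \<open>auto intro!: add_nonneg_nonneg mult_nonneg_nonneg\<close>)
  next
    show "nsq I01 (\<lambda>x. of_real c * w x) + 2 * \<alpha> * nsq I01 (\<lambda>x. of_real c * v x)
      \<in> {nsq I01 w + 2 * \<alpha> * nsq I01 v | u v w. H2 1 u v w \<and> nsq I01 u = 1}"
      by (intro CollectI exI conjI, rule refl, rule c(3)) (use c(2) in \<open>simp add: nsq_cmult\<close>)
  qed
  also have "\<dots> = c\<^sup>2 * (nsq I01 w + 2 * \<alpha> * nsq I01 v)"
    by (simp add: nsq_cmult algebra_simps)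
  finally have "mu \<alpha> * nsq I01 u \<le> c\<^sup>2 * (nsq I01 w + 2 * \<alpha> * nsq I01 v) * nsq I01 u"
    by (rule mult_right_mono) simp
  also have "\<dots> = (c\<^sup>2 * nsq I01 u) * (nsq I01 w + 2 * \<alpha> * nsq I01 v)" by (simp add: mult_ac)
  finally show ?thesis using c(2) by simp
qed

lemma mu_greatest:
  assumes "\<And>u v w. H2 1 u v w \<Longrightarrow> nsq I01 u = 1 \<Longrightarrow> m \<le> nsq I01 w + 2 * \<alpha> * nsq I01 v"
  shows "m \<le> mu \<alpha>"
  unfolding mu_def
proof (rule cInf_greatest)
  obtain u v w where "H2 1 u v w" "nsq I01 u = 1" by (rule exists_H2_unit)
  thus "{nsq I01 w + 2 * \<alpha> * nsq I01 v |u v w. H2 1 u v w \<and> nsq I01 u = 1} \<noteq> {}" by auto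
qed (use assms in auto)

text \<open>Wirtinger gives pi^2 \<le> |u'|^2, and interpolation squares this to pi^4 \<le> |u''|^2.
  Positivity is what makes both wave numbers of the eigenvalue equation positive.\<close>

lemma mu_pos: assumes "\<alpha> \<ge> 0" shows "mu \<alpha> > 0"
proof -
  have "pi\<^sup>2 * pi\<^sup>2 \<le> mu \<alpha>"
  proof (rule mu_greatest)
    fix u v w assume H: "H2 1 u v w" and n: "nsq I01 u = 1"
    have v: "pi\<^sup>2 \<le> nsq I01 v" using wirtinger[OF H] n by simp
    hence "pi\<^sup>2 * pi\<^sup>2 \<le> (nsq I01 v)\<^sup>2" unfolding power2_eq_square by (intro mult_mono) auto
    also have "\<dots> \<le> nsq I01 w" using H2_interpolation[OF H] n by simp
    also have "\<dots> \<le> nsq I01 w + 2 * \<alpha> * nsq I01 v" using assms by simp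
    finally show "pi\<^sup>2 * pi\<^sup>2 \<le> nsq I01 w + 2 * \<alpha> * nsq I01 v" .
  qed
  thus ?thesis by (rule less_le_trans[rotated]) simp
qed

text \<open>Cauchy-Schwarz for \<phi>' against the indicator of [x, y]: Hoelder continuity of
  exponent 1/2, which supplies the equicontinuity for compactness.\<close>

lemma test_function_diff_bound:
  assumes t: "test_function {0..1} \<phi>" and xy: "0 \<le> x" "x \<le> y" "y \<le> 1"
  shows "(cmod (\<phi> y - \<phi> x))\<^sup>2 \<le> (y - x) * nsq I01 (D \<phi>)"
proof -
  note s = test_functionD(1)[OF t]
  let ?\<chi> = "\<lambda>z. indicator {x..y} z :: complex"
  have \<chi>: "sq_int I01 ?\<chi>" and n\<chi>: "nsq I01 ?\<chi> = y - x"
  proof -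
    have eq: "(cmod (?\<chi> z))\<^sup>2 = indicator {x..y} z" for z by (simp add: indicator_def)
    have eq2: "indicator {0..1} z * indicator {x..y} z = (indicator {x..y} z :: real)" for z
      using xy by (auto simp: indicator_def)
    show "sq_int I01 ?\<chi>" unfolding sq_int_def eq
      using borel_integrable_compact[of "{x..y}" "\<lambda>_. 1::real"]
      by (auto simp: integrable_restrict_space eq2 intro!: measurable_restrict_space1)
    show "nsq I01 ?\<chi> = y - x" unfolding nsq_def eq using xy
      by (simp add: measure_restrict_space)
  qed
  have eq: "indicator {0..1} z *\<^sub>R (D \<phi> z * cnj (?\<chi> z)) = indicator {x..y} z *\<^sub>R D \<phi> z" for z
    using xy by (auto simp: indicator_def)
  have "ip I01 (D \<phi>) ?\<chi> = (\<integral>z. indicator {x..y} z *\<^sub>R D \<phi> z \<partial>lborel)"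
    unfolding ip_def by (subst integral_restrict_space) (simp_all only: eq, simp)
  also have "\<dots> = \<phi> y - \<phi> x"
    by (rule integral_FTC_atLeastAtMost[OF xy(2)])
       (auto intro: smooth_has_vector_derivative s smooth_continuous smooth_D)
  finally have "(cmod (\<phi> y - \<phi> x))\<^sup>2 \<le> nsq I01 (D \<phi>) * nsq I01 ?\<chi>"
    using ip_CS[OF test_function_sq_int[OF test_functionD_real[OF t]] \<chi>] by simp
  thus ?thesis by (simp add: n\<chi> mult.commute)
qed

text \<open>A minimising sequence that converges in L2 is Cauchy in the energy norm, by the
  parallelogram law; the uniform convergence of a subsequence comes from Arzela-Ascoli.\<close>

lemma minimising_sequence_test:
  assumes \<alpha>: "\<alpha> \<ge> 0" and t: "\<And>n. test_function {0..1} (\<phi> n)"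
    and n1: "(\<lambda>n. nsq I01 (\<phi> n)) \<longlonglongrightarrow> 1"
    and q: "(\<lambda>n. nsq I01 (D (D (\<phi> n))) + 2 * \<alpha> * nsq I01 (D (\<phi> n))) \<longlonglongrightarrow> mu \<alpha>"
  shows "\<exists>r u v w. strict_mono r \<and> ground_state \<alpha> u v w \<and> (\<lambda>n. nsq I01 (D (\<phi> (r n)))) \<longlonglongrightarrow> nsq I01 v"
proof -
  define A where "A = (\<lambda>\<phi>. nsq I01 (D (D \<phi>)))"
  define B where "B = (\<lambda>\<phi>. nsq I01 (D \<phi>))"
  define N where "N = (\<lambda>\<phi>. nsq I01 \<phi>)"
  \<comment> \<open>The excess over the minimal energy, written homogeneously so that the functions
    need not have norm exactly 1.\<close>
  define \<delta> where "\<delta> = (\<lambda>n. A (\<phi> n) + 2 * \<alpha> * B (\<phi> n) - mu \<alpha> * N (\<phi> n))"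
  have \<delta>: "\<delta> \<longlonglongrightarrow> 0"
    using tendsto_diff[OF q tendsto_mult_left[OF n1, of "mu \<alpha>"]] by (simp add: \<delta>_def A_def B_def N_def)
  have nn: "A \<psi> \<ge> 0" "B \<psi> \<ge> 0" "N \<psi> \<ge> 0" for \<psi> by (auto simp: A_def B_def N_def)
  obtain C1 where C1: "\<And>n. A (\<phi> n) + 2 * \<alpha> * B (\<phi> n) \<le> C1"
    using convergent_imp_Bseq[OF convergentI[OF q]] unfolding Bseq_def A_def B_def by (metis abs_le_iff real_norm_def)
  obtain C2 where C2: "\<And>n. N (\<phi> n) \<le> C2"
    using convergent_imp_Bseq[OF convergentI[OF n1]] unfolding Bseq_def N_def by (metis abs_le_iff real_norm_def)
  \<comment> \<open>For \<alpha> = 0 the energy contains no first derivative, so the bound on it has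
    to come from interpolation.\<close>
  have BAN: "B \<psi> \<le> A \<psi> + N \<psi>" if "test_function {0..1} \<psi>" for \<psi>
  proof (rule power2_le_imp_le)
    have "(B \<psi>)\<^sup>2 \<le> N \<psi> * A \<psi>"
      using H2_interpolation[OF H2_test_function[OF that]] by (simp add: A_def B_def N_def)
    also have "\<dots> \<le> (A \<psi> + N \<psi>)\<^sup>2" using nn by (simp add: power2_sum mult.commute add_increasing)
    finally show "(B \<psi>)\<^sup>2 \<le> (A \<psi> + N \<psi>)\<^sup>2" .
  qed (use nn in simp)
  define C where "C = C1 + C2"
  have BC: "B (\<phi> n) \<le> C" for n
  proof -
    have "2 * \<alpha> * B (\<phi> n) \<ge> 0" using \<alpha> nn by simp
    thus ?thesis using BAN[OF t, of n] C1[of n] C2[of n] unfolding C_def by linarith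
  qed
  have C0: "C \<ge> 0" using BC[of 0] nn(2)[of "\<phi> 0"] by linarith
  have lip: "(cmod (\<phi> n y - \<phi> n x))\<^sup>2 \<le> \<bar>y - x\<bar> * C" if "x \<in> {0..1}" "y \<in> {0..1}" for n x y
  proof -
    have "(cmod (\<phi> n y - \<phi> n x))\<^sup>2 \<le> (y - x) * C" if "0 \<le> x" "x \<le> y" "y \<le> 1" for x y
      by (rule order_trans[OF test_function_diff_bound[OF t that]])
         (use BC[of n] that in \<open>auto simp: B_def intro: mult_left_mono\<close>)
    from this[of x y] this[of y x] show ?thesis
      using that by (cases "x \<le> y") (auto simp: norm_minus_commute)
  qed
  obtain g k where k: "strict_mono (k :: nat \<Rightarrow> nat)"
    and g: "\<And>e. 0 < e \<Longrightarrow> \<exists>N. \<forall>n x. n \<ge> N \<and> x \<in> {0..1} \<longrightarrow> norm (\<phi> (k n) x - g x) < e"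
  proof (rule Arzela_Ascoli[of "{0..1::real}" \<phi> "sqrt C"])
    fix n x assume x: "x \<in> {0..1::real}"
    have "(cmod (\<phi> n x))\<^sup>2 \<le> \<bar>x\<bar> * C" using lip[of 0 x n] x test_function_ends[OF t] by simp
    also have "\<dots> \<le> C" using x C0 by (auto intro: mult_left_le_one_le)
    finally show "norm (\<phi> n x) \<le> sqrt C" by (simp add: real_le_rsqrt)
  next
    fix x e :: real assume x: "x \<in> {0..1}" and e: "0 < e"
    show "\<exists>d. 0 < d \<and> (\<forall>n y. y \<in> {0..1} \<and> norm (x - y) < d \<longrightarrow> norm (\<phi> n x - \<phi> n y) < e)"
    proof (intro exI[of _ "e\<^sup>2 / (C + 1)"] conjI allI impI)
      show "0 < e\<^sup>2 / (C + 1)" using e C0 by simp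
      fix n y assume y: "y \<in> {0..1} \<and> norm (x - y) < e\<^sup>2 / (C + 1)"
      have "(norm (\<phi> n x - \<phi> n y))\<^sup>2 \<le> \<bar>x - y\<bar> * C" using lip x y by blast
      also have "\<dots> \<le> \<bar>x - y\<bar> * (C + 1)" by (intro mult_left_mono) auto
      also have "\<dots> < e\<^sup>2" using y C0 by (simp add: field_simps)
      finally show "norm (\<phi> n x - \<phi> n y) < e" using e by (simp add: power2_less_imp_less)
    qed
  qed (use that in auto)
  have diffN: "\<exists>M. \<forall>m\<ge>M. \<forall>n\<ge>M. N (\<lambda>x. \<phi> (k m) x - \<phi> (k n) x) < e" if "e > 0" for e
  proof -
    \<comment> \<open>(2 e')^2 = e/4, which leaves room for the strict inequality.\<close>
    define e' where "e' = sqrt e / 4"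
    have e': "e' > 0" using that by (simp add: e'_def)
    then obtain M where M: "\<And>n x. n \<ge> M \<Longrightarrow> x \<in> {0..1} \<Longrightarrow> norm (\<phi> (k n) x - g x) < e'" using g by meson
    have "N (\<lambda>x. \<phi> (k m) x - \<phi> (k n) x) < e" if "m \<ge> M" "n \<ge> M" for m n
    proof -
      have b: "cmod (\<phi> (k m) x - \<phi> (k n) x) \<le> 2 * e'" if x: "x \<in> {0..1}" for x
        using M[OF \<open>m \<ge> M\<close> x] M[OF \<open>n \<ge> M\<close> x] norm_triangle_ineq4[of "\<phi> (k m) x - g x" "\<phi> (k n) x - g x"] by simp
      have "N (\<lambda>x. \<phi> (k m) x - \<phi> (k n) x) \<le> (2 * e')\<^sup>2"
        unfolding N_def
        by (rule nsq_le_const[OF sq_int_diff[OF test_function_sq_int[OF t] test_function_sq_int[OF t]]])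
           (use power_mono[OF b norm_ge_zero, of _ 2] in auto)
      also have "\<dots> < e" using \<open>e > 0\<close> by (simp add: e'_def power_mult_distrib power_divide)
      finally show ?thesis .
    qed
    thus ?thesis by blast
  qed
  have sm: "smooth (\<phi> n)" for n by (rule test_functionD(1)[OF t])
  have Dd: "D (\<lambda>x. \<phi> m x - \<phi> n x) = (\<lambda>x. D (\<phi> m) x - D (\<phi> n) x)"
    and DDd: "D (D (\<lambda>x. \<phi> m x - \<phi> n x)) = (\<lambda>x. D (D (\<phi> m)) x - D (D (\<phi> n)) x)"
    and Da: "D (\<lambda>x. \<phi> m x + \<phi> n x) = (\<lambda>x. D (\<phi> m) x + D (\<phi> n) x)"
    and DDa: "D (D (\<lambda>x. \<phi> m x + \<phi> n x)) = (\<lambda>x. D (D (\<phi> m)) x + D (D (\<phi> n)) x)" for m n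
  proof -
    have s: "smooth (\<lambda>x. -1 * \<phi> n x)" "smooth (\<lambda>x. -1 * D (\<phi> n) x)"
      by (intro smooth_mult smooth_const sm smooth_D)+
    show "D (\<lambda>x. \<phi> m x - \<phi> n x) = (\<lambda>x. D (\<phi> m) x - D (\<phi> n) x)"
      using D_add[OF sm s(1), of m] D_cmult[OF sm, of "-1" n] by simp
    thus "D (D (\<lambda>x. \<phi> m x - \<phi> n x)) = (\<lambda>x. D (D (\<phi> m)) x - D (D (\<phi> n)) x)"
      using D_add[OF smooth_D[OF sm] s(2), of m] D_cmult[OF smooth_D[OF sm], of "-1" n] by simp
    show "D (\<lambda>x. \<phi> m x + \<phi> n x) = (\<lambda>x. D (\<phi> m) x + D (\<phi> n) x)" by (rule D_add[OF sm sm])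
    thus "D (D (\<lambda>x. \<phi> m x + \<phi> n x)) = (\<lambda>x. D (D (\<phi> m)) x + D (D (\<phi> n)) x)"
      using D_add[OF smooth_D[OF sm] smooth_D[OF sm], of m n] by simp
  qed
  note sq = test_function_sq_int[OF t] test_function_sq_int[OF test_functionD_real[OF t]]
    test_function_sq_int[OF test_functionD_real[OF test_functionD_real[OF t]]]
  \<comment> \<open>Parallelogram law for all three norms; the sum of \<open>\<phi> m\<close> and
    \<open>\<phi> n\<close> is bounded below by \<open>mu_le\<close>, which leaves the two excesses
    and the already controlled L2 distance.\<close>
  have key: "A (\<lambda>x. \<phi> m x - \<phi> n x) + 2 * \<alpha> * B (\<lambda>x. \<phi> m x - \<phi> n x)
       \<le> 2 * \<delta> m + 2 * \<delta> n + mu \<alpha> * N (\<lambda>x. \<phi> m x - \<phi> n x)" for m n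
  proof -
    have e: "A (\<lambda>x. \<phi> m x - \<phi> n x) = 2 * A (\<phi> m) + 2 * A (\<phi> n) - A (\<lambda>x. \<phi> m x + \<phi> n x)"
         "B (\<lambda>x. \<phi> m x - \<phi> n x) = 2 * B (\<phi> m) + 2 * B (\<phi> n) - B (\<lambda>x. \<phi> m x + \<phi> n x)"
         "N (\<lambda>x. \<phi> m x - \<phi> n x) = 2 * N (\<phi> m) + 2 * N (\<phi> n) - N (\<lambda>x. \<phi> m x + \<phi> n x)"
      unfolding A_def B_def N_def DDd[unfolded Dd] DDa[unfolded Da] Dd Da DDd[unfolded Dd] DDa[unfolded Da]
      by (rule nsq_parallelogram; rule sq; simp)+
    have "mu \<alpha> * N (\<lambda>x. \<phi> m x + \<phi> n x) \<le> A (\<lambda>x. \<phi> m x + \<phi> n x) + 2 * \<alpha> * B (\<lambda>x. \<phi> m x + \<phi> n x)"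
      unfolding A_def B_def N_def by (intro mu_le \<alpha> H2_test_function test_function_add t)
    thus ?thesis unfolding e \<delta>_def by (simp add: algebra_simps)
  qed
  have diffA: "\<exists>M. \<forall>m\<ge>M. \<forall>n\<ge>M. A (\<lambda>x. \<phi> (k m) x - \<phi> (k n) x) < e" if "e > 0" for e
  proof -
    have \<delta>k: "(\<lambda>n. \<delta> (k n)) \<longlonglongrightarrow> 0" using LIMSEQ_subseq_LIMSEQ[OF \<delta> k] by (simp add: o_def)
    have "eventually (\<lambda>n. \<delta> (k n) < e / 8) sequentially"
      by (rule order_tendstoD(2)[OF \<delta>k]) (use that in auto)
    then obtain M1 where M1: "\<And>n. n \<ge> M1 \<Longrightarrow> \<delta> (k n) < e / 8" by (auto simp: eventually_sequentially)
    obtain M2 where M2: "\<forall>m\<ge>M2. \<forall>n\<ge>M2. N (\<lambda>x. \<phi> (k m) x - \<phi> (k n) x) < e / (2 * mu \<alpha>)"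
      using diffN[of "e / (2 * mu \<alpha>)"] mu_pos[OF \<alpha>] \<open>e > 0\<close> by auto
    have "A (\<lambda>x. \<phi> (k m) x - \<phi> (k n) x) < e" if mn: "m \<ge> max M1 M2" "n \<ge> max M1 M2" for m n
    proof -
      have "N (\<lambda>x. \<phi> (k m) x - \<phi> (k n) x) < e / (2 * mu \<alpha>)" using M2 mn by auto
      hence "mu \<alpha> * N (\<lambda>x. \<phi> (k m) x - \<phi> (k n) x) < e / 2"
        using mu_pos[OF \<alpha>] by (simp add: field_simps)
      moreover have "\<delta> (k m) < e / 8" "\<delta> (k n) < e / 8" using M1 mn by auto
      moreover have "2 * \<alpha> * B (\<lambda>x. \<phi> (k m) x - \<phi> (k n) x) \<ge> 0" using \<alpha> nn by simp
      ultimately show ?thesis using key[of "k m" "k n"] by linarith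
    qed
    thus ?thesis by blast
  qed
  have diffB: "\<exists>M. \<forall>m\<ge>M. \<forall>n\<ge>M. B (\<lambda>x. \<phi> (k m) x - \<phi> (k n) x) < e" if "e > 0" for e
  proof -
    obtain M1 where M1: "\<forall>m\<ge>M1. \<forall>n\<ge>M1. A (\<lambda>x. \<phi> (k m) x - \<phi> (k n) x) < e / 2"
      using diffA[of "e/2"] \<open>e > 0\<close> by auto
    obtain M2 where M2: "\<forall>m\<ge>M2. \<forall>n\<ge>M2. N (\<lambda>x. \<phi> (k m) x - \<phi> (k n) x) < e / 2"
      using diffN[of "e/2"] \<open>e > 0\<close> by auto
    have "B (\<lambda>x. \<phi> (k m) x - \<phi> (k n) x) < e" if mn: "m \<ge> max M1 M2" "n \<ge> max M1 M2" for m n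
      using BAN[OF test_function_diff[OF t t], of "k m" "k n"] M1[rule_format, of m n] M2[rule_format, of m n] mn by auto
    thus ?thesis by blast
  qed
  have fm: "finite_measure I01" using finite_measure_leb[of 0 "1::real"] by simp
  obtain u where u: "L2_lim I01 (\<lambda>n. \<phi> (k n)) u"
    using L2_complete[of I01 "\<lambda>n. \<phi> (k n)", OF sq(1) fm] diffN unfolding N_def by auto
  obtain v where v: "L2_lim I01 (\<lambda>n. D (\<phi> (k n))) v"
    using L2_complete[of I01 "\<lambda>n. D (\<phi> (k n))", OF sq(2) fm] diffB unfolding B_def Dd by auto
  obtain w where w: "L2_lim I01 (\<lambda>n. D (D (\<phi> (k n)))) w"
    using L2_complete[of I01 "\<lambda>n. D (D (\<phi> (k n)))", OF sq(3) fm] diffA unfolding A_def DDd by auto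
  have H: "H2 1 u v w" by (rule H2I[OF t u v w])
  have "(\<lambda>n. nsq I01 (\<phi> (k n))) \<longlonglongrightarrow> 1" using LIMSEQ_subseq_LIMSEQ[OF n1 k] by (simp add: o_def)
  hence "nsq I01 u = 1" using nsq_lim[OF u] LIMSEQ_unique by blast
  moreover have "(\<lambda>n. nsq I01 (D (D (\<phi> (k n)))) + 2 * \<alpha> * nsq I01 (D (\<phi> (k n)))) \<longlonglongrightarrow> mu \<alpha>"
    using LIMSEQ_subseq_LIMSEQ[OF q k] by (simp add: o_def)
  hence "nsq I01 w + 2 * \<alpha> * nsq I01 v = mu \<alpha>"
    using tendsto_add[OF nsq_lim[OF w] tendsto_mult_left[OF nsq_lim[OF v], of "2 * \<alpha>"]] LIMSEQ_unique by blast
  ultimately have "ground_state \<alpha> u v w" using H by (simp add: ground_state_def)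
  thus ?thesis using k nsq_lim[OF v] by blast
qed

text \<open>Only the three norms of each triple matter, so it can be traded for a single test
  function whose squared norms are within 1/(n+1). The limit of |v|^2 along the subsequence is
  recorded because it yields continuity in \<alpha>.\<close>

lemma minimising_sequence:
  assumes \<alpha>: "\<alpha> \<ge> 0" and H: "\<And>n. H2 1 (u n) (v n) (w n)"
    and n1: "(\<lambda>n. nsq I01 (u n)) \<longlonglongrightarrow> 1"
    and q: "(\<lambda>n. nsq I01 (w n) + 2 * \<alpha> * nsq I01 (v n)) \<longlonglongrightarrow> mu \<alpha>"
  shows "\<exists>r u' v' w'. strict_mono r \<and> ground_state \<alpha> u' v' w' \<and> (\<lambda>n. nsq I01 (v (r n))) \<longlonglongrightarrow> nsq I01 v'"
proof -
  have "\<exists>\<phi>. test_function {0..1} \<phi> \<and> \<bar>nsq I01 \<phi> - nsq I01 (u n)\<bar> < 1 / real (Suc n) \<and>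
     \<bar>nsq I01 (D \<phi>) - nsq I01 (v n)\<bar> < 1 / real (Suc n) \<and> \<bar>nsq I01 (D (D \<phi>)) - nsq I01 (w n)\<bar> < 1 / real (Suc n)" for n
  proof -
    obtain \<phi> where t: "\<forall>n. test_function {0..1} (\<phi> n)" and L: "L2_lim I01 \<phi> (u n)"
      "L2_lim I01 (\<lambda>n. D (\<phi> n)) (v n)" "L2_lim I01 (\<lambda>n. D (D (\<phi> n))) (w n)" using H2E[OF H] .
    have "eventually (\<lambda>j. \<bar>nsq I01 (\<phi> j) - nsq I01 (u n)\<bar> < 1 / real (Suc n)) sequentially"
         "eventually (\<lambda>j. \<bar>nsq I01 (D (\<phi> j)) - nsq I01 (v n)\<bar> < 1 / real (Suc n)) sequentially"
         "eventually (\<lambda>j. \<bar>nsq I01 (D (D (\<phi> j))) - nsq I01 (w n)\<bar> < 1 / real (Suc n)) sequentially"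
      using tendstoD[OF nsq_lim[OF L(1)], of "1 / real (Suc n)"] tendstoD[OF nsq_lim[OF L(2)], of "1 / real (Suc n)"]
        tendstoD[OF nsq_lim[OF L(3)], of "1 / real (Suc n)"] by (simp_all add: dist_real_def)
    hence "eventually (\<lambda>j. \<bar>nsq I01 (\<phi> j) - nsq I01 (u n)\<bar> < 1 / real (Suc n) \<and>
      \<bar>nsq I01 (D (\<phi> j)) - nsq I01 (v n)\<bar> < 1 / real (Suc n) \<and> \<bar>nsq I01 (D (D (\<phi> j))) - nsq I01 (w n)\<bar> < 1 / real (Suc n)) sequentially"
      by eventually_elim auto
    thus ?thesis using t unfolding eventually_sequentially by blast
  qed
  then obtain \<phi> where t: "\<And>n. test_function {0..1} (\<phi> n)"
    and a: "\<And>n. \<bar>nsq I01 (\<phi> n) - nsq I01 (u n)\<bar> < 1 / real (Suc n)"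
     "\<And>n. \<bar>nsq I01 (D (\<phi> n)) - nsq I01 (v n)\<bar> < 1 / real (Suc n)"
     "\<And>n. \<bar>nsq I01 (D (D (\<phi> n))) - nsq I01 (w n)\<bar> < 1 / real (Suc n)" by metis
  have l: "(\<lambda>n. f n - g n) \<longlonglongrightarrow> 0" if "\<And>n. \<bar>f n - g n\<bar> < 1 / real (Suc n)" for f g :: "nat \<Rightarrow> real"
  proof (rule tendsto_rabs_zero_cancel, rule tendsto_0_squeeze)
    show "(\<lambda>n. 1 / real (Suc n)) \<longlonglongrightarrow> 0" by (rule LIMSEQ_Suc[OF lim_1_over_n])
  qed (use that less_imp_le in auto)
  note l1 = l[OF a(1)] and l2 = l[OF a(2)] and l3 = l[OF a(3)]
  have "\<exists>r u v w. strict_mono r \<and> ground_state \<alpha> u v w \<and> (\<lambda>n. nsq I01 (D (\<phi> (r n)))) \<longlonglongrightarrow> nsq I01 v"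
  proof (rule minimising_sequence_test[OF \<alpha> t])
    show "(\<lambda>n. nsq I01 (\<phi> n)) \<longlonglongrightarrow> 1" using tendsto_add[OF l1 n1] by simp
    show "(\<lambda>n. nsq I01 (D (D (\<phi> n))) + 2 * \<alpha> * nsq I01 (D (\<phi> n))) \<longlonglongrightarrow> mu \<alpha>"
      using tendsto_add[OF tendsto_add[OF l3 tendsto_mult_left[OF l2, of "2 * \<alpha>"]] q] by (simp add: algebra_simps)
  qed
  then obtain r u' v' w' where r: "strict_mono r" "ground_state \<alpha> u' v' w'"
     "(\<lambda>n. nsq I01 (D (\<phi> (r n)))) \<longlonglongrightarrow> nsq I01 v'" by blast
  have "(\<lambda>n. nsq I01 (v (r n))) \<longlonglongrightarrow> nsq I01 v'"
    using tendsto_diff[OF r(3) LIMSEQ_subseq_LIMSEQ[OF l2 r(1)]] by (simp add: o_def)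
  thus ?thesis using r by blast
qed

lemma ground_state_exists: assumes \<alpha>: "\<alpha> \<ge> 0" obtains u v w where "ground_state \<alpha> u v w"
proof -
  have "\<exists>u v w. H2 1 u v w \<and> nsq I01 u = 1 \<and> nsq I01 w + 2 * \<alpha> * nsq I01 v < mu \<alpha> + 1 / real (Suc n)" for n
  proof (rule ccontr)
    assume "\<not> ?thesis"
    hence "mu \<alpha> + 1 / real (Suc n) \<le> mu \<alpha>" by (intro mu_greatest) (metis not_le)
    thus False by simp
  qed
  then obtain u v w where H: "\<And>n. H2 1 (u n) (v n) (w n)" "\<And>n. nsq I01 (u n) = 1"
    "\<And>n. nsq I01 (w n) + 2 * \<alpha> * nsq I01 (v n) < mu \<alpha> + 1 / real (Suc n)" by metis
  have "(\<lambda>n. nsq I01 (w n) + 2 * \<alpha> * nsq I01 (v n)) \<longlonglongrightarrow> mu \<alpha>"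
  proof (rule tendsto_sandwich[OF _ _ tendsto_const])
    show "(\<lambda>n. mu \<alpha> + 1 / real (Suc n)) \<longlonglongrightarrow> mu \<alpha>"
      using tendsto_add[OF tendsto_const LIMSEQ_Suc[OF lim_1_over_n], of "mu \<alpha>"] by simp
    show "eventually (\<lambda>n. mu \<alpha> \<le> nsq I01 (w n) + 2 * \<alpha> * nsq I01 (v n)) sequentially"
      using mu_le[OF \<alpha> H(1)] H(2) by simp
    show "eventually (\<lambda>n. nsq I01 (w n) + 2 * \<alpha> * nsq I01 (v n) \<le> mu \<alpha> + 1 / real (Suc n)) sequentially"
      by (intro always_eventually allI less_imp_le H(3))
  qed
  from minimising_sequence[OF \<alpha> H(1) _ this] H(2) show ?thesis using that by auto
qed

text \<open>The first variations in the directions \<open>\<psi>\<close> and \<open>\<i>\<psi>\<close> give the real and the imaginary part.\<close>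

lemma ground_state_euler_lagrange:
  assumes \<alpha>: "\<alpha> \<ge> 0" and g: "ground_state \<alpha> u v w" and H: "H2 1 \<psi> \<psi>1 \<psi>2"
  shows "ip I01 w \<psi>2 + 2 * of_real \<alpha> * ip I01 v \<psi>1 = of_real (mu \<alpha>) * ip I01 u \<psi>"
proof -
  have G: "H2 1 u v w" "nsq I01 u = 1" "nsq I01 w + 2 * \<alpha> * nsq I01 v = mu \<alpha>"
    using g by (auto simp: ground_state_def)
  have Re0: "Re (ip I01 w \<psi>2 + 2 * of_real \<alpha> * ip I01 v \<psi>1 - of_real (mu \<alpha>) * ip I01 u \<psi>) = 0"
    if H: "H2 1 \<psi> \<psi>1 \<psi>2" for \<psi> \<psi>1 \<psi>2
  proof -
    define X where "X = Re (ip I01 w \<psi>2 + 2 * of_real \<alpha> * ip I01 v \<psi>1 - of_real (mu \<alpha>) * ip I01 u \<psi>)"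
    define Y where "Y = nsq I01 \<psi>2 + 2 * \<alpha> * nsq I01 \<psi>1 - mu \<alpha> * nsq I01 \<psi>"
    have Y: "Y \<ge> 0" using mu_le[OF \<alpha> H] by (simp add: Y_def)
    \<comment> \<open>Minimality of u against u + t \<psi>: X is half of the first variation and Y
      the excess energy of the direction. A nonnegative quadratic without constant term has no
      linear term.\<close>
    have main: "0 \<le> 2 * t * X + t\<^sup>2 * Y" for t
    proof -
      let ?c = "of_real t :: complex"
      note S = H2_sq_int[OF G(1)] H2_sq_int[OF H2_cmult[OF H, of ?c]]
      have "mu \<alpha> * nsq I01 (\<lambda>x. u x + ?c * \<psi> x) \<le> nsq I01 (\<lambda>x. w x + ?c * \<psi>2 x) + 2 * \<alpha> * nsq I01 (\<lambda>x. v x + ?c * \<psi>1 x)"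
        by (rule mu_le[OF \<alpha> H2_add[OF G(1) H2_cmult[OF H]]])
      hence "mu \<alpha> * (1 + t\<^sup>2 * nsq I01 \<psi> + 2 * t * Re (ip I01 u \<psi>)) \<le>
         nsq I01 w + t\<^sup>2 * nsq I01 \<psi>2 + 2 * t * Re (ip I01 w \<psi>2) +
         2 * \<alpha> * (nsq I01 v + t\<^sup>2 * nsq I01 \<psi>1 + 2 * t * Re (ip I01 v \<psi>1))"
        by (simp add: nsq_add S nsq_cmult ip_cmult_right G(2) mult_ac)
      thus ?thesis using G(3) by (simp add: X_def Y_def algebra_simps)
    qed
    have "X = 0"
    proof (cases "Y = 0")
      case True
      thus ?thesis using main[of 1] main[of "-1"] by simp
    next
      case False
      hence "Y > 0" using Y by simp
      moreover have "0 \<le> - (X\<^sup>2) / Y"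
        using main[of "- X / Y"] \<open>Y > 0\<close> by (simp add: power2_eq_square field_simps)
      ultimately have "X\<^sup>2 \<le> 0" by (simp add: divide_le_0_iff)
      thus ?thesis by simp
    qed
    thus ?thesis by (simp add: X_def)
  qed
  have "Im (ip I01 w \<psi>2 + 2 * of_real \<alpha> * ip I01 v \<psi>1 - of_real (mu \<alpha>) * ip I01 u \<psi>) = 0"
    using Re0[OF H2_cmult[OF H, of \<i>]] by (simp add: ip_cmult_right)
  with Re0[OF H] show ?thesis by (simp add: complex_eq_iff)
qed

section \<open>Regularity of ground states\<close>

lemma test_function_support_interval:
  assumes "test_function {0..1::real} \<psi>"
  obtains a b where "0 < a" "a < b" "b < 1" "\<And>x. x \<le> a \<or> b \<le> x \<Longrightarrow> \<psi> x = 0"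
proof -
  obtain K where K: "compact K" "K \<subseteq> interior {0..1}" "\<And>x. x \<notin> K \<Longrightarrow> \<psi> x = 0"
    using test_function_support[OF assms] by blast
  have sub: "K \<subseteq> {0<..<1}" using K(2) unfolding interior_atLeastAtMost_real .
  show ?thesis
  proof (cases "K = {}")
    case True
    thus ?thesis using K(3) by (intro that[of "1/3" "2/3"]) auto
  next
    case False
    obtain p where p: "p \<in> K" "\<forall>t\<in>K. p \<le> t" using compact_attains_inf[OF K(1) False] by blast
    obtain q where q: "q \<in> K" "\<forall>t\<in>K. t \<le> q" using compact_attains_sup[OF K(1) False] by blast
    have pq: "0 < p" "p \<le> q" "q < 1" using p q sub by auto
    show ?thesis
    \<comment> \<open>Moving outwards from the extreme points of K keeps a < b even if K is a single
      point.\<close>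
    proof (rule that[of "p/2" "(q+1)/2"])
      fix x assume "x \<le> p/2 \<or> (q+1)/2 \<le> x"
      moreover have "p \<le> x \<and> x \<le> q" if "x \<in> K" using p(2) q(2) that by blast
      ultimately have "x \<notin> K" using pq by fastforce
      thus "\<psi> x = 0" by (rule K(3))
    qed (use pq in auto)
  qed
qed

text \<open>The primitive that starts left of the support is constant to its right, with the total
  integral as its value; mean zero is what makes it compactly supported again.\<close>

lemma test_function_primitive:
  assumes t: "test_function {0..1::real} \<psi>" and z: "(\<integral>x. \<psi> x \<partial>I01) = 0"
  obtains \<Psi> where "test_function {0..1} \<Psi>" "D \<Psi> = \<psi>"
proof -
  obtain a b where ab: "0 < a" "a < b" "b < 1" "\<And>x. x \<le> a \<or> b \<le> x \<Longrightarrow> \<psi> x = 0"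
    using test_function_support_interval[OF t] by blast
  note s = test_functionD(1)[OF t]
  define \<Psi> where "\<Psi> = (\<lambda>x. integral {-1..x} \<psi>)"
  have neg: "\<Psi> x = 0" if "x \<le> a" for x
  proof -
    have "integral {-1..x} \<psi> = integral {-1..x} (\<lambda>_. 0)"
      by (rule integral_cong) (use ab that in auto)
    thus ?thesis by (simp add: \<Psi>_def)
  qed
  have der: "(\<Psi> has_vector_derivative \<psi> x) (at x)" for x
  proof (cases "x < a")
    case True
    have "((\<lambda>x. 0) has_vector_derivative \<psi> x) (at x)" using ab(4)[of x] True by simp
    thus ?thesis
      by (rule has_vector_derivative_transform_within_open[of _ _ _ "{..<a}"]) (use True neg in auto)
  next
    case False
    have "(\<Psi> has_vector_derivative \<psi> x) (at x within {-1..x+1})"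
      unfolding \<Psi>_def using False ab(1)
      by (intro integral_has_vector_derivative smooth_continuous s) auto
    moreover have "x \<in> interior {-1..x+1}" using False ab(1) by (simp add: interior_atLeastAtMost_real)
    ultimately show ?thesis by (simp only: at_within_interior)
  qed
  have D\<Psi>: "D \<Psi> = \<psi>"
    using der pderiv_at_eq[of \<Psi> _ _ 1] by (fastforce simp: has_vector_derivative_def)
  have "\<Psi> 1 = \<Psi> 1 - \<Psi> 0" using neg[of 0] ab by simp
  also have "\<dots> = (\<integral>x. \<psi> x \<partial>I01)"
    by (rule leb_FTC[symmetric]) (auto intro: has_vector_derivative_at_within der smooth_continuous s)
  finally have one: "\<Psi> 1 = 0" using z by simp
  have pos: "\<Psi> x = 0" if "b \<le> x" for x
  proof -
    have c: "\<Psi> y = \<Psi> b" if "b \<le> y" for y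
    proof -
      have "integral {-1..b} \<psi> + integral {b..y} \<psi> = integral {-1..y} \<psi>"
        by (rule Henstock_Kurzweil_Integration.integral_combine)
           (use that ab in \<open>auto intro: integrable_continuous_interval smooth_continuous s\<close>)
      moreover have "integral {b..y} \<psi> = integral {b..y} (\<lambda>_. 0)"
        by (rule integral_cong) (use ab in auto)
      ultimately show ?thesis by (simp add: \<Psi>_def)
    qed
    show ?thesis using c[OF that] c[of 1] one ab by simp
  qed
  have "smooth \<Psi>"
  proof (rule smoothI)
    show "\<Psi> differentiable at x" for x using der differentiableI_vector by blast
    show "smooth (pderiv_at i \<Psi>)" if "i \<in> Basis" for i using that D\<Psi> s by simp
  qed
  hence "test_function {0..1} \<Psi>"
  proof (rule test_functionI)
    show "{a..b} \<subseteq> interior {0..1}" using ab unfolding interior_atLeastAtMost_real by auto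
    show "\<Psi> x = 0" if "x \<notin> {a..b}" for x using that neg pos by force
  qed simp
  thus ?thesis using D\<Psi> that by blast
qed

text \<open>Integration by parts with the weight 1 - x, without boundary terms. It expresses the
  mean of a primitive as a moment of the function that was integrated.\<close>

lemma integral_test_primitive:
  assumes t: "test_function {0..1::real} \<xi>"
  shows "(\<integral>x. \<xi> x \<partial>I01) = (\<integral>x. of_real (1 - x) * D \<xi> x \<partial>I01)"
proof -
  note s = test_functionD(1)[OF t]
  note cs = smooth_continuous[OF s, of "{0..1}"] smooth_continuous[OF smooth_D[OF s], of "{0..1}"]
  have "(\<integral>x. of_real (1 - x) * D \<xi> x - \<xi> x \<partial>I01) = of_real (1 - 1) * \<xi> 1 - of_real (1 - 0) * \<xi> 0"
  proof (rule leb_FTC)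
    fix x :: real
    have "((\<lambda>x. complex_of_real (1 - x)) has_vector_derivative -1) (at x within {0..1})"
      using has_vector_derivative_of_real[of "\<lambda>x. 1 - x" "-1" "at x within {0..1}"]
      by (auto intro!: derivative_eq_intros simp: has_real_derivative_iff_has_vector_derivative[symmetric])
    from has_vector_derivative_mult[OF this smooth_has_vector_derivative[OF s]]
    show "((\<lambda>x. of_real (1 - x) * \<xi> x) has_vector_derivative of_real (1 - x) * D \<xi> x - \<xi> x) (at x within {0..1})"
      by simp
  qed (auto intro!: continuous_intros cs)
  also have "\<dots> = 0" using test_function_ends[OF t] by simp
  finally have "(\<integral>x. of_real (1 - x) * D \<xi> x - \<xi> x \<partial>I01) = 0" .
  moreover have "integrable I01 (\<lambda>x. of_real (1 - x) * D \<xi> x)" "integrable I01 \<xi>"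
    by (intro continuous_integrable_leb continuous_intros smooth_continuous smooth_D s)+
  ultimately show ?thesis by simp
qed

lemma exists_test_function_unit: "\<exists>\<eta>. test_function {0..1::real} \<eta> \<and> (\<integral>x. \<eta> x \<partial>I01) = 1"
proof -
  obtain \<phi> where t: "test_function {0..1::real} \<phi>" "nsq I01 \<phi> > 0" using exists_test_function_pos by blast
  define c where "c = complex_of_real (1 / nsq I01 \<phi>)"
  have "test_function {0..1} (\<lambda>x. c * (\<phi> x * cnj (\<phi> x)))"
    by (intro test_function_cmult test_function_mult t smooth_cnj test_functionD(1)[OF t(1)])
  moreover have "(\<integral>x. c * (\<phi> x * cnj (\<phi> x)) \<partial>I01) = c * ip I01 \<phi> \<phi>" by (simp add: ip_def)
  hence "(\<integral>x. c * (\<phi> x * cnj (\<phi> x)) \<partial>I01) = 1" using t(2) by (simp add: ip_self c_def flip: of_real_mult)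
  ultimately show ?thesis by blast
qed

text \<open>Subtracting multiples of \<open>\<eta>\<close> and \<open>\<eta>'\<close> kills the two moments that obstruct a test function
  from being the second derivative of a test function.\<close>

lemma moment_correction:
  assumes \<eta>: "test_function {0..1::real} \<eta>" "(\<integral>x. \<eta> x \<partial>I01) = 1" and \<theta>: "test_function {0..1} \<theta>"
  obtains \<phi> where "test_function {0..1} \<phi>"
    "D (D \<phi>) = (\<lambda>x. \<theta> x - (\<integral>x. \<theta> x \<partial>I01) * \<eta> x
       - (\<integral>x. of_real (1 - x) * (\<theta> x - (\<integral>x. \<theta> x \<partial>I01) * \<eta> x) \<partial>I01) * D \<eta> x)"
proof -
  have int: "integrable I01 f" if "test_function {0..1} f" for f :: "real \<Rightarrow> complex"
    by (intro continuous_integrable_leb smooth_continuous test_functionD(1)[OF that])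
  define c0 where "c0 = (\<integral>x. \<theta> x \<partial>I01)"
  define \<psi> where "\<psi> = (\<lambda>x. \<theta> x - c0 * \<eta> x)"
  have t\<psi>: "test_function {0..1} \<psi>" unfolding \<psi>_def by (intro test_function_diff test_function_cmult \<eta> \<theta>)
  have "(\<integral>x. \<psi> x \<partial>I01) = 0" unfolding \<psi>_def using int[OF \<eta>(1)] int[OF \<theta>] \<eta>(2) by (simp add: c0_def)
  then obtain \<xi> where \<xi>: "test_function {0..1} \<xi>" "D \<xi> = \<psi>" using test_function_primitive[OF t\<psi>] by blast
  define c1 where "c1 = (\<integral>x. \<xi> x \<partial>I01)"
  have c1: "c1 = (\<integral>x. of_real (1 - x) * \<psi> x \<partial>I01)"
    unfolding c1_def integral_test_primitive[OF \<xi>(1)] \<xi>(2) ..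
  define \<zeta> where "\<zeta> = (\<lambda>x. \<xi> x + - c1 * \<eta> x)"
  have t\<zeta>: "test_function {0..1} \<zeta>" unfolding \<zeta>_def by (intro test_function_add test_function_cmult \<eta> \<xi>)
  have "(\<integral>x. \<zeta> x \<partial>I01) = 0" unfolding \<zeta>_def using int[OF \<eta>(1)] int[OF \<xi>(1)] \<eta>(2) by (simp add: c1_def)
  then obtain \<phi> where \<phi>: "test_function {0..1} \<phi>" "D \<phi> = \<zeta>" using test_function_primitive[OF t\<zeta>] by blast
  note s = test_functionD(1)[OF \<xi>(1)] test_functionD(1)[OF \<eta>(1)]
  have "D \<zeta> = (\<lambda>x. \<psi> x - c1 * D \<eta> x)"
    unfolding \<zeta>_def using D_add[OF s(1) smooth_mult[OF smooth_const s(2)], of "- c1"] D_cmult[OF s(2), of "- c1"] \<xi>(2) by simp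
  thus ?thesis using that[OF \<phi>(1)] \<phi>(2) c1 by (simp add: \<psi>_def c0_def)
qed

text \<open>An arbitrary test function becomes a second derivative once its two moments are
  corrected. The correction depends on it only through these moments, so r acts on test functions
  like an affine function.\<close>

lemma du_Bois_Reymond:
  assumes r: "sq_int I01 r" and orth: "\<And>\<phi>. test_function {0..1} \<phi> \<Longrightarrow> (\<integral>x. r x * D (D \<phi>) x \<partial>I01) = 0"
  shows "\<exists>A B. AE x in I01. r x = A + B * of_real x"
proof -
  obtain \<eta> where \<eta>: "test_function {0..1::real} \<eta>" "(\<integral>x. \<eta> x \<partial>I01) = 1" using exists_test_function_unit by blast
  define Q where "Q = (\<integral>x. r x * D \<eta> x \<partial>I01)"
  \<comment> \<open>P and Q are the coefficients of the mean of \<theta> and of its moment with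
    weight 1 - x when the orthogonality of r to the corrected \<theta> is solved for the pairing of
    r with \<theta>.\<close>
  define P where "P = (\<integral>x. r x * \<eta> x \<partial>I01) - Q * (\<integral>x. of_real (1 - x) * \<eta> x \<partial>I01)"
  have lin: "sq_int I01 (\<lambda>x. of_real (1 - x))" by (intro continuous_sq_int continuous_intros)
  have lin2: "sq_int I01 (\<lambda>x. P + Q * of_real (1 - x))" by (intro continuous_sq_int continuous_intros)
  have "AE x in leb (cbox 0 1). r x - (P + Q * of_real (1 - x)) = 0"
  proof (rule fundamental_lemma)
    show "integrable (leb (cbox 0 1)) (\<lambda>x. r x - (P + Q * of_real (1 - x)))"
      by (rule sq_int_integrable[OF _ finite_measure_leb]) (use sq_int_diff[OF r lin2] in simp)
    fix \<theta> :: "real \<Rightarrow> complex" assume "test_function (cbox 0 1) \<theta>"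
    hence \<theta>: "test_function {0..1} \<theta>" by simp
    define c0 where "c0 = (\<integral>x. \<theta> x \<partial>I01)"
    note sq = test_function_sq_int[OF \<theta>] test_function_sq_int[OF \<eta>(1)] test_function_sq_int[OF test_functionD_real[OF \<eta>(1)]]
    define c1 where "c1 = (\<integral>x. of_real (1 - x) * (\<theta> x - c0 * \<eta> x) \<partial>I01)"
    have i1: "integrable I01 (\<lambda>x. of_real (1 - x) * \<theta> x)" "integrable I01 (\<lambda>x. of_real (1 - x) * \<eta> x)"
      "integrable I01 (\<lambda>x. r x * \<theta> x)" "integrable I01 (\<lambda>x. r x * \<eta> x)" "integrable I01 (\<lambda>x. r x * D \<eta> x)"
      by (intro integrable_mult_sq r lin sq; simp)+
    have i2: "integrable I01 \<theta>" by (intro continuous_integrable_leb smooth_continuous test_functionD(1)[OF \<theta>])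
    have c1: "c1 = (\<integral>x. of_real (1 - x) * \<theta> x \<partial>I01) - c0 * (\<integral>x. of_real (1 - x) * \<eta> x \<partial>I01)"
    proof -
      have "c1 = (\<integral>x. of_real (1 - x) * \<theta> x - c0 * (of_real (1 - x) * \<eta> x) \<partial>I01)"
        unfolding c1_def by (simp add: algebra_simps)
      thus ?thesis using i1 by simp
    qed
    obtain \<phi> where \<phi>: "test_function {0..1} \<phi>" "D (D \<phi>) = (\<lambda>x. \<theta> x - c0 * \<eta> x - c1 * D \<eta> x)"
      using moment_correction[OF \<eta> \<theta>] unfolding c0_def c1_def by blast
    have "0 = (\<integral>x. r x * \<theta> x - c0 * (r x * \<eta> x) - c1 * (r x * D \<eta> x) \<partial>I01)"
      using orth[OF \<phi>(1)] unfolding \<phi>(2) by (simp add: algebra_simps)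
    also have "\<dots> = (\<integral>x. r x * \<theta> x \<partial>I01) - c0 * (\<integral>x. r x * \<eta> x \<partial>I01) - c1 * Q"
      using i1 by (simp add: Q_def)
    finally have e: "(\<integral>x. r x * \<theta> x \<partial>I01) = c0 * (\<integral>x. r x * \<eta> x \<partial>I01) + c1 * Q" by (simp add: algebra_simps)
    have "(\<integral>x. (r x - (P + Q * of_real (1 - x))) * \<theta> x \<partial>I01) =
       (\<integral>x. r x * \<theta> x - (P * \<theta> x + Q * (of_real (1 - x) * \<theta> x)) \<partial>I01)" by (simp add: algebra_simps)
    also have "\<dots> = (\<integral>x. r x * \<theta> x \<partial>I01) - (P * c0 + Q * (\<integral>x. of_real (1 - x) * \<theta> x \<partial>I01))"
      using i1 i2 by (simp add: c0_def)
    also have "\<dots> = 0" unfolding e c1 P_def by (simp add: algebra_simps)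
    finally show "(\<integral>x. (r x - (P + Q * of_real (1 - x))) * \<theta> x \<partial>leb (cbox 0 1)) = 0" by simp
  qed
  hence "AE x in I01. r x = (P + Q) + (- Q) * of_real x"
    by (simp only: cbox_interval) (auto simp: algebra_simps elim!: eventually_mono)
  thus ?thesis by blast
qed

text \<open>The primitive starting at 0. Written as a pairing with an indicator it is available for
  every L2 function, and Cauchy-Schwarz bounds it uniformly in x.\<close>

definition J :: "(real \<Rightarrow> complex) \<Rightarrow> real \<Rightarrow> complex" where
  "J f x = ip I01 f (indicator {0..x})"

lemma sq_int_indicator: "sq_int I01 (indicator {0..x})" "nsq I01 (indicator {0..x}) \<le> 1"
proof -
  have eq: "(cmod (indicator {0..x} z))\<^sup>2 = indicator {0..x} z" for z by (simp add: indicator_def)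
  have *: "sq_int I01 (\<lambda>_. 1)" by (intro continuous_sq_int continuous_intros)
  have i1: "integrable I01 (\<lambda>_. 1::real)" by (intro continuous_integrable_leb continuous_intros)
  have i: "integrable I01 (indicator {0..x} :: real \<Rightarrow> real)"
    by (rule Bochner_Integration.integrable_bound[OF i1]) (auto simp: indicator_def intro!: measurable_restrict_space1)
  show "sq_int I01 (indicator {0..x})" unfolding sq_int_def eq
    using i by (auto intro!: measurable_restrict_space1)
  have "nsq I01 (indicator {0..x}) \<le> (\<integral>x. 1 \<partial>I01)"
    unfolding nsq_def eq by (rule integral_mono[OF i i1]) (auto simp: indicator_def)
  thus "nsq I01 (indicator {0..x}) \<le> 1" by (simp add: measure_restrict_space space_restrict_space)
qed

lemma J_cong_AE:
  assumes "sq_int I01 f" "sq_int I01 g" "AE x in I01. f x = g x" shows "J f = J g"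
proof
  fix x
  note [measurable] = sq_int_measurable[OF assms(1)] sq_int_measurable[OF assms(2)]
    sq_int_measurable[OF sq_int_cnj[OF sq_int_indicator(1)]]
  show "J f x = J g x" unfolding J_def ip_def
    by (rule integral_cong_AE) (use assms(3) in auto)
qed

lemma J_diff_bound:
  assumes "sq_int I01 f" "sq_int I01 g" shows "(cmod (J f x - J g x))\<^sup>2 \<le> nsq I01 (\<lambda>x. f x - g x)"
proof -
  have "(cmod (J f x - J g x))\<^sup>2 \<le> nsq I01 (\<lambda>x. f x - g x) * nsq I01 (indicator {0..x})"
    using ip_CS[OF sq_int_diff[OF assms] sq_int_indicator(1), of x]
    by (simp add: J_def ip_diff_left assms sq_int_indicator)
  also have "\<dots> \<le> nsq I01 (\<lambda>x. f x - g x) * 1" by (intro mult_left_mono sq_int_indicator) simp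
  finally show ?thesis by simp
qed

lemma J_eq_integral:
  assumes "continuous_on {0..1} f" "0 \<le> x" "x \<le> 1" shows "J f x = integral {0..x} f"
proof -
  have eq: "indicator {0..1} z *\<^sub>R (f z * cnj (indicator {0..x} z)) = indicator {0..x} z *\<^sub>R f z" for z
    using assms by (auto simp: indicator_def)
  have c: "continuous_on {0..x} f" using assms by (auto intro: continuous_on_subset)
  have "J f x = (LINT z:{0..x}|lborel. f z)"
    unfolding J_def ip_def set_lebesgue_integral_def by (subst integral_restrict_space) (simp_all only: eq, simp)
  also have "\<dots> = integral {0..x} f"
    by (rule set_borel_integral_eq_integral(2)) (unfold set_integrable_def, rule borel_integrable_compact[OF _ c], simp)
  finally show ?thesis .
qed

lemma J_has_vector_derivative:
  assumes "continuous_on {0..1} f" "0 \<le> x" "x \<le> 1"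
  shows "(J f has_vector_derivative f x) (at x within {0..1})"
proof -
  have "((\<lambda>x. integral {0..x} f) has_vector_derivative f x) (at x within {0..1})"
    by (rule integral_has_vector_derivative[OF assms(1)]) (use assms in auto)
  thus ?thesis
    by (rule has_vector_derivative_transform[rotated 2]) (use assms J_eq_integral in auto)
qed

lemma J_smooth:
  assumes "smooth f" "f 0 = 0" "0 \<le> x" "x \<le> 1" shows "J (D f) x = f x"
proof -
  have "J (D f) x = integral {0..x} (D f)"
    by (rule J_eq_integral[OF smooth_continuous[OF smooth_D[OF assms(1)]] assms(3,4)])
  also have "\<dots> = f x - f 0"
    by (rule integral_unique, rule fundamental_theorem_of_calculus[OF assms(3)])
       (rule smooth_has_vector_derivative[OF assms(1)])
  finally show ?thesis using assms(2) by simp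
qed

lemma J_test: "test_function {0..1} \<phi> \<Longrightarrow> 0 \<le> x \<Longrightarrow> x \<le> 1 \<Longrightarrow> J (D \<phi>) x = \<phi> x"
  by (rule J_smooth[OF test_functionD(1) test_function_ends(1)])

text \<open>A test function on [0, 1] is the primitive of its derivative, and L2 convergence of the
  derivatives gives uniform convergence of the primitives; so continuity and the zero boundary
  values survive in the limit.\<close>

lemma J_lim:
  assumes t: "\<And>n. test_function {0..1} (F n)" and u: "L2_lim I01 F u" and v: "L2_lim I01 (\<lambda>n. D (F n)) v"
  shows "continuous_on {0..1} (J v)" "J v 0 = 0" "J v 1 = 0" "AE x in I01. u x = J v x"
proof -
  define e where "e = (\<lambda>n. nsq I01 (\<lambda>x. D (F n) x - v x))"
  have e: "e \<longlonglongrightarrow> 0" using L2_limD(3)[OF v] by (simp add: e_def)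
  have b: "(cmod (F n x - J v x))\<^sup>2 \<le> e n" if "0 \<le> x" "x \<le> 1" for n x
    using J_diff_bound[OF L2_limD(1,2)[OF v], of n x] J_test[OF t that] by (simp add: e_def)
  have ul: "uniform_limit {0..1} F (J v) sequentially"
  proof (rule uniform_limitI)
    fix \<epsilon> :: real assume \<epsilon>: "0 < \<epsilon>"
    have "eventually (\<lambda>n. e n < \<epsilon>\<^sup>2) sequentially" by (rule order_tendstoD(2)[OF e]) (use \<epsilon> in simp)
    thus "eventually (\<lambda>n. \<forall>x\<in>{0..1}. dist (F n x) (J v x) < \<epsilon>) sequentially"
    proof eventually_elim
      case (elim n)
      show ?case
      proof
        fix x :: real assume x: "x \<in> {0..1}"
        have "(cmod (F n x - J v x))\<^sup>2 < \<epsilon>\<^sup>2" using b[of x n] x elim by auto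
        thus "dist (F n x) (J v x) < \<epsilon>" using \<epsilon> by (simp add: dist_norm power2_less_imp_less)
      qed
    qed
  qed
  show c: "continuous_on {0..1} (J v)"
    by (rule uniform_limit_theorem[OF always_eventually ul]) (auto intro!: smooth_continuous test_functionD(1)[OF t])
  have pt: "(\<lambda>n. F n x) \<longlonglongrightarrow> J v x" if "x \<in> {0..1}" for x
    by (rule tendsto_uniform_limitI[OF ul that])
  show "J v 0 = 0" "J v 1 = 0"
    using pt[of 0] pt[of 1] test_function_ends[OF t] by (simp_all add: LIMSEQ_const_iff)
  have sJ: "sq_int I01 (J v)" by (rule continuous_sq_int[OF c])
  have "(\<lambda>n. nsq I01 (\<lambda>x. F n x - J v x)) \<longlonglongrightarrow> 0"
  proof (rule tendsto_0_squeeze[OF _ _ e])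
    fix n
    show "nsq I01 (\<lambda>x. F n x - J v x) \<le> e n"
      by (rule nsq_le_const[OF sq_int_diff[OF L2_limD(1)[OF u] sJ] b])
  qed simp
  hence L: "L2_lim I01 F (J v)" using L2_limD(1)[OF u] sJ by (simp add: L2_lim_def)
  have "L2_lim I01 (\<lambda>n x. F n x - F n x) (\<lambda>x. u x - J v x)" by (rule L2_lim_diff[OF u L])
  from nsq_lim[OF this] have "nsq I01 (\<lambda>x. u x - J v x) = 0" by (simp add: LIMSEQ_const_iff)
  moreover have "integrable I01 (\<lambda>x. (cmod (u x - J v x))\<^sup>2)"
    using sq_int_diff[OF L2_limD(2)[OF u] sJ] by (simp add: sq_int_def)
  ultimately have "AE x in I01. (cmod (u x - J v x))\<^sup>2 = 0"
    unfolding nsq_def by (subst (asm) integral_nonneg_eq_0_iff_AE) auto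
  thus "AE x in I01. u x = J v x" by eventually_elim auto
qed

text \<open>\<open>J_lim\<close> applied to u with v, and to v with w, turns membership in the form
  domain into the clamped boundary conditions for continuous representatives.\<close>

lemma H2_J:
  assumes "H2 1 u v w"
  shows "continuous_on {0..1} (J w)" "J w 1 = 0" "J w 0 = 0" "AE x in I01. v x = J w x"
    "AE x in I01. u x = J (J w) x" "J (J w) 1 = 0" "J (J w) 0 = 0"
proof -
  obtain \<phi> where t: "\<forall>n. test_function {0..1} (\<phi> n)" and L: "L2_lim I01 \<phi> u"
    "L2_lim I01 (\<lambda>n. D (\<phi> n)) v" "L2_lim I01 (\<lambda>n. D (D (\<phi> n))) w" using H2E[OF assms] .
  note t = t[rule_format]
  note 1 = J_lim[OF t L(1,2)] and 2 = J_lim[OF test_functionD_real[OF t] L(2,3)]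
  show "continuous_on {0..1} (J w)" "J w 1 = 0" "J w 0 = 0" "AE x in I01. v x = J w x" by (rule 2)+
  have "J v = J (J w)"
    by (rule J_cong_AE[OF H2_sq_int(2)[OF assms] continuous_sq_int[OF 2(1)] 2(4)])
  thus "AE x in I01. u x = J (J w) x" "J (J w) 1 = 0" "J (J w) 0 = 0" using 1 by auto
qed

lemma parts_C1:
  assumes t: "test_function {0..1} \<psi>" and c: "continuous_on {0..1} f"
    and d: "\<And>x. 0 \<le> x \<Longrightarrow> x \<le> 1 \<Longrightarrow> (F has_vector_derivative f x) (at x within {0..1})"
  shows "(\<integral>x. F x * D \<psi> x \<partial>I01) = - (\<integral>x. f x * \<psi> x \<partial>I01)"
proof -
  note s = test_functionD(1)[OF t]
  note cs = smooth_continuous[OF s, of "{0..1}"] smooth_continuous[OF smooth_D[OF s], of "{0..1}"]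
  have cF: "continuous_on {0..1} F"
    using d by (intro continuous_on_vector_derivative) auto
  have "(\<integral>x. F x * D \<psi> x + f x * \<psi> x \<partial>I01) = F 1 * \<psi> 1 - F 0 * \<psi> 0"
    by (rule leb_FTC[where F="\<lambda>x. F x * \<psi> x"])
       (use has_vector_derivative_mult[OF d smooth_has_vector_derivative[OF s]] in
         \<open>auto intro!: continuous_intros c cF cs\<close>)
  moreover have "integrable I01 (\<lambda>x. F x * D \<psi> x)" "integrable I01 (\<lambda>x. f x * \<psi> x)"
    by (intro continuous_integrable_leb continuous_intros c cF smooth_continuous s smooth_D)+
  ultimately show ?thesis using test_function_ends[OF t] by (simp add: add_eq_0_iff)
qed

text \<open>With all derivatives moved onto \<phi>, the Euler-Lagrange identity says that w minus a
  combination of y and its second primitive Y is orthogonal to every \<phi>'', hence affine. So w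
  has a representative built from y and Y, and this gains the two missing derivatives.\<close>

lemma ground_state_classical:
  assumes \<alpha>: "\<alpha> \<ge> 0" and g: "ground_state \<alpha> u v w"
  obtains z0 z1 z2 z3 where
    "\<And>x. 0 \<le> x \<Longrightarrow> x \<le> 1 \<Longrightarrow> (z0 has_vector_derivative z1 x) (at x within {0..1})"
    "\<And>x. 0 \<le> x \<Longrightarrow> x \<le> 1 \<Longrightarrow> (z1 has_vector_derivative z2 x) (at x within {0..1})"
    "\<And>x. 0 \<le> x \<Longrightarrow> x \<le> 1 \<Longrightarrow> (z2 has_vector_derivative z3 x) (at x within {0..1})"
    "\<And>x. 0 \<le> x \<Longrightarrow> x \<le> 1 \<Longrightarrow> (z3 has_vector_derivative 2 * of_real \<alpha> * z2 x + of_real (mu \<alpha>) * z0 x) (at x within {0..1})"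
    "z0 0 = 0" "z1 0 = 0" "z0 1 = 0" "z1 1 = 0"
    "AE x in I01. u x = z0 x" "AE x in I01. v x = z1 x" "AE x in I01. w x = z2 x"
proof -
  have H: "H2 1 u v w" using g by (simp add: ground_state_def)
  note S = H2_sq_int[OF H] and JJ = H2_J[OF H]
  define y where "y = J (J w)"
  define Y where "Y = J (J y)"
  have cont: "continuous_on {0..1} (J f)" if "continuous_on {0..1} f" for f
    using J_has_vector_derivative[OF that] by (intro continuous_on_vector_derivative) auto
  have cy: "continuous_on {0..1} y" unfolding y_def by (intro cont JJ)
  have cJy: "continuous_on {0..1} (J y)" by (intro cont cy)
  have cY: "continuous_on {0..1} Y" unfolding Y_def by (intro cont cy)
  let ?a = "2 * complex_of_real \<alpha>" let ?m = "complex_of_real (mu \<alpha>)"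
  have "\<exists>A B. AE x in I01. w x - (?a * y x + ?m * Y x) = A + B * of_real x"
  proof (rule du_Bois_Reymond)
    have sr: "sq_int I01 (\<lambda>x. ?a * y x + ?m * Y x)" by (intro continuous_sq_int continuous_intros cy cY)
    show "sq_int I01 (\<lambda>x. w x - (?a * y x + ?m * Y x))" by (intro sq_int_diff S sr)
    fix \<phi> :: "real \<Rightarrow> complex" assume t: "test_function {0..1} \<phi>"
    note t1 = test_functionD_real[OF t] note t2 = test_functionD_real[OF t1]
    note sm = test_functionD(1)[OF t] test_functionD(1)[OF t1]
    \<comment> \<open>The identity is conjugate linear in the test function, so it is applied to the
      conjugate of \<phi>.\<close>
    have tc: "test_function {0..1} (\<lambda>x. cnj (\<phi> x))"
    proof -
      obtain K where K: "compact K" "K \<subseteq> interior {0..1}" "\<And>x. x \<notin> K \<Longrightarrow> \<phi> x = 0"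
        using test_function_support[OF t] by blast
      show ?thesis by (rule test_functionI[OF smooth_cnj[OF sm(1)] K(1,2)]) (simp add: K(3))
    qed
    have Dc: "D (\<lambda>x. cnj (\<phi> x)) = (\<lambda>x. cnj (D \<phi> x))" "D (\<lambda>x. cnj (D \<phi> x)) = (\<lambda>x. cnj (D (D \<phi>) x))"
      by (auto simp: fun_eq_iff pderiv_at_cnj smooth_differentiable sm)
    have EL: "(\<integral>x. w x * D (D \<phi>) x \<partial>I01) + ?a * (\<integral>x. v x * D \<phi> x \<partial>I01) = ?m * (\<integral>x. u x * \<phi> x \<partial>I01)"
      using ground_state_euler_lagrange[OF \<alpha> g H2_test_function[OF tc]] by (simp add: Dc ip_def)
    have 1: "(\<integral>x. v x * D \<phi> x \<partial>I01) = - (\<integral>x. u x * D (D \<phi>) x \<partial>I01)"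
      using H2_imp_W22_0(4)[OF H] t1 by (simp add: has_weak_pderiv_iff)
    have uy: "(\<integral>x. u x * f x \<partial>I01) = (\<integral>x. y x * f x \<partial>I01)" if "sq_int I01 f" for f
    proof (rule integral_cong_AE)
      note [measurable] = sq_int_measurable[OF S(1)] sq_int_measurable[OF that] sq_int_measurable[OF continuous_sq_int[OF cy]]
      show "(\<lambda>x. u x * f x) \<in> borel_measurable I01" "(\<lambda>x. y x * f x) \<in> borel_measurable I01" by measurable
      show "AE x in I01. u x * f x = y x * f x" using JJ(5) by (auto simp: y_def)
    qed
    have 2: "(\<integral>x. y x * \<phi> x \<partial>I01) = (\<integral>x. Y x * D (D \<phi>) x \<partial>I01)"
      using parts_C1[OF t cy J_has_vector_derivative[OF cy]]
        parts_C1[OF t1 cJy J_has_vector_derivative[OF cJy]] by (simp add: Y_def)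
    note sq2 = test_function_sq_int[OF t2, of "{0..1}"]
    have i: "integrable I01 (\<lambda>x. w x * D (D \<phi>) x)" "integrable I01 (\<lambda>x. y x * D (D \<phi>) x)"
       "integrable I01 (\<lambda>x. Y x * D (D \<phi>) x)"
      by (intro integrable_mult_sq S sq2 continuous_sq_int[OF cy] continuous_sq_int[OF cY]; simp)+
    have "(\<integral>x. (w x - (?a * y x + ?m * Y x)) * D (D \<phi>) x \<partial>I01) =
       (\<integral>x. w x * D (D \<phi>) x - (?a * (y x * D (D \<phi>) x) + ?m * (Y x * D (D \<phi>) x)) \<partial>I01)"
      by (simp add: algebra_simps)
    also have "\<dots> = (\<integral>x. w x * D (D \<phi>) x \<partial>I01) - (?a * (\<integral>x. y x * D (D \<phi>) x \<partial>I01) + ?m * (\<integral>x. Y x * D (D \<phi>) x \<partial>I01))"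
      using i by simp
    also have "\<dots> = 0"
      using EL unfolding 1 uy[OF sq2[simplified]] uy[OF test_function_sq_int[OF t, of "{0..1}", simplified]] 2
      by (simp add: algebra_simps)
    finally show "(\<integral>x. (w x - (?a * y x + ?m * Y x)) * D (D \<phi>) x \<partial>I01) = 0" .
  qed
  then obtain A B where AB: "AE x in I01. w x - (?a * y x + ?m * Y x) = A + B * of_real x" by blast
  \<comment> \<open>The continuous representative of w; all its terms are differentiable, which
    starts the bootstrap.\<close>
  define W where "W = (\<lambda>x. ?a * y x + ?m * Y x + A + B * of_real x)"
  have cW: "continuous_on {0..1} W" unfolding W_def by (intro continuous_intros cy cY)
  have wW: "AE x in I01. w x = W x" using AB by eventually_elim (simp add: W_def algebra_simps)
  have Jw: "J w = J W" by (rule J_cong_AE[OF S(3) continuous_sq_int[OF cW] wW])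
  have cJW: "continuous_on {0..1} (J W)" by (rule cont[OF cW])
  have yW: "y = J (J W)" by (simp add: y_def Jw)
  show ?thesis
  proof (rule that[of y "J W" W "\<lambda>x. ?a * J W x + ?m * J y x + B"])
    fix x :: real assume x: "0 \<le> x" "x \<le> 1"
    show dy: "(y has_vector_derivative J W x) (at x within {0..1})"
      unfolding yW by (rule J_has_vector_derivative[OF cJW x])
    show dJ: "(J W has_vector_derivative W x) (at x within {0..1})"
      by (rule J_has_vector_derivative[OF cW x])
    have dY: "(Y has_vector_derivative J y x) (at x within {0..1})"
      unfolding Y_def by (rule J_has_vector_derivative[OF cJy x])
    have dJy: "(J y has_vector_derivative y x) (at x within {0..1})"
      by (rule J_has_vector_derivative[OF cy x])
    have dl: "((\<lambda>x. B * of_real x) has_vector_derivative B) (at x within {0..1})"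
      using has_vector_derivative_mult_right[OF has_vector_derivative_of_real[of "\<lambda>x. x" 1 "at x within {0..1}"], of B]
      by simp
    have "((\<lambda>x. ?a * y x + ?m * Y x + A + B * of_real x) has_vector_derivative ?a * J W x + ?m * J y x + B) (at x within {0..1})"
      by (rule has_vector_derivative_eq_rhs,
          rule has_vector_derivative_add[OF has_vector_derivative_add[OF has_vector_derivative_add[OF
             has_vector_derivative_mult_right[OF dy] has_vector_derivative_mult_right[OF dY]] has_vector_derivative_const] dl]) simp
    thus "(W has_vector_derivative ?a * J W x + ?m * J y x + B) (at x within {0..1})"
      by (simp only: W_def[symmetric])
    show "((\<lambda>x. ?a * J W x + ?m * J y x + B) has_vector_derivative ?a * W x + ?m * y x) (at x within {0..1})"
      by (rule has_vector_derivative_eq_rhs,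
          rule has_vector_derivative_add[OF has_vector_derivative_add[OF
             has_vector_derivative_mult_right[OF dJ] has_vector_derivative_mult_right[OF dJy]] has_vector_derivative_const]) simp
  qed (use JJ wW in \<open>auto simp: y_def Jw\<close>)
qed

section \<open>Simplicity of the lowest eigenvalue\<close>

text \<open>\<open>osc \<kappa> \<omega> j\<close> is the \<open>j\<close>-th derivative of the solution of
  \<open>y'''' = (\<kappa>\<^sup>2 - \<omega>\<^sup>2) y'' + \<kappa>\<^sup>2 \<omega>\<^sup>2 y\<close> with \<open>y = y' = y'' = 0\<close>, \<open>y''' = 1\<close> at \<open>0\<close>.\<close>

fun osc :: "real \<Rightarrow> real \<Rightarrow> nat \<Rightarrow> real \<Rightarrow> real" where
  "osc k w 0 t = (sinh (k * t) / k - sin (w * t) / w) / (k\<^sup>2 + w\<^sup>2)"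
| "osc k w (Suc 0) t = (cosh (k * t) - cos (w * t)) / (k\<^sup>2 + w\<^sup>2)"
| "osc k w (Suc (Suc 0)) t = (k * sinh (k * t) + w * sin (w * t)) / (k\<^sup>2 + w\<^sup>2)"
| "osc k w (Suc (Suc (Suc 0))) t = (k\<^sup>2 * cosh (k * t) + w\<^sup>2 * cos (w * t)) / (k\<^sup>2 + w\<^sup>2)"
| "osc k w (Suc (Suc (Suc (Suc j)))) t = (k\<^sup>2 - w\<^sup>2) * osc k w (Suc (Suc j)) t + k\<^sup>2 * w\<^sup>2 * osc k w j t"

lemma osc_numeral: "osc k w 1 = osc k w (Suc 0)" "osc k w 2 = osc k w (Suc (Suc 0))" "osc k w 3 = osc k w (Suc (Suc (Suc 0)))"
   "osc k w 4 = (\<lambda>t. (k\<^sup>2 - w\<^sup>2) * osc k w (Suc (Suc 0)) t + k\<^sup>2 * w\<^sup>2 * osc k w 0 t)"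
  by (auto simp: numeral_eq_Suc)

lemma osc_fun:
  "osc k w 0 = (\<lambda>t. (sinh (k * t) / k - sin (w * t) / w) / (k\<^sup>2 + w\<^sup>2))"
  "osc k w (Suc 0) = (\<lambda>t. (cosh (k * t) - cos (w * t)) / (k\<^sup>2 + w\<^sup>2))"
  "osc k w (Suc (Suc 0)) = (\<lambda>t. (k * sinh (k * t) + w * sin (w * t)) / (k\<^sup>2 + w\<^sup>2))"
  "osc k w (Suc (Suc (Suc 0))) = (\<lambda>t. (k\<^sup>2 * cosh (k * t) + w\<^sup>2 * cos (w * t)) / (k\<^sup>2 + w\<^sup>2))"
  by (auto simp: fun_eq_iff)

lemma osc_deriv:
  assumes "k > 0" "w > 0" "j < 4"
  shows "(osc k w j has_real_derivative osc k w (Suc j) t) (at t)"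
proof -
  have p: "k\<^sup>2 + w\<^sup>2 > 0" using assms by (simp add: add_pos_pos)
  have ne: "k \<noteq> 0" "w \<noteq> 0" "k\<^sup>2 + w\<^sup>2 \<noteq> 0" using assms p by auto
  consider "j = 0" | "j = Suc 0" | "j = Suc (Suc 0)" | "j = Suc (Suc (Suc 0))" using assms(3) by linarith
  thus ?thesis
  proof cases
    case 1
    have "((\<lambda>t. sinh (k * t) / k - sin (w * t) / w) has_real_derivative cosh (k * t) - cos (w * t)) (at t)"
      using ne(1,2) by (auto intro!: derivative_eq_intros)
    from DERIV_cdivide[OF this, of "k\<^sup>2 + w\<^sup>2"] show ?thesis using 1 by (simp add: osc_fun)
  next
    case 2
    have "((\<lambda>t. cosh (k * t) - cos (w * t)) has_real_derivative k * sinh (k * t) + w * sin (w * t)) (at t)"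
      by (auto intro!: derivative_eq_intros)
    from DERIV_cdivide[OF this, of "k\<^sup>2 + w\<^sup>2"] show ?thesis using 2 by (simp add: osc_fun)
  next
    case 3
    have "((\<lambda>t. k * sinh (k * t) + w * sin (w * t)) has_real_derivative k\<^sup>2 * cosh (k * t) + w\<^sup>2 * cos (w * t)) (at t)"
      by (auto intro!: derivative_eq_intros simp: power2_eq_square)
    from DERIV_cdivide[OF this, of "k\<^sup>2 + w\<^sup>2"] show ?thesis using 3 by (simp add: osc_fun)
  next
    case 4
    have e: "osc k w (Suc (Suc (Suc (Suc 0)))) t =
       (k\<^sup>2 * (k * sinh (k * t)) - w\<^sup>2 * (w * sin (w * t))) / (k\<^sup>2 + w\<^sup>2)"
    proof -
      have "(k\<^sup>2 - w\<^sup>2) * (k * S + w * s) + k\<^sup>2 * w\<^sup>2 * (S / k - s / w) = k\<^sup>2 * (k * S) - w\<^sup>2 * (w * s)" for S s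
        using ne(1,2) by (simp add: field_simps power2_eq_square)
      moreover have "a * (X / q) + b * (Y / q) = (a * X + b * Y) / q" for a b X Y q :: real
        by (simp add: add_divide_distrib)
      ultimately show ?thesis by (simp only: osc.simps)
    qed
    have "((\<lambda>t. k\<^sup>2 * cosh (k * t) + w\<^sup>2 * cos (w * t)) has_real_derivative
        k\<^sup>2 * (k * sinh (k * t)) - w\<^sup>2 * (w * sin (w * t))) (at t)"
      by (auto intro!: derivative_eq_intros)
    from DERIV_cdivide[OF this, of "k\<^sup>2 + w\<^sup>2"] show ?thesis unfolding 4 e by (simp add: osc_fun(4))
  qed
qed

lemma osc_zero: "k > 0 \<Longrightarrow> w > 0 \<Longrightarrow> osc k w 0 0 = 0" "k > 0 \<Longrightarrow> w > 0 \<Longrightarrow> osc k w 1 0 = 0"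
  "k > 0 \<Longrightarrow> w > 0 \<Longrightarrow> osc k w 2 0 = 0" "k > 0 \<Longrightarrow> w > 0 \<Longrightarrow> osc k w 3 0 = 1"
  by (auto simp: osc_numeral add_pos_pos add_nonneg_eq_0_iff)

lemma cosh_gt_1: assumes "(x::real) > 0" shows "1 < cosh x"
proof -
  have "sinh x > 0" using assms by simp
  hence "(cosh x)\<^sup>2 \<noteq> 1" by (simp add: cosh_square_eq)
  hence "cosh x \<noteq> 1" by auto
  thus ?thesis using cosh_real_ge_1[of x] by linarith
qed

lemma sinh_gt_self: assumes "(x::real) > 0" shows "x < sinh x"
proof -
  have "sinh 0 - 0 < sinh x - x"
    by (rule DERIV_pos_imp_increasing_open[OF assms])
       (auto intro!: exI derivative_eq_intros continuous_intros cosh_gt_1)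
  thus ?thesis by simp
qed

text \<open>sinh k / k exceeds 1, and sin w / w does not. This nonvanishing is what leaves a
  one-dimensional space of solutions with u(0) = u'(0) = u(1) = 0.\<close>

lemma osc_one_pos: assumes "k > 0" "w > 0" shows "osc k w 0 1 > 0"
proof -
  have "sinh k / k > 1" using sinh_gt_self[OF assms(1)] assms by simp
  moreover have "sin w / w \<le> 1" using sin_x_le_x[of w] assms by simp
  ultimately have "sinh k / k - sin w / w > 0" by linarith
  moreover have "k\<^sup>2 + w\<^sup>2 > 0" using assms by (simp add: add_pos_pos)
  ultimately show ?thesis unfolding osc.simps mult_1_right by (rule divide_pos_pos)
qed

text \<open>Lagrange identity: the solution is paired with the fundamental solution run backwards
  from x. The pairing \<open>G\<close> is constant in t; at t = x only \<open>z0 x\<close> remains,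
  at t = 0 only the terms with the two free initial values.\<close>

lemma ode_representation:
  fixes z0 z1 z2 z3 :: "real \<Rightarrow> complex"
  assumes kw: "k > 0" "w > 0"
    and d0: "\<And>x. 0 \<le> x \<Longrightarrow> x \<le> 1 \<Longrightarrow> (z0 has_vector_derivative z1 x) (at x within {0..1})"
    and d1: "\<And>x. 0 \<le> x \<Longrightarrow> x \<le> 1 \<Longrightarrow> (z1 has_vector_derivative z2 x) (at x within {0..1})"
    and d2: "\<And>x. 0 \<le> x \<Longrightarrow> x \<le> 1 \<Longrightarrow> (z2 has_vector_derivative z3 x) (at x within {0..1})"
    and d3: "\<And>x. 0 \<le> x \<Longrightarrow> x \<le> 1 \<Longrightarrow> (z3 has_vector_derivative
        of_real (k\<^sup>2 - w\<^sup>2) * z2 x + of_real (k\<^sup>2 * w\<^sup>2) * z0 x) (at x within {0..1})"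
    and init: "z0 0 = 0" "z1 0 = 0" and x: "0 \<le> x" "x \<le> 1"
  shows "z0 x = z3 0 * of_real (osc k w 0 x) + z2 0 * of_real (osc k w 1 x)"
    and "z1 x = z3 0 * of_real (osc k w 1 x) + z2 0 * of_real (osc k w 2 x)"
proof -
  let ?a = "complex_of_real (k\<^sup>2 - w\<^sup>2)" let ?m = "complex_of_real (k\<^sup>2 * w\<^sup>2)"
  have rep: "z0 x = z3 0 * of_real (osc k w 0 x) + z2 0 * of_real (osc k w 1 x)" if x: "0 \<le> x" "x \<le> 1" for x
  proof -
    define E where "E = (\<lambda>j t. complex_of_real (osc k w j (x - t)))"
    have dE: "(E j has_vector_derivative - E (Suc j) t) (at t within {0..x})" if "j < 4" for j t
    proof -
      have "((\<lambda>t. osc k w j (x - t)) has_real_derivative osc k w (Suc j) (x - t) * (0 - 1)) (at t within {0..x})"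
        by (rule DERIV_chain2[OF osc_deriv[OF kw that]]) (auto intro!: derivative_eq_intros)
      from has_vector_derivative_of_real[OF this] show ?thesis by (simp add: E_def)
    qed
    have E4: "E (Suc 3) t = ?a * E 2 t + ?m * E 0 t" for t
      by (simp add: E_def numeral_eq_Suc)
    \<comment> \<open>The bilinear concomitant of the equation; the bracket with \<open>?a\<close>
      belongs to its second-order term.\<close>
    define G where "G = (\<lambda>t. z3 t * E 0 t + z2 t * E 1 t + z1 t * E 2 t + z0 t * E 3 t - ?a * (z1 t * E 0 t + z0 t * E 1 t))"
    have dG: "(G has_vector_derivative 0) (at t within {0..x})" if "t \<in> {0..x}" for t
    proof -
      have t: "0 \<le> t" "t \<le> 1" using that x by auto
      have sub: "{0..x} \<subseteq> {0..1}" using x by auto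
      note z = has_vector_derivative_within_subset[OF d0[OF t] sub] has_vector_derivative_within_subset[OF d1[OF t] sub]
        has_vector_derivative_within_subset[OF d2[OF t] sub] has_vector_derivative_within_subset[OF d3[OF t] sub]
      have e: "(E 0 has_vector_derivative - E 1 t) (at t within {0..x})" "(E 1 has_vector_derivative - E 2 t) (at t within {0..x})"
        "(E 2 has_vector_derivative - E 3 t) (at t within {0..x})"
        "(E 3 has_vector_derivative - (?a * E 2 t + ?m * E 0 t)) (at t within {0..x})"
        using dE[of 0 t] dE[of 1 t] dE[of 2 t] dE[of 3 t, unfolded E4] by (simp_all add: numeral_eq_Suc)
      show ?thesis unfolding G_def
        by (rule has_vector_derivative_eq_rhs, rule has_vector_derivative_diff[OF
              has_vector_derivative_add[OF has_vector_derivative_add[OF has_vector_derivative_add[OF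
                has_vector_derivative_mult[OF z(4) e(1)] has_vector_derivative_mult[OF z(3) e(2)]]
                has_vector_derivative_mult[OF z(2) e(3)]] has_vector_derivative_mult[OF z(1) e(4)]]
              has_vector_derivative_mult_right[OF has_vector_derivative_add[OF
                has_vector_derivative_mult[OF z(2) e(1)] has_vector_derivative_mult[OF z(1) e(2)]]]])
           (simp add: algebra_simps)
    qed
    obtain c where "\<And>t. t \<in> {0..x} \<Longrightarrow> G t = c"
      using has_vector_derivative_zero_constant[of "{0..x}" G] dG by auto
    hence "G x = G 0" using x by simp
    thus ?thesis by (simp add: G_def E_def osc_zero[OF kw] osc_zero(2)[OF kw, unfolded One_nat_def] init del: osc.simps)
  qed
  show "z0 x = z3 0 * of_real (osc k w 0 x) + z2 0 * of_real (osc k w 1 x)" by (rule rep[OF x])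
  have dO: "((\<lambda>x. complex_of_real (osc k w j x)) has_vector_derivative of_real (osc k w (Suc j) x)) (at x within {0..1})"
    if "j < 4" for j
    by (rule has_vector_derivative_of_real[OF has_field_derivative_at_within[OF osc_deriv[OF kw that]]])
  have "(z0 has_vector_derivative z3 0 * of_real (osc k w 1 x) + z2 0 * of_real (osc k w 2 x)) (at x within {0..1})"
  proof (rule has_vector_derivative_transform[rotated 2])
    show "((\<lambda>x. z3 0 * of_real (osc k w 0 x) + z2 0 * of_real (osc k w 1 x)) has_vector_derivative
         z3 0 * of_real (osc k w 1 x) + z2 0 * of_real (osc k w 2 x)) (at x within {0..1})"
      using has_vector_derivative_add[OF has_vector_derivative_mult_right[OF dO[of 0]] has_vector_derivative_mult_right[OF dO[of 1]], of "z3 0" "z2 0"]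
      by (simp add: numeral_eq_Suc del: osc.simps)
  qed (use x rep in \<open>auto simp del: osc.simps\<close>)
  thus "z1 x = z3 0 * of_real (osc k w 1 x) + z2 0 * of_real (osc k w 2 x)"
    using vector_derivative_unique_within_closed_interval[of 0 1 x z0 "z1 x"] d0[OF x] x by (simp del: osc.simps)
qed

text \<open>The characteristic equation l^4 = 2 \<alpha> l^2 + m has the roots l^2 = \<alpha> + s
  and l^2 = \<alpha> - s with s = sqrt (\<alpha>^2 + m). The second is negative as m > 0, so k is a
  growth rate and w a frequency.\<close>

lemma wave_numbers:
  assumes "\<alpha> \<ge> 0" "m > 0"
  obtains k w :: real where "k > 0" "w > 0" "k\<^sup>2 - w\<^sup>2 = 2 * \<alpha>" "k\<^sup>2 * w\<^sup>2 = m"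
proof -
  define s where "s = sqrt (\<alpha>\<^sup>2 + m)"
  have s2: "s\<^sup>2 = \<alpha>\<^sup>2 + m" using assms by (simp add: s_def)
  have s: "s > \<alpha>" unfolding s_def by (rule real_less_rsqrt) (use assms in simp)
  show ?thesis
  proof (rule that[of "sqrt (s + \<alpha>)" "sqrt (s - \<alpha>)"])
    show "(sqrt (s + \<alpha>))\<^sup>2 * (sqrt (s - \<alpha>))\<^sup>2 = m"
      using s assms s2 by (simp add: algebra_simps power2_eq_square)
  qed (use s assms in auto)
qed

text \<open>u(1) = 0 fixes u'''(0) in terms of u''(0), since \<open>osc k \<omega> 0 1\<close> is
  nonzero, and makes u a multiple of one function. Then u'(1) = 0 reads u''(0) times a determinant
  equals 0; as u has norm 1, the determinant vanishes, which is the frequency equation.\<close>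

lemma ground_state_shape:
  assumes \<alpha>: "\<alpha> \<ge> 0" and g: "ground_state \<alpha> u v w" and kw: "k > 0" "\<omega> > 0" "k\<^sup>2 - \<omega>\<^sup>2 = 2 * \<alpha>" "k\<^sup>2 * \<omega>\<^sup>2 = mu \<alpha>"
  shows "osc k \<omega> 2 1 * osc k \<omega> 0 1 = (osc k \<omega> 1 1)\<^sup>2"
    and "\<exists>p. nsq I01 u = p * nsq I01 (\<lambda>t. of_real (osc k \<omega> 1 t - osc k \<omega> 1 1 / osc k \<omega> 0 1 * osc k \<omega> 0 t)) \<and>
             nsq I01 v = p * nsq I01 (\<lambda>t. of_real (osc k \<omega> 2 t - osc k \<omega> 1 1 / osc k \<omega> 0 1 * osc k \<omega> 1 t))"
proof -
  obtain z0 z1 z2 z3 where d: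
    "\<And>x. 0 \<le> x \<Longrightarrow> x \<le> 1 \<Longrightarrow> (z0 has_vector_derivative z1 x) (at x within {0..1})"
    "\<And>x. 0 \<le> x \<Longrightarrow> x \<le> 1 \<Longrightarrow> (z1 has_vector_derivative z2 x) (at x within {0..1})"
    "\<And>x. 0 \<le> x \<Longrightarrow> x \<le> 1 \<Longrightarrow> (z2 has_vector_derivative z3 x) (at x within {0..1})"
    "\<And>x. 0 \<le> x \<Longrightarrow> x \<le> 1 \<Longrightarrow> (z3 has_vector_derivative 2 * of_real \<alpha> * z2 x + of_real (mu \<alpha>) * z0 x) (at x within {0..1})"
    and z: "z0 0 = 0" "z1 0 = 0" "z0 1 = 0" "z1 1 = 0"
    and ae: "AE x in I01. u x = z0 x" "AE x in I01. v x = z1 x" "AE x in I01. w x = z2 x"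
    by (rule ground_state_classical[OF \<alpha> g], rule that)
  have d4: "(z3 has_vector_derivative of_real (k\<^sup>2 - \<omega>\<^sup>2) * z2 x + of_real (k\<^sup>2 * \<omega>\<^sup>2) * z0 x) (at x within {0..1})"
    if "0 \<le> x" "x \<le> 1" for x using d(4)[OF that] kw(3,4) by simp
  note rep = ode_representation[OF kw(1,2) d(1-3) d4 z(1,2)]
  define S where "S = (\<lambda>j. complex_of_real (osc k \<omega> j 1))"
  have S0: "S 0 \<noteq> 0" using osc_one_pos[OF kw(1,2)] by (simp add: S_def del: osc.simps)
  define p where "p = z2 0"
  have e1: "z3 0 * S 0 + p * S 1 = 0" "z3 0 * S 1 + p * S 2 = 0"
    using rep[of 1] z(3,4) by (simp_all add: S_def p_def del: osc.simps)
  hence q: "z3 0 = - p * (S 1 / S 0)" using S0 by (simp add: field_simps add_eq_0_iff)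
  have sq: "S 1 / S 0 = of_real (osc k \<omega> 1 1 / osc k \<omega> 0 1)" by (simp add: S_def del: osc.simps)
  have r: "z0 x = p * of_real (osc k \<omega> 1 x - osc k \<omega> 1 1 / osc k \<omega> 0 1 * osc k \<omega> 0 x)"
          "z1 x = p * of_real (osc k \<omega> 2 x - osc k \<omega> 1 1 / osc k \<omega> 0 1 * osc k \<omega> 1 x)" if "x \<in> {0..1}" for x
    using rep[of x] that unfolding q sq p_def[symmetric] by (simp_all add: algebra_simps del: osc.simps)
  have H: "H2 1 u v w" and n: "nsq I01 u = 1" using g by (auto simp: ground_state_def)
  note SQ = H2_sq_int[OF H]
  have cO: "continuous_on A (osc k \<omega> j)" if "j < 4" for A j
    by (rule DERIV_continuous_on[OF has_field_derivative_at_within[OF osc_deriv[OF kw(1,2) that]]])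
  let ?f0 = "\<lambda>t. complex_of_real (osc k \<omega> 1 t - osc k \<omega> 1 1 / osc k \<omega> 0 1 * osc k \<omega> 0 t)"
  let ?f1 = "\<lambda>t. complex_of_real (osc k \<omega> 2 t - osc k \<omega> 1 1 / osc k \<omega> 0 1 * osc k \<omega> 1 t)"
  have m: "(\<lambda>t. p * ?f0 t) \<in> borel_measurable I01" "(\<lambda>t. p * ?f1 t) \<in> borel_measurable I01"
    by (intro sq_int_measurable continuous_sq_int continuous_intros continuous_on_of_real cO; simp)+
  have sp: "AE x in I01. x \<in> {0..1}" by (rule AE_I2) (simp add: space_restrict_space)
  have nu: "nsq I01 u = nsq I01 (\<lambda>t. p * ?f0 t)"
  proof (rule nsq_cong_AE[OF sq_int_measurable[OF SQ(1)] m(1)])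
    show "AE x in I01. u x = p * ?f0 x" using ae(1) sp by eventually_elim (use r(1) in auto)
  qed
  have nv: "nsq I01 v = nsq I01 (\<lambda>t. p * ?f1 t)"
  proof (rule nsq_cong_AE[OF sq_int_measurable[OF SQ(2)] m(2)])
    show "AE x in I01. v x = p * ?f1 x" using ae(2) sp by eventually_elim (use r(2) in auto)
  qed
  show "\<exists>p. nsq I01 u = p * nsq I01 ?f0 \<and> nsq I01 v = p * nsq I01 ?f1"
    by (rule exI[of _ "(cmod p)\<^sup>2"]) (simp only: nu nv nsq_cmult simp_thms)
  have "p \<noteq> 0" using nu n by auto
  have "p * (S 2 * S 0 - S 1 ^ 2) = 0"
    using e1(2) S0 unfolding q by (simp add: field_simps power2_eq_square)
  hence "S 2 * S 0 = S 1 ^ 2" using \<open>p \<noteq> 0\<close> by simp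
  thus "osc k \<omega> 2 1 * osc k \<omega> 0 1 = (osc k \<omega> 1 1)\<^sup>2"
    unfolding S_def of_real_mult[symmetric] of_real_power[symmetric] of_real_eq_iff .
qed

text \<open>The wave numbers depend on \<alpha> alone, so both states are multiples of the same
  function, and unit norm fixes the size of the factor.\<close>

lemma ground_state_unique:
  assumes \<alpha>: "\<alpha> \<ge> 0" and g: "ground_state \<alpha> u v w" "ground_state \<alpha> u' v' w'"
  shows "nsq I01 v = nsq I01 v'"
proof -
  obtain k \<omega> :: real where kw: "k > 0" "\<omega> > 0" "k\<^sup>2 - \<omega>\<^sup>2 = 2 * \<alpha>" "k\<^sup>2 * \<omega>\<^sup>2 = mu \<alpha>"
    by (rule wave_numbers[OF \<alpha> mu_pos[OF \<alpha>]], rule that)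
  define N0 where "N0 = nsq I01 (\<lambda>t. of_real (osc k \<omega> 1 t - osc k \<omega> 1 1 / osc k \<omega> 0 1 * osc k \<omega> 0 t))"
  define N1 where "N1 = nsq I01 (\<lambda>t. of_real (osc k \<omega> 2 t - osc k \<omega> 1 1 / osc k \<omega> 0 1 * osc k \<omega> 1 t))"
  obtain p where p: "nsq I01 u = p * N0 \<and> nsq I01 v = p * N1"
    using ground_state_shape(2)[OF \<alpha> g(1) kw] unfolding N0_def[symmetric] N1_def[symmetric] by blast
  obtain q where q: "nsq I01 u' = q * N0 \<and> nsq I01 v' = q * N1"
    using ground_state_shape(2)[OF \<alpha> g(2) kw] unfolding N0_def[symmetric] N1_def[symmetric] by blast
  note pq = p q
  have "p * N0 = 1" "q * N0 = 1" using g pq by (simp_all add: ground_state_def)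
  hence "p = q" by (metis mult_cancel_right mult_zero_right zero_neq_one)
  thus ?thesis using pq by simp
qed

section \<open>The constant c as least root of the frequency equation\<close>

lemma cosh_cos_less_1: assumes "0 < x" "x < pi" shows "cosh x * cos x < (1::real)"
proof -
  \<comment> \<open>\<open>g\<close> is minus the derivative of cosh x cos x, and its own derivative
    2 sinh x sin x is positive on (0, pi).\<close>
  define g where "g = (\<lambda>x::real. cosh x * sin x - sinh x * cos x)"
  have g: "g y > 0" if "0 < y" "y < pi" for y
  proof -
    have "g 0 < g y"
    proof (rule DERIV_pos_imp_increasing_open[OF that(1)])
      fix t assume t: "0 < t" "t < y"
      have "(g has_real_derivative 2 * sinh t * sin t) (at t)"
        unfolding g_def by (auto intro!: derivative_eq_intros simp: algebra_simps)
      moreover have "2 * sinh t * sin t > 0" using t that by (simp add: sin_gt_zero)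
      ultimately show "\<exists>y. (g has_real_derivative y) (at t) \<and> 0 < y" by blast
    qed (auto simp: g_def intro!: continuous_intros)
    thus ?thesis by (simp add: g_def)
  qed
  have "cosh x * cos x < cosh 0 * cos (0::real)"
  proof (rule DERIV_neg_imp_decreasing_open[OF assms(1)])
    fix t assume t: "0 < t" "t < x"
    have "((\<lambda>t::real. cosh t * cos t) has_real_derivative - g t) (at t)"
      unfolding g_def by (auto intro!: derivative_eq_intros simp: algebra_simps)
    thus "\<exists>y. ((\<lambda>t::real. cosh t * cos t) has_real_derivative y) (at t) \<and> y < 0" using g[of t] t assms by auto
  qed (auto intro!: continuous_intros)
  thus ?thesis by simp
qed

text \<open>There is no root below 3 pi / 2: before pi the product is below 1, and from there on the
  cosine is nonpositive. A root exists in [3 pi / 2, 2 pi], and compactness of the set of roots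
  there provides a least one, so that \<open>LEAST\<close> over the reals is meaningful. Its
  location strictly between pi and 2 pi gives the sign of the sine.\<close>

lemma c_const_props:
  "c_const > 0" "cosh c_const * cos c_const = 1" "sin c_const < 0"
  "\<And>k. k > 0 \<Longrightarrow> cosh k * cos k = 1 \<Longrightarrow> c_const \<le> k"
proof -
  let ?f = "\<lambda>x::real. cosh x * cos x"
  have c32: "cos (3 * pi / 2) = 0" using cos_3over2_pi by simp
  have nz: "k \<ge> 3 * pi / 2" if "k > 0" "?f k = 1" for k
  proof (rule ccontr)
    assume "\<not> k \<ge> 3 * pi / 2"
    hence lt: "k < 3 * pi / 2" by simp
    have "k \<ge> pi" using cosh_cos_less_1[of k] that by fastforce
    hence "cos (k - pi) \<ge> 0" using lt by (intro cos_ge_zero) auto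
    hence "cos k \<le> 0" by (simp add: cos_diff)
    hence "?f k \<le> 0" by (intro mult_nonneg_nonpos) auto
    thus False using that by simp
  qed
  define R where "R = {x \<in> {3 * pi / 2..2 * pi}. ?f x = 1}"
  have "\<exists>x\<ge>3 * pi / 2. x \<le> 2 * pi \<and> ?f x = 1"
    by (rule IVT') (auto simp: c32 intro!: continuous_intros cosh_real_ge_1)
  hence ne: "R \<noteq> {}" by (auto simp: R_def)
  have "closed R" unfolding R_def by (intro continuous_closed_preimage_constant continuous_intros)
  moreover have "bounded R"
    by (rule bounded_subset[OF bounded_closed_interval[of "3*pi/2" "2*pi"]]) (auto simp: R_def)
  ultimately have "compact R" by (simp add: compact_eq_bounded_closed)
  then obtain c where c: "c \<in> R" "\<And>x. x \<in> R \<Longrightarrow> c \<le> x" using compact_attains_inf[OF _ ne] by blast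
  have cp: "c > 0" using c(1) pi_gt_zero by (auto simp: R_def intro: less_le_trans[of 0 "3*pi/2"])
  have min: "c \<le> k" if "k > 0" "?f k = 1" for k
  proof (cases "k \<le> 2 * pi")
    case True thus ?thesis using nz[OF that] that by (intro c(2)) (simp add: R_def)
  next
    case False thus ?thesis using c(1) by (simp add: R_def)
  qed
  have eq: "c_const = c" unfolding c_const_def
    by (rule Least_equality) (use cp c(1) min in \<open>auto simp: R_def\<close>)
  show "c_const > 0" "cosh c_const * cos c_const = 1" using cp c(1) by (auto simp: eq R_def)
  show "\<And>k. k > 0 \<Longrightarrow> ?f k = 1 \<Longrightarrow> c_const \<le> k" using min by (simp add: eq)
  have "c \<noteq> 2 * pi"
  proof
    assume "c = 2 * pi"
    hence "cosh (2 * pi) = 1" using c(1) by (simp add: R_def)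
    thus False using cosh_gt_1[of "2*pi"] by simp
  qed
  hence "c < 2 * pi" "c > pi" using c(1) pi_gt_zero by (auto simp: R_def)
  hence "sin (c - pi) > 0" by (intro sin_gt_zero) auto
  thus "sin c_const < 0" by (simp add: eq sin_diff)
qed

text \<open>Cut off e'' and correct the two moments, so that it becomes the second derivative of a
  test function. The corrections tend to 0 because the clamped boundary values make both moments of
  e'' vanish, and integration from 0 carries the convergence down to e' and e.\<close>

lemma smooth_clamped_H2:
  assumes s: "smooth e" and z: "e 0 = 0" "e 1 = 0" "D e 0 = 0" "D e 1 = 0"
  shows "H2 1 e (D e) (D (D e))"
proof -
  note s1 = smooth_D[OF s] note s2 = smooth_D[OF s1]
  define w where "w = D (D e)"
  have cw: "continuous_on {0..1} w" unfolding w_def by (rule smooth_continuous[OF s2])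
  have cv: "continuous_on {0..1} (D e)" by (rule smooth_continuous[OF s1])
  obtain \<eta> where \<eta>: "test_function {0..1::real} \<eta>" "(\<integral>x. \<eta> x \<partial>I01) = 1" using exists_test_function_unit by blast
  define X where "X = (\<lambda>n x. w x * complex_of_real (cutoff 0 1 n x))"
  have tX: "test_function {0..1} (X n)" for n
    unfolding X_def w_def by (rule test_function_mult_cutoff[OF s2]) (auto simp: box_real)
  define c0 where "c0 = (\<lambda>n. \<integral>x. X n x \<partial>I01)"
  define c1 where "c1 = (\<lambda>n. \<integral>x. of_real (1 - x) * (X n x - c0 n * \<eta> x) \<partial>I01)"
  have "\<exists>\<phi>. test_function {0..1} \<phi> \<and> D (D \<phi>) = (\<lambda>x. X n x - c0 n * \<eta> x - c1 n * D \<eta> x)" for n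
    by (rule moment_correction[OF \<eta> tX, of n], intro exI conjI, assumption, simp only: c0_def c1_def)
  then obtain \<phi> where t: "\<And>n. test_function {0..1} (\<phi> n)"
    and DD: "\<And>n. D (D (\<phi> n)) = (\<lambda>x. X n x - c0 n * \<eta> x - c1 n * D \<eta> x)" by metis
  have sqw: "sq_int I01 w" by (rule continuous_sq_int[OF cw])
  note sqX = test_function_sq_int[OF tX, of "{0..1}", simplified]
  have LX: "L2_lim I01 X w"
    unfolding L2_lim_def
  proof (intro conjI allI sqX sqw)
    have "(\<lambda>n. \<integral>x. (cmod (X n x - w x))\<^sup>2 \<partial>I01) \<longlonglongrightarrow> (\<integral>x. 0 \<partial>I01)"
    proof (rule integral_dominated_convergence[where w="\<lambda>x. (cmod (w x))\<^sup>2"])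
      have mX: "(\<lambda>x. X n x - w x) \<in> borel_measurable I01" for n by (intro sq_int_measurable sq_int_diff sqX sqw)
      show "(\<lambda>x. (cmod (X n x - w x))\<^sup>2) \<in> borel_measurable I01" for n using mX[of n] by measurable
      show "integrable I01 (\<lambda>x. (cmod (w x))\<^sup>2)" using sqw by (simp add: sq_int_def)
      have eq: "X n x - w x = w x * of_real (cutoff 0 1 n x - 1)" for n x by (simp add: X_def algebra_simps)
      show "AE x in I01. norm ((cmod (X n x - w x))\<^sup>2) \<le> (cmod (w x))\<^sup>2" for n
      proof (rule AE_I2)
        fix x :: real
        have "\<bar>cutoff 0 1 n x - 1\<bar> \<le> 1" using cutoff_bounds[of "0::real" 1 n x] by linarith
        hence "cmod (X n x - w x) \<le> cmod (w x) * 1" unfolding eq norm_mult norm_of_real by (intro mult_left_mono) auto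
        thus "norm ((cmod (X n x - w x))\<^sup>2) \<le> (cmod (w x))\<^sup>2" by (simp add: power_mono)
      qed
      have "AE x in lborel. x \<noteq> (0::real) \<and> x \<noteq> 1" using AE_lborel_singleton[of "0::real"] AE_lborel_singleton[of "1::real"] by auto
      hence "AE x in I01. x \<noteq> 0 \<and> x \<noteq> 1" by (simp add: AE_restrict_space_iff) (auto elim: eventually_mono)
      moreover have "AE x in I01. x \<in> {0..1}" by (rule AE_I2) (simp add: space_restrict_space)
      ultimately show "AE x in I01. (\<lambda>n. (cmod (X n x - w x))\<^sup>2) \<longlonglongrightarrow> 0"
      proof eventually_elim
        case (elim x)
        have "(\<lambda>n. cutoff 0 1 n x) \<longlonglongrightarrow> 1" by (rule cutoff_tendsto) (use elim in \<open>auto simp: box_real\<close>)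
        hence "(\<lambda>n. (cmod (w x * of_real (cutoff 0 1 n x - 1)))\<^sup>2) \<longlonglongrightarrow> (cmod (w x * of_real (1 - 1)))\<^sup>2"
          by (intro tendsto_intros)
        thus ?case unfolding eq by simp
      qed
    qed auto
    thus "(\<lambda>n. nsq I01 (\<lambda>x. X n x - w x)) \<longlonglongrightarrow> 0" by (simp add: nsq_def)
  qed
  have one: "sq_int I01 (\<lambda>x. 1)" and lin: "sq_int I01 (\<lambda>x. of_real (1 - x))" by (intro continuous_sq_int continuous_intros)+
  have I0: "(\<integral>x. w x \<partial>I01) = 0"
    using leb_FTC[of 0 1 "D e" w] smooth_has_vector_derivative[OF s1] cw z by (simp add: w_def)
  have "c0 \<longlonglongrightarrow> (\<integral>x. w x * 1 \<partial>I01)" unfolding c0_def using lint_mult_lim[OF LX one] by simp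
  hence c0: "c0 \<longlonglongrightarrow> 0" using I0 by simp
  have sqe: "sq_int I01 \<eta>" "sq_int I01 (D \<eta>)" using test_function_sq_int[OF \<eta>(1)] test_function_sq_int[OF test_functionD_real[OF \<eta>(1)]] by auto
  have ne: "L2_lim I01 (\<lambda>n x. a n * g x) (\<lambda>x. 0)" if "a \<longlonglongrightarrow> 0" "sq_int I01 g" for a g
    unfolding L2_lim_def using sq_int_cmult[OF that(2)]
      tendsto_mult_right[OF tendsto_power[OF tendsto_norm[OF that(1)], of 2], of "nsq I01 g"] by (simp add: nsq_cmult)
  have I1: "(\<integral>x. w x * of_real (1 - x) \<partial>I01) = 0"
  proof -
    have "(\<integral>x. w x * of_real (1 - x) - D e x \<partial>I01) = D e 1 * of_real (1 - 1) - D e 0 * of_real (1 - 0)"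
    proof (rule leb_FTC)
      fix x :: real
      have "((\<lambda>x. complex_of_real (1 - x)) has_vector_derivative of_real (-1)) (at x within {0..1})"
        by (intro has_vector_derivative_of_real) (auto intro!: derivative_eq_intros)
      from has_vector_derivative_mult[OF smooth_has_vector_derivative[OF s1] this]
      show "((\<lambda>x. D e x * of_real (1 - x)) has_vector_derivative w x * of_real (1 - x) - D e x) (at x within {0..1})"
        by (simp add: w_def)
    qed (auto intro!: continuous_intros cw cv)
    hence "(\<integral>x. w x * of_real (1 - x) - D e x \<partial>I01) = 0" using z by simp
    moreover have "(\<integral>x. D e x \<partial>I01) = 0"
      using leb_FTC[of 0 1 e "D e"] smooth_has_vector_derivative[OF s] cv z by simp
    moreover have "integrable I01 (\<lambda>x. w x * of_real (1 - x))" "integrable I01 (D e)"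
      by (intro continuous_integrable_leb continuous_intros cw cv)+
    ultimately show ?thesis by simp
  qed
  have "(\<lambda>n. \<integral>x. (X n x - c0 n * \<eta> x) * of_real (1 - x) \<partial>I01) \<longlonglongrightarrow> (\<integral>x. (w x - 0) * of_real (1 - x) \<partial>I01)"
    by (rule lint_mult_lim[OF L2_lim_diff[OF LX ne[OF c0 sqe(1)]] lin])
  hence c1: "c1 \<longlonglongrightarrow> 0" using I1 by (simp add: c1_def mult.commute)
  have L2: "L2_lim I01 (\<lambda>n. D (D (\<phi> n))) w"
    unfolding DD using L2_lim_diff[OF L2_lim_diff[OF LX ne[OF c0 sqe(1)]] ne[OF c1 sqe(2)]] by simp
  \<comment> \<open>Convergence descends from derivatives to functions, as both sides are primitives
    starting at 0.\<close>
  have Jlim: "L2_lim I01 F f" if "\<And>n. test_function {0..1} (F n)" "L2_lim I01 (\<lambda>n. D (F n)) (D f)" "smooth f" "f 0 = 0" for F f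
  proof -
    note sf = continuous_sq_int[OF smooth_continuous[OF that(3)], of 0 1]
    have "(\<lambda>n. nsq I01 (\<lambda>x. F n x - f x)) \<longlonglongrightarrow> 0"
    proof (rule tendsto_0_squeeze[OF _ _ L2_limD(3)[OF that(2)]])
      fix n
      let ?e = "nsq I01 (\<lambda>x. D (F n) x - D f x)"
      note tF = that(1) and LF = that(2) and sf0 = that(3,4)
      have "(cmod (F n x - f x))\<^sup>2 \<le> ?e" if x: "0 \<le> x" "x \<le> 1" for x
        using J_diff_bound[OF L2_limD(1,2)[OF LF], of n x] J_test[OF tF x] J_smooth[OF sf0 x] by simp
      thus "nsq I01 (\<lambda>x. F n x - f x) \<le> ?e"
        by (intro nsq_le_const sq_int_diff test_function_sq_int[OF tF] sf) simp_all
    qed simp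
    thus ?thesis using test_function_sq_int[OF that(1), of "{0..1}"] sf by (simp add: L2_lim_def)
  qed
  have L1: "L2_lim I01 (\<lambda>n. D (\<phi> n)) (D e)"
    by (rule Jlim[OF test_functionD_real[OF t] L2[unfolded w_def] s1 z(3)])
  have L0: "L2_lim I01 \<phi> e" by (rule Jlim[OF t L1 s z(1)])
  show ?thesis by (rule H2I[OF t L0 L1 L2[unfolded w_def]])
qed

section \<open>The clamped beam\<close>

lemma smooth_exp_real: "smooth (\<lambda>t::real. exp (l * complex_of_real t))"
proof -
  have "((\<lambda>t. l^n * exp (l * complex_of_real t)) has_vector_derivative l^Suc n * exp (l * complex_of_real t)) (at t)" for n t
  proof -
    have "((\<lambda>z. l^n * exp (l * z)) has_field_derivative l^Suc n * exp (l * of_real t)) (at (of_real t))"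
      by (auto intro!: derivative_eq_intros)
    from has_vector_derivative_real_field[OF this] show ?thesis by (simp add: o_def)
  qed
  from smooth_inner[of "\<lambda>n t. l^n * exp (l * complex_of_real t)" 0 "1::real", OF this] show ?thesis
    by (simp only: inner_real_def mult_1_right power_0 mult_1_left)
qed

lemma smooth_cosh_cos:
  "smooth (\<lambda>t::real. complex_of_real (cosh (c * t)))" "smooth (\<lambda>t::real. complex_of_real (sinh (c * t)))"
  "smooth (\<lambda>t::real. complex_of_real (cos (c * t)))" "smooth (\<lambda>t::real. complex_of_real (sin (c * t)))"
proof -
  let ?e = "\<lambda>l t. exp (l * complex_of_real t)"
  have "(\<lambda>t. complex_of_real (cosh (c * t))) = (\<lambda>t. (1/2) * (?e (of_real c) t + ?e (of_real (-c)) t))"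
    by (auto simp: cosh_field_def simp flip: exp_of_real)
  thus "smooth (\<lambda>t::real. complex_of_real (cosh (c * t)))"
    by (simp only:) (intro smooth_mult smooth_const smooth_add smooth_exp_real)
  have "(\<lambda>t. complex_of_real (sinh (c * t))) = (\<lambda>t. (1/2) * (?e (of_real c) t - ?e (of_real (-c)) t))"
    by (auto simp: sinh_field_def simp flip: exp_of_real)
  thus "smooth (\<lambda>t::real. complex_of_real (sinh (c * t)))"
    by (simp only:) (intro smooth_mult smooth_const smooth_diff smooth_exp_real)
  have "(\<lambda>t. complex_of_real (cos (c * t))) = (\<lambda>t. (1/2) * (?e (\<i> * of_real c) t + ?e (- (\<i> * of_real c)) t))"
    by (auto simp: cos_exp_eq mult.assoc simp flip: cos_of_real)
  thus "smooth (\<lambda>t::real. complex_of_real (cos (c * t)))"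
    by (simp only:) (intro smooth_mult smooth_const smooth_add smooth_exp_real)
  have "(\<lambda>t. complex_of_real (sin (c * t))) = (\<lambda>t. (1/(2*\<i>)) * (?e (\<i> * of_real c) t - ?e (- (\<i> * of_real c)) t))"
    by (auto simp: sin_exp_eq mult.assoc simp flip: sin_of_real)
  thus "smooth (\<lambda>t::real. complex_of_real (sin (c * t)))"
    by (simp only:) (intro smooth_mult smooth_const smooth_diff smooth_exp_real)
qed

lemma D_of_real:
  assumes "\<And>t. (f has_real_derivative f' t) (at t)"
  shows "D (\<lambda>t. complex_of_real (f t)) = (\<lambda>t. complex_of_real (f' t))"
proof
  fix t
  have "((\<lambda>t. complex_of_real (f t)) has_derivative (\<lambda>h. h *\<^sub>R of_real (f' t))) (at t)"
    using has_vector_derivative_of_real[OF assms] by (simp only: has_vector_derivative_def)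
  from pderiv_at_eq[OF this, of 1] show "D (\<lambda>t. complex_of_real (f t)) t = of_real (f' t)" by simp
qed

text \<open>The ground state is \<open>mode 0 = mode_P + mode_T\<close>: \<open>mode_P\<close>, \<open>mode_T\<close> are its hyperbolic and trigonometric
  parts, the primed functions their derivatives divided by \<open>c\<close>.\<close>

definition mode_sigma :: real where "mode_sigma = - sin c_const / (1 + cos c_const)"

definition mode_P :: "real \<Rightarrow> real" where
  "mode_P x = cosh (c_const * x) - mode_sigma * sinh (c_const * x)"
definition mode_P' :: "real \<Rightarrow> real" where
  "mode_P' x = sinh (c_const * x) - mode_sigma * cosh (c_const * x)"
definition mode_T :: "real \<Rightarrow> real" where
  "mode_T x = - cos (c_const * x) + mode_sigma * sin (c_const * x)"
definition mode_T' :: "real \<Rightarrow> real" where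
  "mode_T' x = sin (c_const * x) + mode_sigma * cos (c_const * x)"

lemma mode_deriv:
  "(mode_P has_real_derivative c_const * mode_P' x) (at x within S)"
  "(mode_P' has_real_derivative c_const * mode_P x) (at x within S)"
  "(mode_T has_real_derivative c_const * mode_T' x) (at x within S)"
  "(mode_T' has_real_derivative - (c_const * mode_T x)) (at x within S)"
  unfolding mode_P_def[abs_def] mode_P'_def[abs_def] mode_T_def[abs_def] mode_T'_def[abs_def]
  by (auto intro!: derivative_eq_intros simp: algebra_simps)

text \<open>These identities trade the squares of the parts, up to constants, for derivatives of
  products such as P P' and T T'; hence the norms of the mode have closed forms.\<close>

lemma mode_squares:
  "(mode_P x)\<^sup>2 - (mode_P' x)\<^sup>2 = 1 - mode_sigma\<^sup>2"
  "(mode_T x)\<^sup>2 + (mode_T' x)\<^sup>2 = 1 + mode_sigma\<^sup>2"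
proof -
  have h: "(cosh (c_const * x))\<^sup>2 = (sinh (c_const * x))\<^sup>2 + 1" by (rule cosh_square_eq)
  have "(mode_P x)\<^sup>2 - (mode_P' x)\<^sup>2 = ((cosh (c_const * x))\<^sup>2 - (sinh (c_const * x))\<^sup>2) * (1 - mode_sigma\<^sup>2)"
    unfolding mode_P_def mode_P'_def by (simp add: power2_eq_square algebra_simps)
  thus "(mode_P x)\<^sup>2 - (mode_P' x)\<^sup>2 = 1 - mode_sigma\<^sup>2" by (simp add: h)
  have "(mode_T x)\<^sup>2 + (mode_T' x)\<^sup>2 = ((sin (c_const * x))\<^sup>2 + (cos (c_const * x))\<^sup>2) * (1 + mode_sigma\<^sup>2)"
  proof -
    have "(- b + mode_sigma * a)\<^sup>2 + (a + mode_sigma * b)\<^sup>2 = (a\<^sup>2 + b\<^sup>2) * (1 + mode_sigma\<^sup>2)" for a b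
      by (simp add: power2_eq_square algebra_simps)
    thus ?thesis unfolding mode_T_def mode_T'_def .
  qed
  thus "(mode_T x)\<^sup>2 + (mode_T' x)\<^sup>2 = 1 + mode_sigma\<^sup>2" by (simp only: sin_cos_squared_add mult_1_left)
qed

text \<open>cosh c cos c = 1 eliminates the hyperbolic functions; sinh c > 0 and sin c < 0 decide
  the sign of the square root.\<close>

lemma c_const_trig:
  "cos c_const > 0" "cosh c_const = 1 / cos c_const" "sinh c_const = - sin c_const / cos c_const"
proof -
  have "cosh c_const > 0" by (rule cosh_real_pos)
  thus p: "cos c_const > 0" using c_const_props(2) by (metis mult_pos_pos not_one_le_zero less_eq_real_def mult_nonneg_nonpos linorder_not_less)
  show ch: "cosh c_const = 1 / cos c_const" using c_const_props(2) p by (simp add: field_simps)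
  have "(sinh c_const)\<^sup>2 = (1 / cos c_const)\<^sup>2 - 1" using cosh_square_eq[of c_const] ch by simp
  also have "\<dots> = (1 - (cos c_const)\<^sup>2) / (cos c_const)\<^sup>2" using p by (simp add: field_simps)
  also have "\<dots> = (- sin c_const / cos c_const)\<^sup>2" by (simp add: sin_squared_eq power_divide)
  finally have "sinh c_const = - sin c_const / cos c_const \<or> sinh c_const = - (- sin c_const / cos c_const)"
    by (simp only: power2_eq_iff)
  moreover have "sinh c_const > 0" using c_const_props(1) by simp
  moreover have "- (- sin c_const / cos c_const) < 0" using c_const_props(3) p by (simp add: divide_neg_pos)
  ultimately show "sinh c_const = - sin c_const / cos c_const" by linarith
qed

text \<open>\<open>mode_sigma\<close> is the usual clamped-beam coefficient (cosh c - cos c) / (sinh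
  c - sin c), simplified with cosh c = 1 / cos c and sinh c = - tan c. It makes the hyperbolic and
  the trigonometric part cancel at 1, as they do at 0, together with their derivatives.\<close>

lemma mode_ends:
  "mode_P 0 = 1" "mode_P' 0 = - mode_sigma" "mode_T 0 = - 1" "mode_T' 0 = mode_sigma"
  "mode_P 1 = 1" "mode_P' 1 = mode_sigma" "mode_T 1 = - 1" "mode_T' 1 = - mode_sigma"
proof -
  define C s where "C = cos c_const" and "s = sin c_const"
  have C: "C > 0" "1 + C \<noteq> 0" using c_const_trig(1) by (auto simp: C_def)
  have s2: "s * s = 1 - C * C" using sin_squared_eq[of c_const] by (simp add: C_def s_def power2_eq_square)
  have sg: "mode_sigma = - s / (1 + C)" by (simp add: mode_sigma_def C_def s_def)
  have h: "cosh c_const = 1 / C" "sinh c_const = - s / C" using c_const_trig by (auto simp: C_def s_def)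
  have ss: "mode_sigma * s = - (1 - C)"
  proof -
    have "mode_sigma * s = - (s * s) / (1 + C)" by (simp add: sg)
    also have "s * s = (1 - C) * (1 + C)" using s2 by (simp add: algebra_simps)
    finally show ?thesis using C by simp
  qed
  have sC: "mode_sigma * C = - s - mode_sigma" using C by (simp add: sg field_simps)
  show "mode_P 0 = 1" "mode_P' 0 = - mode_sigma" "mode_T 0 = - 1" "mode_T' 0 = mode_sigma"
    by (simp_all add: mode_P_def mode_P'_def mode_T_def mode_T'_def)
  have "mode_P 1 = (1 + mode_sigma * s) / C" by (simp add: mode_P_def h add_divide_distrib)
  thus "mode_P 1 = 1" using C by (simp add: ss)
  have "mode_P' 1 = (- s - mode_sigma) / C" by (simp add: mode_P'_def h diff_divide_distrib)
  thus "mode_P' 1 = mode_sigma" using C by (simp flip: sC)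
  show "mode_T 1 = - 1" using ss by (simp add: mode_T_def C_def s_def)
  show "mode_T' 1 = - mode_sigma" using sC by (simp add: mode_T'_def C_def s_def)
qed

text \<open>The j-th derivative of the ground state: differentiation exchanges P and P' without a
  sign, while T and T' rotate and change sign every second time.\<close>

definition mode :: "nat \<Rightarrow> real \<Rightarrow> real" where
  "mode j x = (if even j then c_const ^ j * (mode_P x + (-1) ^ (j div 2) * mode_T x)
               else c_const ^ j * (mode_P' x + (-1) ^ (j div 2) * mode_T' x))"

lemma mode_simps:
  "mode 0 = (\<lambda>x. mode_P x + mode_T x)" "mode 1 = (\<lambda>x. c_const * (mode_P' x + mode_T' x))"
  "mode 2 = (\<lambda>x. c_const\<^sup>2 * (mode_P x - mode_T x))" "mode 3 = (\<lambda>x. c_const^3 * (mode_P' x - mode_T' x))"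
  by (auto simp: mode_def)

lemma mode_has_derivative:
  "(mode 0 has_real_derivative mode 1 x) (at x within S)"
  "(mode 1 has_real_derivative mode 2 x) (at x within S)"
  "(mode 2 has_real_derivative mode 3 x) (at x within S)"
  "(mode 3 has_real_derivative c_const^4 * mode 0 x) (at x within S)"
  unfolding mode_simps
  by (auto intro!: derivative_eq_intros mode_deriv simp: algebra_simps power2_eq_square power3_eq_cube power4_eq_xxxx)

lemma mode_continuous: "continuous_on A (mode 0)" "continuous_on A (mode 1)" "continuous_on A (mode 2)"
  by (rule DERIV_continuous_on, rule mode_has_derivative)+

lemma nsq_of_real:
  assumes "continuous_on {0..1} f" "\<And>x. 0 \<le> x \<Longrightarrow> x \<le> 1 \<Longrightarrow> (F has_real_derivative (f x)\<^sup>2) (at x within {0..1})"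
  shows "nsq I01 (\<lambda>x. of_real (f x)) = F 1 - F 0"
  unfolding nsq_def norm_of_real power2_abs
  by (rule leb_FTC) (use assms in \<open>auto simp: has_real_derivative_iff_has_vector_derivative intro!: continuous_intros\<close>)

lemma nsq_mode_0: "nsq I01 (\<lambda>x. of_real (mode 0 x)) = 1"
proof -
  \<comment> \<open>An explicit primitive of (P + T)^2: by \<open>mode_squares\<close> P^2 and T^2
    are half-derivatives of P P' / c and - T T' / c up to constants adding to 1, and 2 P T is the
    derivative of (P' T - P T') / c.\<close>
  define F where "F = (\<lambda>x. x + (mode_P x * mode_P' x - mode_T x * mode_T' x + 2 * mode_P' x * mode_T x - 2 * mode_P x * mode_T' x) / (2 * c_const))"
  have "nsq I01 (\<lambda>x. of_real (mode 0 x)) = F 1 - F 0"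
  proof (rule nsq_of_real[OF mode_continuous(1)])
    fix x :: real
    have c: "c_const \<noteq> 0" using c_const_props(1) by simp
    have "(F has_real_derivative 1 + (c_const * ((mode_P' x)\<^sup>2 + (mode_P x)\<^sup>2 - (mode_T' x)\<^sup>2 + (mode_T x)\<^sup>2 + 4 * mode_P x * mode_T x)) / (2 * c_const)) (at x within {0..1})"
      unfolding F_def
      by (rule DERIV_add[OF DERIV_ident DERIV_cdivide])
         (auto intro!: derivative_eq_intros mode_deriv simp: algebra_simps power2_eq_square)
    also have "1 + (c_const * ((mode_P' x)\<^sup>2 + (mode_P x)\<^sup>2 - (mode_T' x)\<^sup>2 + (mode_T x)\<^sup>2 + 4 * mode_P x * mode_T x)) / (2 * c_const) =
       1 + ((mode_P' x)\<^sup>2 + (mode_P x)\<^sup>2 - (mode_T' x)\<^sup>2 + (mode_T x)\<^sup>2 + 4 * mode_P x * mode_T x) / 2"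
      using c by simp
    also have "\<dots> = (mode 0 x)\<^sup>2"
      using mode_squares[of x] by (simp add: mode_simps power2_sum field_simps)
    finally show "(F has_real_derivative (mode 0 x)\<^sup>2) (at x within {0..1})" .
  qed
  thus ?thesis by (simp add: F_def mode_ends)
qed

lemma nsq_mode_1: "nsq I01 (\<lambda>x. of_real (mode 1 x)) = c_const\<^sup>2 * mode_sigma\<^sup>2 - 2 * c_const * mode_sigma"
proof -
  \<comment> \<open>The same construction for (P' + T')^2: the constants now add up to
    \<open>mode_sigma\<close> squared, and 2 P' T' is the derivative of (P T' + P' T) / c.\<close>
  define F where "F = (\<lambda>x. c_const\<^sup>2 * mode_sigma\<^sup>2 * x + c_const / 2 * (mode_P x * mode_P' x + mode_T x * mode_T' x + 2 * mode_P x * mode_T' x + 2 * mode_P' x * mode_T x))"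
  have "nsq I01 (\<lambda>x. of_real (mode 1 x)) = F 1 - F 0"
  proof (rule nsq_of_real[OF mode_continuous(2)])
    fix x :: real
    have "(F has_real_derivative c_const\<^sup>2 * mode_sigma\<^sup>2 * 1 + c_const / 2 * (c_const * ((mode_P' x)\<^sup>2 + (mode_P x)\<^sup>2 + (mode_T' x)\<^sup>2 - (mode_T x)\<^sup>2 + 4 * mode_P' x * mode_T' x))) (at x within {0..1})"
      unfolding F_def
      by (rule DERIV_add[OF DERIV_cmult[OF DERIV_ident] DERIV_cmult])
         (auto intro!: derivative_eq_intros mode_deriv simp: algebra_simps power2_eq_square)
    also have "c_const\<^sup>2 * mode_sigma\<^sup>2 * 1 + c_const / 2 * (c_const * ((mode_P' x)\<^sup>2 + (mode_P x)\<^sup>2 + (mode_T' x)\<^sup>2 - (mode_T x)\<^sup>2 + 4 * mode_P' x * mode_T' x)) =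
       c_const\<^sup>2 / 2 * (2 * mode_sigma\<^sup>2 + ((mode_P' x)\<^sup>2 + (mode_P x)\<^sup>2 + (mode_T' x)\<^sup>2 - (mode_T x)\<^sup>2 + 4 * mode_P' x * mode_T' x))"
      by (simp add: power2_eq_square algebra_simps)
    also have "2 * mode_sigma\<^sup>2 + ((mode_P' x)\<^sup>2 + (mode_P x)\<^sup>2 + (mode_T' x)\<^sup>2 - (mode_T x)\<^sup>2 + 4 * mode_P' x * mode_T' x) = 2 * (mode_P' x + mode_T' x)\<^sup>2"
      using mode_squares[of x] by (simp add: power2_sum field_simps)
    also have "c_const\<^sup>2 / 2 * (2 * (mode_P' x + mode_T' x)\<^sup>2) = (mode 1 x)\<^sup>2"
      by (simp add: mode_simps mode_simps(2)[unfolded One_nat_def] power_mult_distrib)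
    finally show "(F has_real_derivative (mode 1 x)\<^sup>2) (at x within {0..1})" .
  qed
  also have "\<dots> = c_const\<^sup>2 * mode_sigma\<^sup>2 - 2 * c_const * mode_sigma"
    by (simp add: F_def mode_ends)
  finally show ?thesis .
qed

text \<open>With C = cos c and s = sin c one has tanh c = - s and tan c = s / C, and d becomes (2 s
  + c (1 - C)) / (c (1 + C)). The norm takes this form because \<open>mode_sigma\<close> squared is
  (1 - C) / (1 + C).\<close>

lemma nsq_mode_1_d_const: "nsq I01 (\<lambda>x. of_real (mode 1 x)) = d_const * c_const\<^sup>2"
proof -
  define c C s where "c = c_const" and "C = cos c_const" and "s = sin c_const"
  have C: "C > 0" "1 + C \<noteq> 0" "C \<noteq> 0" using c_const_trig(1) by (auto simp: C_def)
  have c0: "c \<noteq> 0" and s0: "s \<noteq> 0" using c_const_props by (auto simp: c_def s_def)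
  have s2: "s * s = 1 - C * C" using sin_squared_eq[of c_const] by (simp add: C_def s_def power2_eq_square)
  have th: "tanh c = - s" using c_const_trig C by (simp add: tanh_def c_def C_def s_def)
  have tn: "tan c = s / C" by (simp add: tan_def c_def C_def s_def)
  have num: "2 * (- s) * (s / C) - c * (- s) - c * (s / C) = (- s / C) * (2 * s + c * (1 - C))"
    using C by (simp add: field_simps)
  have den: "c * (- s) - c * (s / C) = (- s / C) * (c * (1 + C))" using C by (simp add: field_simps)
  have "d_const = (2 * (- s) * (s / C) - c * (- s) - c * (s / C)) / (c * (- s) - c * (s / C))"
    using th tn by (simp add: d_const_def Let_def c_def)
  also have "\<dots> = (2 * s + c * (1 - C)) / (c * (1 + C))"
    unfolding num den by (rule mult_divide_mult_cancel_left) (use s0 C in simp)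
  finally have d0: "d_const = (2 * s + c * (1 - C)) / (c * (1 + C))" .
  have d: "d_const * c\<^sup>2 = c * (2 * s + c * (1 - C)) / (1 + C)"
  proof -
    have "X / (c * Y) * c\<^sup>2 = c * X / Y" for X Y using c0 by (simp add: power2_eq_square)
    thus ?thesis unfolding d0 .
  qed
  have sg: "mode_sigma = - s / (1 + C)" by (simp add: mode_sigma_def C_def s_def)
  have sg2: "mode_sigma\<^sup>2 = (1 - C) / (1 + C)"
  proof -
    have "mode_sigma\<^sup>2 = (s * s) / ((1 + C) * (1 + C))" by (simp add: sg power2_eq_square)
    also have "s * s = (1 - C) * (1 + C)" using s2 by (simp add: algebra_simps)
    finally show ?thesis using C by simp
  qed
  have "c\<^sup>2 * (X / Y) - 2 * c * (- s / Y) = c * (2 * s + c * X) / Y" for X Y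
    by (simp add: add_divide_distrib power2_eq_square distrib_left mult_ac)
  hence "c\<^sup>2 * mode_sigma\<^sup>2 - 2 * c * mode_sigma = c * (2 * s + c * (1 - C)) / (1 + C)"
    unfolding sg2 unfolding sg .
  thus ?thesis using nsq_mode_1 d by (simp add: c_def)
qed

text \<open>Two integrations by parts with u'''' = c^4 u and clamped boundary values reduce the norm
  of u'' to that of u.\<close>

lemma nsq_mode_2: "nsq I01 (\<lambda>x. of_real (mode 2 x)) = c_const^4"
proof -
  have e: "mode 0 0 = 0" "mode 0 1 = 0" "mode 1 0 = 0" "mode 1 1 = 0" by (simp_all add: mode_simps mode_simps(2)[unfolded One_nat_def] mode_ends)
  have "(\<integral>x. (mode 2 x)\<^sup>2 - c_const^4 * (mode 0 x)\<^sup>2 \<partial>I01) = (mode 2 1 * mode 1 1 - mode 3 1 * mode 0 1) - (mode 2 0 * mode 1 0 - mode 3 0 * mode 0 0)"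
  proof (rule leb_FTC)
    fix x :: real
    have "((\<lambda>x. mode 2 x * mode 1 x - mode 3 x * mode 0 x) has_real_derivative (mode 3 x * mode 1 x + mode 2 x * mode 2 x) - (c_const^4 * mode 0 x * mode 0 x + mode 1 x * mode 3 x)) (at x within {0..1})"
      by (rule DERIV_cong[OF DERIV_diff[OF DERIV_mult[OF mode_has_derivative(3,2)] DERIV_mult[OF mode_has_derivative(4,1)]]]) (simp add: algebra_simps)
    thus "((\<lambda>x. mode 2 x * mode 1 x - mode 3 x * mode 0 x) has_vector_derivative (mode 2 x)\<^sup>2 - c_const^4 * (mode 0 x)\<^sup>2) (at x within {0..1})"
      by (simp add: has_real_derivative_iff_has_vector_derivative power2_eq_square algebra_simps)
  qed (auto intro!: continuous_intros mode_continuous)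
  hence "(\<integral>x. (mode 2 x)\<^sup>2 - c_const^4 * (mode 0 x)\<^sup>2 \<partial>I01) = 0" by (simp add: e e[unfolded One_nat_def])
  moreover have "integrable I01 (\<lambda>x. (mode 2 x)\<^sup>2)" "integrable I01 (\<lambda>x. (mode 0 x)\<^sup>2)"
    by (intro continuous_integrable_leb continuous_intros mode_continuous)+
  ultimately have "(\<integral>x. (mode 2 x)\<^sup>2 \<partial>I01) = c_const^4 * (\<integral>x. (mode 0 x)\<^sup>2 \<partial>I01)" by simp
  thus ?thesis using nsq_mode_0 by (simp add: nsq_def)
qed

lemma H2_mode: "H2 1 (\<lambda>x. of_real (mode 0 x)) (\<lambda>x. of_real (mode 1 x)) (\<lambda>x. of_real (mode 2 x))"
proof -
  have d: "D (\<lambda>x. of_real (mode 0 x)) = (\<lambda>x. of_real (mode 1 x))" "D (\<lambda>x. of_real (mode 1 x)) = (\<lambda>x. of_real (mode 2 x))"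
    by (rule D_of_real, rule mode_has_derivative)+
  have s: "smooth (\<lambda>x. complex_of_real (mode 0 x))"
    unfolding mode_simps mode_P_def mode_T_def of_real_add of_real_diff of_real_minus of_real_mult
    by (intro smooth_add smooth_diff smooth_uminus smooth_mult smooth_const smooth_cosh_cos[unfolded of_real_mult])
  have e: "mode 0 0 = 0" "mode 0 1 = 0" "mode 1 0 = 0" "mode 1 1 = 0" by (simp_all add: mode_simps mode_simps(2)[unfolded One_nat_def] mode_ends)
  from smooth_clamped_H2[OF s] show ?thesis by (simp only: d e of_real_0 simp_thms)
qed

text \<open>The mode gives the upper bound. For the lower one, a ground state at \<alpha> = 0 has
  equal wave numbers k, its frequency equation reduces to cosh k cos k = 1, and c is the least such
  k.\<close>

lemma mu_0: "mu 0 = c_const^4"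
proof (rule antisym)
  show "mu 0 \<le> c_const^4" using mu_le[OF _ H2_mode, of 0] by (simp add: nsq_mode_0 nsq_mode_2)
  obtain u v w where g: "ground_state 0 u v w" by (rule ground_state_exists[of 0]) auto
  obtain k \<omega> :: real where kw: "k > 0" "\<omega> > 0" "k\<^sup>2 - \<omega>\<^sup>2 = 2 * 0" "k\<^sup>2 * \<omega>\<^sup>2 = mu 0"
    by (rule wave_numbers[OF order_refl mu_pos[OF order_refl]], rule that)
  have eq: "\<omega> = k" using kw by (simp add: power2_eq_iff_nonneg)
  have "osc k \<omega> 2 1 * osc k \<omega> 0 1 = (osc k \<omega> 1 1)\<^sup>2" by (rule ground_state_shape(1)[OF order_refl g kw])
  hence "(k * sinh k + k * sin k) / (k\<^sup>2 + k\<^sup>2) * ((sinh k / k - sin k / k) / (k\<^sup>2 + k\<^sup>2)) = ((cosh k - cos k) / (k\<^sup>2 + k\<^sup>2))\<^sup>2"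
    unfolding eq osc_numeral osc_fun by simp
  moreover have "(k * a + k * b) / (k\<^sup>2 + k\<^sup>2) * ((a / k - b / k) / (k\<^sup>2 + k\<^sup>2)) = (a\<^sup>2 - b\<^sup>2) / (4 * k^4)"
     "(a / (k\<^sup>2 + k\<^sup>2))\<^sup>2 = a\<^sup>2 / (4 * k^4)" for a b :: real
    using kw(1) by (simp_all add: field_simps power2_eq_square power4_eq_xxxx)
  ultimately have "(sinh k)\<^sup>2 - (sin k)\<^sup>2 = (cosh k - cos k)\<^sup>2"
    using kw(1) by simp
  hence "cosh k * cos k = 1"
    using cosh_square_eq[of k] sin_squared_eq[of k] by (simp add: power2_diff)
  hence "c_const \<le> k" by (rule c_const_props(4)[OF kw(1)])
  hence "c_const^4 \<le> k^4" using c_const_props(1) by (intro power_mono) auto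
  thus "c_const^4 \<le> mu 0" using kw(4) by (simp add: eq flip: power_add)
qed

lemma ground_state_0: "ground_state 0 (\<lambda>x. of_real (mode 0 x)) (\<lambda>x. of_real (mode 1 x)) (\<lambda>x. of_real (mode 2 x))"
  using H2_mode by (simp add: ground_state_def nsq_mode_0 nsq_mode_2 mu_0)

section \<open>Dependence on the parameter and the coupled problem\<close>

text \<open>The number |u'|^2 of a normalised ground state, half the derivative of
  \<open>rho1\<close>; \<open>ground_state_unique\<close> makes the choice immaterial for \<alpha>
  \<ge> 0.\<close>

definition slope :: "real \<Rightarrow> real" where
  "slope \<alpha> = (SOME b. \<exists>u v w. ground_state \<alpha> u v w \<and> b = nsq I01 v)"

lemma slope_eq:
  assumes "\<alpha> \<ge> 0" "ground_state \<alpha> u v w" shows "slope \<alpha> = nsq I01 v"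
proof -
  have "\<exists>u' v' w'. ground_state \<alpha> u' v' w' \<and> slope \<alpha> = nsq I01 v'"
    unfolding slope_def by (rule someI_ex) (use assms(2) in blast)
  thus ?thesis using ground_state_unique[OF assms(1)] assms(2) by metis
qed

lemma ground_state_slope:
  assumes "\<alpha> \<ge> 0"
  obtains u v w where "ground_state \<alpha> u v w" "nsq I01 v = slope \<alpha>" "nsq I01 w = mu \<alpha> - 2 * \<alpha> * slope \<alpha>"
proof -
  obtain u v w where g: "ground_state \<alpha> u v w" by (rule ground_state_exists[OF assms])
  moreover have "nsq I01 v = slope \<alpha>" using slope_eq[OF assms g] by simp
  ultimately show ?thesis by (intro that[of u v w]) (auto simp: ground_state_def)
qed

text \<open>The ground state at \<alpha> serves as trial function at \<beta>, and its energy is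
  affine in the parameter: a supporting line of the concave function \<open>mu\<close>.\<close>

lemma mu_tangent:
  assumes "\<alpha> \<ge> 0" "\<beta> \<ge> 0" shows "mu \<beta> \<le> mu \<alpha> + 2 * (\<beta> - \<alpha>) * slope \<alpha>"
proof -
  obtain u v w where g: "ground_state \<alpha> u v w" and s: "nsq I01 v = slope \<alpha>" "nsq I01 w = mu \<alpha> - 2 * \<alpha> * slope \<alpha>"
    by (rule ground_state_slope[OF assms(1)])
  have "mu \<beta> * nsq I01 u \<le> nsq I01 w + 2 * \<beta> * nsq I01 v"
    by (rule mu_le[OF assms(2)]) (use g in \<open>simp add: ground_state_def\<close>)
  thus ?thesis using g by (simp add: s ground_state_def algebra_simps)
qed

lemma slope_antimono:
  assumes "0 \<le> \<alpha>" "\<alpha> \<le> \<beta>" shows "slope \<beta> \<le> slope \<alpha>"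
proof (cases "\<alpha> = \<beta>")
  case False
  have "mu \<beta> \<le> mu \<alpha> + 2 * (\<beta> - \<alpha>) * slope \<alpha>" "mu \<alpha> \<le> mu \<beta> + 2 * (\<alpha> - \<beta>) * slope \<beta>"
    by (rule mu_tangent; use assms in simp)+
  hence "(\<beta> - \<alpha>) * slope \<beta> \<le> (\<beta> - \<alpha>) * slope \<alpha>" by (simp add: algebra_simps)
  thus ?thesis using False assms by simp
qed simp

lemma slope_bounds:
  assumes "\<alpha> \<ge> 0" shows "pi\<^sup>2 \<le> slope \<alpha>" "slope \<alpha> \<le> d_const * c_const\<^sup>2"
proof -
  obtain u v w where g: "ground_state \<alpha> u v w" and s: "nsq I01 v = slope \<alpha>"
    by (rule ground_state_slope[OF assms])
  show "pi\<^sup>2 \<le> slope \<alpha>" using wirtinger[of u v w] g s by (simp add: ground_state_def)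
  have "slope 0 = d_const * c_const\<^sup>2"
    using slope_eq[OF _ ground_state_0] nsq_mode_1_d_const by simp
  thus "slope \<alpha> \<le> d_const * c_const\<^sup>2" using slope_antimono[of 0 \<alpha>] assms by simp
qed

text \<open>Ground states at parameters tending to \<alpha> form a minimising sequence at \<alpha>.
  A subsequence converges to a ground state there, and by uniqueness its |u'|^2 can only be
  \<open>slope \<alpha>\<close>.\<close>

lemma slope_sequentially_continuous:
  assumes \<alpha>: "\<alpha> \<ge> 0" and x: "\<And>n. x n \<ge> 0" "x \<longlonglongrightarrow> \<alpha>"
  shows "\<exists>r. strict_mono r \<and> (\<lambda>n. slope (x (r n))) \<longlonglongrightarrow> slope \<alpha>"
proof -
  have "\<exists>u v w. ground_state (x n) u v w \<and> nsq I01 v = slope (x n) \<and> nsq I01 w = mu (x n) - 2 * x n * slope (x n)" for n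
    by (rule ground_state_slope[OF x(1)[of n]]) blast
  then obtain u v w where g: "\<And>n. ground_state (x n) (u n) (v n) (w n)"
    and s: "\<And>n. nsq I01 (v n) = slope (x n)" "\<And>n. nsq I01 (w n) = mu (x n) - 2 * x n * slope (x n)" by metis
  have H: "H2 1 (u n) (v n) (w n)" "nsq I01 (u n) = 1" for n using g[of n] by (auto simp: ground_state_def)
  \<comment> \<open>The n-th state is evaluated at \<alpha> instead of \<open>x n\<close>; the error
    is the shift of the parameter times a difference of two slopes, both between 0 and
    \<open>slope 0\<close>.\<close>
  have up: "nsq I01 (w n) + 2 * \<alpha> * nsq I01 (v n) \<le> mu \<alpha> + 2 * \<bar>x n - \<alpha>\<bar> * slope 0" for n
  proof -
    have "nsq I01 (w n) + 2 * \<alpha> * nsq I01 (v n) = mu (x n) + 2 * (\<alpha> - x n) * slope (x n)"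
      by (simp add: s algebra_simps)
    also have "\<dots> \<le> mu \<alpha> + 2 * (x n - \<alpha>) * slope \<alpha> + 2 * (\<alpha> - x n) * slope (x n)"
      using mu_tangent[OF \<alpha> x(1)[of n]] by simp
    also have "\<dots> = mu \<alpha> + 2 * ((x n - \<alpha>) * (slope \<alpha> - slope (x n)))" by (simp add: algebra_simps)
    also have "\<dots> \<le> mu \<alpha> + 2 * (\<bar>x n - \<alpha>\<bar> * slope 0)"
    proof -
      have "slope \<alpha> \<ge> 0" "slope (x n) \<ge> 0" using slope_bounds(1)[OF \<alpha>] slope_bounds(1)[OF x(1)[of n]]
        by (meson order_trans zero_le_power2)+
      hence "\<bar>slope \<alpha> - slope (x n)\<bar> \<le> slope 0"
        using slope_antimono[of 0 \<alpha>] slope_antimono[of 0 "x n"] \<alpha> x(1)[of n] by auto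
      hence "\<bar>x n - \<alpha>\<bar> * \<bar>slope \<alpha> - slope (x n)\<bar> \<le> \<bar>x n - \<alpha>\<bar> * slope 0" by (rule mult_left_mono) simp
      thus ?thesis using abs_ge_self[of "(x n - \<alpha>) * (slope \<alpha> - slope (x n))"] unfolding abs_mult by linarith
    qed
    finally show ?thesis by simp
  qed
  have "(\<lambda>n. nsq I01 (w n) + 2 * \<alpha> * nsq I01 (v n)) \<longlonglongrightarrow> mu \<alpha>"
  proof (rule tendsto_sandwich[OF _ _ tendsto_const])
    have "(\<lambda>n. mu \<alpha> + 2 * \<bar>x n - \<alpha>\<bar> * slope 0) \<longlonglongrightarrow> mu \<alpha> + 2 * \<bar>\<alpha> - \<alpha>\<bar> * slope 0"
      by (intro tendsto_intros x)
    thus "(\<lambda>n. mu \<alpha> + 2 * \<bar>x n - \<alpha>\<bar> * slope 0) \<longlonglongrightarrow> mu \<alpha>" by simp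
    show "eventually (\<lambda>n. mu \<alpha> \<le> nsq I01 (w n) + 2 * \<alpha> * nsq I01 (v n)) sequentially"
      using mu_le[OF \<alpha> H(1)] H(2) by simp
    show "eventually (\<lambda>n. nsq I01 (w n) + 2 * \<alpha> * nsq I01 (v n) \<le> mu \<alpha> + 2 * \<bar>x n - \<alpha>\<bar> * slope 0) sequentially"
      by (intro always_eventually allI up)
  qed
  from minimising_sequence[OF \<alpha> H(1) _ this] H(2)
  obtain r u' v' w' where "strict_mono r" "ground_state \<alpha> u' v' w'" "(\<lambda>n. nsq I01 (v (r n))) \<longlonglongrightarrow> nsq I01 v'"
    by auto
  thus ?thesis using slope_eq[OF \<alpha>] unfolding s by auto
qed

text \<open>Convergence along a subsequence is enough: a discontinuity would give a sequence all of
  whose slopes keep distance e.\<close>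

lemma slope_continuous: "continuous_on {0..} slope"
  unfolding continuous_on_iff
proof (intro ballI allI impI)
  fix \<alpha> e :: real assume \<alpha>: "\<alpha> \<in> {0..}" and e: "0 < e"
  show "\<exists>d>0. \<forall>x'\<in>{0..}. dist x' \<alpha> < d \<longrightarrow> dist (slope x') (slope \<alpha>) < e"
  proof (rule ccontr)
    assume neg: "\<not> ?thesis"
    have "\<exists>y\<ge>0. \<bar>y - \<alpha>\<bar> < 1 / real (Suc n) \<and> e \<le> \<bar>slope y - slope \<alpha>\<bar>" for n
    proof -
      have "0 < 1 / real (Suc n)" by simp
      with neg have "\<not> (\<forall>x'\<in>{0..}. dist x' \<alpha> < 1 / real (Suc n) \<longrightarrow> dist (slope x') (slope \<alpha>) < e)"
        by blast
      thus ?thesis by (auto simp: dist_real_def not_less simp del: of_nat_Suc)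
    qed
    then obtain x where x: "\<And>n. x n \<ge> 0" "\<And>n. \<bar>x n - \<alpha>\<bar> < 1 / real (Suc n)" "\<And>n. e \<le> \<bar>slope (x n) - slope \<alpha>\<bar>"
      by metis
    have "(\<lambda>n. x n - \<alpha>) \<longlonglongrightarrow> 0"
      by (rule tendsto_rabs_zero_cancel, rule tendsto_0_squeeze[OF _ _ LIMSEQ_Suc[OF lim_1_over_n]])
         (use x(2) less_imp_le in auto)
    hence "x \<longlonglongrightarrow> \<alpha>" using LIM_zero_iff by blast
    then obtain r where "(\<lambda>n. slope (x (r n))) \<longlonglongrightarrow> slope \<alpha>"
      using slope_sequentially_continuous[of \<alpha> x] \<alpha> x(1) by auto
    from tendstoD[OF this e] obtain n where "dist (slope (x (r n))) (slope \<alpha>) < e"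
      by (auto simp: eventually_sequentially)
    thus False using x(3)[of "r n"] by (simp add: dist_real_def)
  qed
qed

text \<open>The supporting lines at \<alpha> and at y squeeze the difference quotient between 2
  \<open>slope \<alpha>\<close> and 2 \<open>slope y\<close>, and the slope is continuous.\<close>

lemma mu_has_derivative:
  assumes "\<alpha> > 0" shows "(mu has_real_derivative 2 * slope \<alpha>) (at \<alpha>)"
proof -
  have cont: "(slope \<longlongrightarrow> slope \<alpha>) (at \<alpha>)"
  proof -
    have "isCont slope \<alpha>"
      by (rule continuous_on_interior[OF slope_continuous]) (use assms in simp)
    thus ?thesis by (simp add: isCont_def)
  qed
  have "((\<lambda>y. (mu y - mu \<alpha>) / (y - \<alpha>)) \<longlongrightarrow> 2 * slope \<alpha>) (at \<alpha>)"
  proof (rule LIM_zero_cancel)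
    have "((\<lambda>y. 2 * \<bar>slope y - slope \<alpha>\<bar>) \<longlongrightarrow> 2 * \<bar>slope \<alpha> - slope \<alpha>\<bar>) (at \<alpha>)"
      by (intro tendsto_intros cont)
    hence l: "((\<lambda>y. 2 * \<bar>slope y - slope \<alpha>\<bar>) \<longlongrightarrow> 0) (at \<alpha>)" by simp
    show "((\<lambda>y. (mu y - mu \<alpha>) / (y - \<alpha>) - 2 * slope \<alpha>) \<longlongrightarrow> 0) (at \<alpha>)"
    proof (rule Lim_null_comparison[OF _ l])
      have "eventually (\<lambda>y. y > 0 \<and> y \<noteq> \<alpha>) (at \<alpha>)"
        using assms by (intro eventually_conj order_tendstoD(1)[OF tendsto_ident_at]) (auto simp: eventually_at_filter)
      thus "eventually (\<lambda>y. norm ((mu y - mu \<alpha>) / (y - \<alpha>) - 2 * slope \<alpha>) \<le> 2 * \<bar>slope y - slope \<alpha>\<bar>) (at \<alpha>)"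
      proof eventually_elim
        case (elim y)
        have 1: "mu y - mu \<alpha> - 2 * slope \<alpha> * (y - \<alpha>) \<le> 0"
          using mu_tangent[of \<alpha> y] assms elim by (simp add: algebra_simps)
        have 2: "mu y - mu \<alpha> - 2 * slope \<alpha> * (y - \<alpha>) \<ge> 2 * ((slope y - slope \<alpha>) * (y - \<alpha>))"
          using mu_tangent[of y \<alpha>] assms elim by (simp add: algebra_simps)
        have "\<bar>mu y - mu \<alpha> - 2 * slope \<alpha> * (y - \<alpha>)\<bar> \<le> 2 * (\<bar>slope y - slope \<alpha>\<bar> * \<bar>y - \<alpha>\<bar>)"
          using 1 2 abs_ge_minus_self[of "(slope y - slope \<alpha>) * (y - \<alpha>)"] unfolding abs_mult by linarith
        moreover have "(mu y - mu \<alpha>) / (y - \<alpha>) - 2 * slope \<alpha> = (mu y - mu \<alpha> - 2 * slope \<alpha> * (y - \<alpha>)) / (y - \<alpha>)"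
          using elim by (simp add: diff_divide_distrib)
        ultimately show ?case using elim by (simp add: abs_divide divide_le_eq mult.assoc)
      qed
    qed
  qed
  thus ?thesis by (simp add: has_field_derivative_iff)
qed

text \<open>The supporting lines give the Lipschitz constant 2 \<open>slope 0\<close>. The endpoint
  0 is included because it is a boundary value of the compact rectangle on which the energy is
  minimised.\<close>

lemma mu_continuous: "continuous_on {0..} mu"
  unfolding continuous_on_iff
proof (intro ballI allI impI)
  fix \<alpha> e :: real assume \<alpha>: "\<alpha> \<in> {0..}" and e: "0 < e"
  define L where "L = 2 * slope 0 + 1"
  have s0: "slope y \<ge> 0" "slope y \<le> slope 0" if "y \<ge> 0" for y
    using slope_bounds(1)[OF that] slope_antimono[of 0 y] that by (auto intro: order_trans[OF zero_le_power2])
  have L: "L > 0" using s0[of 0] by (simp add: L_def)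
  show "\<exists>d>0. \<forall>y\<in>{0..}. dist y \<alpha> < d \<longrightarrow> dist (mu y) (mu \<alpha>) < e"
  proof (intro exI[of _ "e / L"] conjI ballI impI)
    show "0 < e / L" using e L by simp
    fix y assume y: "y \<in> {0..}" "dist y \<alpha> < e / L"
    have b: "mu p - mu q \<le> \<bar>p - q\<bar> * (2 * slope 0)" if "p \<ge> 0" "q \<ge> 0" for p q
    proof -
      have "mu p - mu q \<le> 2 * ((p - q) * slope q)" using mu_tangent[OF that(2,1)] by (simp add: algebra_simps)
      also have "(p - q) * slope q \<le> \<bar>p - q\<bar> * slope 0"
        using s0[OF that(2)] by (intro mult_mono) auto
      finally show ?thesis by simp
    qed
    have "\<bar>mu y - mu \<alpha>\<bar> \<le> \<bar>y - \<alpha>\<bar> * (2 * slope 0)"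
      using b[of y \<alpha>] b[of \<alpha> y] y(1) \<alpha> by (simp add: abs_le_iff abs_minus_commute)
    also have "\<dots> \<le> \<bar>y - \<alpha>\<bar> * L" by (intro mult_left_mono) (auto simp: L_def)
    also have "\<dots> < e" using y(2) L by (simp add: dist_real_def field_simps)
    finally show "dist (mu y) (mu \<alpha>) < e" by (simp add: dist_real_def)
  qed
qed

section \<open>Identification with the eigenvalue of the operator\<close>

lemma H_form_eq: "H_form \<alpha> u v = ip I01 (D01 (D01 u)) (D01 (D01 v)) + 2 * of_real \<alpha> * ip I01 (D01 u) (D01 v)"
  by (simp add: H_form_def ip_def set_lint_leb)

text \<open>The Euler-Lagrange identity is the weak eigenvalue equation, so
  \<open>mu \<alpha>\<close> is an eigenvalue. Testing an eigenvalue equation with its own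
  eigenfunction exhibits the eigenvalue as a Rayleigh quotient, which is at least
  \<open>mu \<alpha>\<close>.\<close>

lemma rho1_eq_mu: assumes \<alpha>: "\<alpha> \<ge> 0" shows "rho1 \<alpha> = mu \<alpha>"
  unfolding rho1_def
proof (rule Least_equality)
  have H01: "H2 1 v (D01 v) (D01 (D01 v))" if "v \<in> W22_0 {0..1}" for v
    using W22_0_imp_H2[OF that] by (simp add: D01_def)
  obtain u v w where g: "ground_state \<alpha> u v w" by (rule ground_state_exists[OF \<alpha>])
  have H: "H2 1 u v w" "nsq I01 u = 1" using g by (auto simp: ground_state_def)
  have u0: "u \<in> W22_0 {0..1}" by (rule H2_imp_W22_0(1)[OF H(1)])
  \<comment> \<open>The operator is stated with the derivatives chosen by \<open>D01\<close>;
    passing to them leaves the norms unchanged.\<close>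
  have g': "ground_state \<alpha> u (D01 u) (D01 (D01 u))"
    using g H01[OF u0] H2_unique[OF H(1) H01[OF u0]] by (simp add: ground_state_def)
  show "H_eigenvalue \<alpha> (complex_of_real (mu \<alpha>))"
    unfolding H_eigenvalue_def H_op_def
  proof (intro exI[of _ u] conjI ballI)
    have "(L2_norm {0..1} u)\<^sup>2 = 1" using H(2) by (simp add: L2_norm_sq)
    thus "L2_norm {0..1} u \<noteq> 0" by auto
    show "u \<in> W22_0 {0..1}" by (rule u0)
    show "(\<lambda>x. of_real (mu \<alpha>) * u x) \<in> L2 {0..1}"
      using sq_int_cmult[OF H2_sq_int(1)[OF H(1)]] by (simp add: L2_iff)
    fix v :: "real \<Rightarrow> complex" assume "v \<in> W22_0 {0..1}"
    from ground_state_euler_lagrange[OF \<alpha> g' H01[OF this]]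
    show "H_form \<alpha> u v = (LINT x:{0..1}|lborel. of_real (mu \<alpha>) * u x * cnj (v x))"
      by (simp add: H_form_eq set_lint_leb ip_def mult.assoc)
  qed
  fix l assume "H_eigenvalue \<alpha> (complex_of_real l)"
  then obtain u where u: "L2_norm {0..1} u \<noteq> 0" "u \<in> W22_0 {0..1}"
    and eq: "\<forall>v\<in>W22_0 {0..1}. H_form \<alpha> u v = (LINT x:{0..1}|lborel. of_real l * u x * cnj (v x))"
    unfolding H_eigenvalue_def H_op_def by blast
  have "H_form \<alpha> u u = of_real l * ip I01 u u"
    using eq u(2) by (simp add: set_lint_leb ip_def mult.assoc)
  hence "complex_of_real (nsq I01 (D01 (D01 u)) + 2 * \<alpha> * nsq I01 (D01 u)) = of_real (l * nsq I01 u)"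
    by (simp add: H_form_eq ip_self)
  hence "nsq I01 (D01 (D01 u)) + 2 * \<alpha> * nsq I01 (D01 u) = l * nsq I01 u" by (simp only: of_real_eq_iff)
  hence "mu \<alpha> * nsq I01 u \<le> l * nsq I01 u" using mu_le[OF \<alpha> H01[OF u(2)]] by simp
  moreover have "nsq I01 u > 0" using u(1) L2_norm_sq[of "{0..1::real}" u] nsq_nonneg[of I01 u]
    by (auto simp: less_le)
  ultimately show "mu \<alpha> \<le> l" by simp
qed

lemma deriv_rho1: assumes "\<alpha> > 0" shows "deriv rho1 \<alpha> = 2 * slope \<alpha>"
proof (rule DERIV_imp_deriv)
  show "(rho1 has_real_derivative 2 * slope \<alpha>) (at \<alpha>)"
    by (rule has_field_derivative_transform_within_open[OF mu_has_derivative[OF assms], of "{0<..}"])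
       (use assms rho1_eq_mu in auto)
qed

section \<open>Minimisation over pairs of derivative norms\<close>

definition energies :: "(real \<times> real) set" where
  "energies = {(A, B). \<exists>u v w. H2 1 u v w \<and> nsq I01 u = 1 \<and> A = nsq I01 w \<and> B = nsq I01 v}"

text \<open>The function sqrt h u(h x) on the unit interval has the same norm as u on [0, h], and
  each derivative brings a factor h, hence the powers h^2 and h^4 of the squared norms.\<close>

lemma energies_scale_to:
  assumes h: "h > 0" and H: "H2 h u v w" "nsq (leb {0..h}) u = 1"
  shows "(h^4 * nsq (leb {0..h}) w, h\<^sup>2 * nsq (leb {0..h}) v) \<in> energies"
proof -
  let ?c = "complex_of_real (sqrt h)"
  have S: "H2 1 (\<lambda>x. ?c * u (h * x)) (\<lambda>x. ?c * (of_real h * v (h * x))) (\<lambda>x. ?c * (of_real (h\<^sup>2) * w (h * x)))"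
    using H2_cmult[OF H2_scale[OF h H(1)], of ?c] h by simp
  have n: "nsq I01 (\<lambda>x. f (h * x)) = nsq (leb {0..h}) f / h" for f :: "real \<Rightarrow> complex"
    using nsq_scale(2)[OF h, of h f] h by simp
  show ?thesis
    unfolding energies_def
    by (intro CollectI case_prodI exI conjI, rule S)
       (use h H(2) in \<open>simp_all add: nsq_cmult n norm_mult power_mult_distrib power2_eq_square power4_eq_xxxx\<close>)
qed

lemma energies_scale_from:
  assumes h: "h > 0" and AB: "(A, B) \<in> energies"
  obtains u v w where "H2 h u v w" "nsq (leb {0..h}) u = 1" "nsq (leb {0..h}) w = A / h^4" "nsq (leb {0..h}) v = B / h\<^sup>2"
proof -
  obtain u v w where H: "H2 1 u v w" "nsq I01 u = 1" "A = nsq I01 w" "B = nsq I01 v"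
    using AB by (auto simp: energies_def)
  let ?s = "1 / h" let ?c = "complex_of_real (1 / sqrt h)"
  have s: "?s > 0" using h by simp
  have S: "H2 h (\<lambda>x. ?c * u (?s * x)) (\<lambda>x. ?c * (of_real ?s * v (?s * x))) (\<lambda>x. ?c * (of_real (?s\<^sup>2) * w (?s * x)))"
    using H2_cmult[OF H2_scale[OF s H(1)], of ?c] by simp
  have n: "nsq (leb {0..h}) (\<lambda>x. f (?s * x)) = nsq I01 f * h" for f :: "real \<Rightarrow> complex"
    using nsq_scale(2)[OF s, of 1 f] h by simp
  have cc: "(cmod ?c)\<^sup>2 = 1 / h" using h by (simp add: norm_divide power_divide)
  show ?thesis
  proof (rule that[OF S])
    show "nsq (leb {0..h}) (\<lambda>x. ?c * u (?s * x)) = 1"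
      using h H(2) unfolding nsq_cmult cc n by simp
    show "nsq (leb {0..h}) (\<lambda>x. ?c * (of_real (?s\<^sup>2) * w (?s * x))) = A / h^4"
      using h unfolding nsq_cmult cc n H(3) by (simp add: norm_power norm_divide power_divide)
    show "nsq (leb {0..h}) (\<lambda>x. ?c * (of_real ?s * v (?s * x))) = B / h\<^sup>2"
      using h unfolding nsq_cmult cc n H(4) by (simp add: norm_divide power_divide)
  qed
qed

lemma energies_lower: "(A, B) \<in> energies \<Longrightarrow> t \<ge> 0 \<Longrightarrow> mu t \<le> A + 2 * t * B"
proof -
  assume "(A, B) \<in> energies" "t \<ge> 0"
  then obtain u v w where "H2 1 u v w" "nsq I01 u = 1" "A = nsq I01 w" "B = nsq I01 v"
    by (auto simp: energies_def)
  thus ?thesis using mu_le[OF \<open>t \<ge> 0\<close>, of u v w] by simp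
qed

lemma energies_ground_state: "t \<ge> 0 \<Longrightarrow> (mu t - 2 * t * slope t, slope t) \<in> energies"
proof -
  assume "t \<ge> 0"
  obtain u v w where g: "ground_state t u v w" "nsq I01 v = slope t" "nsq I01 w = mu t - 2 * t * slope t"
    by (rule ground_state_slope[OF \<open>t \<ge> 0\<close>])
  show ?thesis unfolding energies_def
    by (intro CollectI case_prodI exI[of _ u] exI[of _ v] exI[of _ w]) (use g in \<open>simp add: ground_state_def\<close>)
qed

text \<open>A pair attaining the lower bound comes from a ground state at t, and uniqueness then
  fixes both of its components.\<close>

lemma energies_eq:
  assumes "(A, B) \<in> energies" "t \<ge> 0" "A + 2 * t * B \<le> mu t"
  shows "B = slope t" "A = mu t - 2 * t * slope t"
proof -
  have eq: "A + 2 * t * B = mu t" using energies_lower[OF assms(1,2)] assms(3) by simp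
  obtain u v w where "H2 1 u v w" "nsq I01 u = 1" "A = nsq I01 w" "B = nsq I01 v"
    using assms(1) by (auto simp: energies_def)
  hence "ground_state t u v w" using eq by (simp add: ground_state_def)
  from slope_eq[OF assms(2) this] show B: "B = slope t" using \<open>B = nsq I01 v\<close> by simp
  show "A = mu t - 2 * t * slope t" using eq B by simp
qed

text \<open>The energy of a normalised pair f, g in terms of points of \<open>energies\<close>. The
  first point describes f pulled back to the unit interval, hence the divisions by h^4 and
  h^2.\<close>

definition product_energy :: "real \<Rightarrow> real \<times> real \<Rightarrow> real \<times> real \<Rightarrow> real" where
  "product_energy h = (\<lambda>(A, B) (A', B'). A / h^4 + A' + 2 * (B * B' / h\<^sup>2))"

text \<open>For fixed B the energy is affine in (A', B') with weight 2 B / h^2 on B', so the best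
  partner is the ground state at B / h^2; for fixed B' the best first point is the one at h^2 B'.
  Equality of a minimising pair with its best responses is a statement about slopes; the parameters
  s and t themselves are not compared.\<close>

lemma product_energy_minimum:
  assumes h: "h > 0"
  obtains s t where "s \<ge> 0" "t \<ge> 0" "slope s = slope (h\<^sup>2 * slope t)" "slope t = slope (slope s / h\<^sup>2)"
    "\<And>p q. p \<in> energies \<Longrightarrow> q \<in> energies \<Longrightarrow>
      mu (h\<^sup>2 * slope t) / h^4 + mu (slope s / h\<^sup>2) - 2 * (slope s * slope t / h\<^sup>2) \<le> product_energy h p q"
    "\<exists>p\<in>energies. \<exists>q\<in>energies. product_energy h p q =
      mu (h\<^sup>2 * slope t) / h^4 + mu (slope s / h\<^sup>2) - 2 * (slope s * slope t / h\<^sup>2)"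
proof -
  define a where "a = (\<lambda>t. mu t - 2 * t * slope t)"
  define \<Psi> where "\<Psi> = (\<lambda>p. a (fst p) / h^4 + a (snd p) + 2 * (slope (fst p) * slope (snd p) / h\<^sup>2))"
  have sp: "slope t > 0" if "t \<ge> 0" for t
    using slope_bounds(1)[OF that] by (rule less_le_trans[rotated]) simp
  have h2: "h\<^sup>2 > 0" "h^4 > 0" using h by auto
  have hh: "h^4 = h\<^sup>2 * h\<^sup>2" by (simp add: power2_eq_square power4_eq_xxxx)
  \<comment> \<open>Best responses have parameters h^2 times a slope or a slope over h^2, and no
    slope exceeds \<open>slope 0\<close>.\<close>
  define K where "K = {0..h\<^sup>2 * slope 0} \<times> {0..slope 0 / h\<^sup>2}"
  have ca: "continuous_on {0..} a" unfolding a_def by (intro continuous_intros mu_continuous slope_continuous)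
  have c1: "continuous_on K (\<lambda>p. f (fst p))" "continuous_on K (\<lambda>p. f (snd p))" if "continuous_on {0..} f" for f :: "real \<Rightarrow> real"
    by (rule continuous_on_compose2[OF that]; auto simp: K_def intro!: continuous_intros)+
  have "continuous_on K \<Psi>" unfolding \<Psi>_def
    using h2 by (intro continuous_intros c1(1)[OF ca] c1(2)[OF ca] c1(1)[OF slope_continuous] c1(2)[OF slope_continuous]) auto
  moreover have "compact K" unfolding K_def by (intro compact_Times compact_Icc)
  moreover have "(0, 0) \<in> K" using sp[of 0] h by (simp add: K_def)
  hence "K \<noteq> {}" by auto
  ultimately obtain p0 where p0: "p0 \<in> K" "\<And>p. p \<in> K \<Longrightarrow> \<Psi> p0 \<le> \<Psi> p"
    using continuous_attains_inf[of K \<Psi>] by blast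
  obtain s t where st: "p0 = (s, t)" by (cases p0)
  have s: "s \<ge> 0" and t: "t \<ge> 0" using p0(1) by (auto simp: st K_def)
  have step1: "a (B / h\<^sup>2) + 2 * (B * slope (B / h\<^sup>2) / h\<^sup>2) \<le> A' + 2 * (B * B' / h\<^sup>2)"
    if "(A', B') \<in> energies" "B \<ge> 0" for A' B' B
    using energies_lower[OF that(1), of "B / h\<^sup>2"] that(2) h by (simp add: a_def mult.assoc)
  have step2: "a (h\<^sup>2 * B') / h^4 + 2 * (slope (h\<^sup>2 * B') * B' / h\<^sup>2) \<le> A / h^4 + 2 * (B * B' / h\<^sup>2)"
    if "(A, B) \<in> energies" "B' \<ge> 0" for A B B'
  proof -
    have "mu (h\<^sup>2 * B') \<le> A + 2 * (h\<^sup>2 * B') * B" using energies_lower[OF that(1), of "h\<^sup>2 * B'"] that(2) h by simp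
    hence "mu (h\<^sup>2 * B') / h^4 \<le> (A + 2 * (h\<^sup>2 * B') * B) / h^4" using h by (intro divide_right_mono) auto
    moreover have "(x - 2 * (h\<^sup>2 * B') * y) / h^4 = x / h^4 - 2 * (y * B' / h\<^sup>2)"
      "(x + 2 * (h\<^sup>2 * B') * y) / h^4 = x / h^4 + 2 * (y * B' / h\<^sup>2)" for x y
      using h unfolding hh by (simp_all add: field_simps)
    ultimately show ?thesis unfolding a_def by simp
  qed
  have eg: "(a t, slope t) \<in> energies" if "t \<ge> 0" for t
    using energies_ground_state[OF that] by (simp add: a_def)
  have lower: "\<Psi> (s, t) \<le> product_energy h p q" if pq: "p \<in> energies" "q \<in> energies" for p q
  proof -
    obtain A B where e1: "p = (A, B)" by (cases p)
    obtain A' B' where e2: "q = (A', B')" by (cases q)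
    note e = e1 e2
    have "B \<ge> 0" using pq(1) by (auto simp: e energies_def)
    \<comment> \<open>Three successive best responses: t1 answers the given B, s1 answers t1, t2
      answers s1. B is arbitrary, so t1 may lie outside the rectangle; s1 and t2 are computed from
      slopes and lie inside.\<close>
    define t1 where "t1 = B / h\<^sup>2"
    have t1: "t1 \<ge> 0" using \<open>B \<ge> 0\<close> h by (simp add: t1_def)
    define s1 where "s1 = h\<^sup>2 * slope t1"
    have s1: "s1 \<ge> 0" using sp[OF t1] h by (simp add: s1_def)
    define t2 where "t2 = slope s1 / h\<^sup>2"
    have t2: "t2 \<ge> 0" using sp[OF s1] h by (simp add: t2_def)
    have "slope t1 \<le> slope 0" "slope s1 \<le> slope 0" using slope_antimono[of 0 t1] slope_antimono[of 0 s1] t1 s1 by simp_all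
    have "s1 \<le> h\<^sup>2 * slope 0"
      unfolding s1_def by (rule mult_left_mono[OF \<open>slope t1 \<le> slope 0\<close>]) simp
    moreover have "t2 \<le> slope 0 / h\<^sup>2"
      unfolding t2_def by (rule divide_right_mono[OF \<open>slope s1 \<le> slope 0\<close>]) simp
    ultimately have "(s1, t2) \<in> K" using s1 t2 by (simp add: K_def)
    hence "\<Psi> (s, t) \<le> \<Psi> (s1, t2)" using p0(2) by (simp add: st)
    also have "\<dots> \<le> a s1 / h^4 + (a t1 + 2 * (slope s1 * slope t1 / h\<^sup>2))"
      using step1[OF eg[OF t1], of "slope s1"] sp[OF s1] by (simp add: \<Psi>_def t2_def)
    also have "\<dots> \<le> A / h^4 + 2 * (B * slope t1 / h\<^sup>2) + a t1"
      using step2[OF pq(1)[unfolded e], of "slope t1"] sp[OF t1] by (simp add: s1_def)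
    also have "\<dots> \<le> product_energy h p q"
      using step1[OF pq(2)[unfolded e] \<open>B \<ge> 0\<close>] by (simp add: product_energy_def e t1_def)
    finally show ?thesis .
  qed
  txt \<open>Best responses to the members of the minimising pair do not lower the energy.\<close>
  define t' s' where "t' = slope s / h\<^sup>2" and "s' = h\<^sup>2 * slope t"
  have t': "t' \<ge> 0" and s': "s' \<ge> 0" using sp[OF s] sp[OF t] h by (auto simp: t'_def s'_def)
  have "\<Psi> (s, t) \<le> product_energy h (a s, slope s) (a t', slope t')" by (rule lower[OF eg[OF s] eg[OF t']])
  hence "a t + 2 * (slope s * slope t / h\<^sup>2) \<le> a t' + 2 * (slope s * slope t' / h\<^sup>2)"
    by (simp add: \<Psi>_def product_energy_def)
  hence le1: "a t + 2 * t' * slope t \<le> mu t'" by (simp add: a_def t'_def mult.assoc)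
  note E1 = energies_eq[OF eg[OF t] t' le1]
  have "\<Psi> (s, t) \<le> product_energy h (a s', slope s') (a t, slope t)" by (rule lower[OF eg[OF s'] eg[OF t]])
  hence "a s / h^4 + 2 * (slope s * slope t / h\<^sup>2) \<le> a s' / h^4 + 2 * (slope s' * slope t / h\<^sup>2)"
    by (simp add: \<Psi>_def product_energy_def)
  hence "h^4 * (a s / h^4 + 2 * (slope s * slope t / h\<^sup>2)) \<le> h^4 * (a s' / h^4 + 2 * (slope s' * slope t / h\<^sup>2))"
    using h2 by (intro mult_left_mono) auto
  \<comment> \<open>Multiplying by h^4 turns the coupling into the parameter s' = h^2
    \<open>slope t\<close> of the response problem for the first factor.\<close>
  moreover have "h^4 * (x / h^4 + 2 * (y * slope t / h\<^sup>2)) = x + 2 * s' * y" for x y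
    unfolding s'_def hh using h by (simp add: field_simps)
  ultimately have le2: "a s + 2 * s' * slope s \<le> mu s'" by (simp add: a_def)
  note E2 = energies_eq[OF eg[OF s] s' le2]
  \<comment> \<open>Each of the two values of \<open>mu\<close> contains the coupling term once in
    full, so the sum counts it twice and one copy is subtracted.\<close>
  have val: "\<Psi> (s, t) = mu s' / h^4 + mu t' - 2 * (slope s * slope t / h\<^sup>2)"
  proof -
    have m1: "mu t' = a t + 2 * (slope s * slope t / h\<^sup>2)" using E1 by (simp add: t'_def)
    have "mu s' = a s + 2 * s' * slope s" using E2 by simp
    hence m2: "mu s' / h^4 = a s / h^4 + 2 * (slope s * slope t / h\<^sup>2)"
      using h unfolding s'_def hh by (simp add: field_simps)
    show ?thesis unfolding m1 m2 by (simp add: \<Psi>_def)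
  qed
  have v: "product_energy h (a s, slope s) (a t, slope t) = \<Psi> (s, t)"
    by (simp add: product_energy_def \<Psi>_def)
  show ?thesis
  proof (rule that[OF s t])
    show "slope s = slope (h\<^sup>2 * slope t)" using E2(1) by (simp add: s'_def)
    show "slope t = slope (slope s / h\<^sup>2)" using E1(1) by (simp add: t'_def)
    show "\<And>p q. p \<in> energies \<Longrightarrow> q \<in> energies \<Longrightarrow>
      mu (h\<^sup>2 * slope t) / h^4 + mu (slope s / h\<^sup>2) - 2 * (slope s * slope t / h\<^sup>2) \<le> product_energy h p q"
      using lower val by (simp add: s'_def t'_def)
    show "\<exists>p\<in>energies. \<exists>q\<in>energies. product_energy h p q =
      mu (h\<^sup>2 * slope t) / h^4 + mu (slope s / h\<^sup>2) - 2 * (slope s * slope t / h\<^sup>2)"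
      by (intro bexI[of _ "(a s, slope s)"] bexI[of _ "(a t, slope t)"] eg s t)
         (use v val in \<open>simp add: s'_def t'_def\<close>)
  qed
qed

text \<open>Pairs outside \<open>W22_0\<close> have infinite energy. For the others the lower bound,
  and for attainment the minimising pair, are transported between [0, h] and the unit interval by
  scaling.\<close>

lemma nu1_eq:
  assumes h: "h > 0" and low: "\<And>p q. p \<in> energies \<Longrightarrow> q \<in> energies \<Longrightarrow> m \<le> product_energy h p q"
    and att: "p \<in> energies" "q \<in> energies" "product_energy h p q = m"
  shows "nu1 h = ereal m"
  unfolding nu1_def
proof (rule Inf_eqI)
  fix y assume "y \<in> {tensor_energy h f g | f g. f \<in> L2 {0..h} \<and> g \<in> L2 {0..1} \<and> L2_norm {0..h} f = 1 \<and> L2_norm {0..1} g = 1}"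
  then obtain f g where fg: "L2_norm {0..h} f = 1" "L2_norm {0..1} g = 1" and y: "y = tensor_energy h f g" by auto
  show "ereal m \<le> y"
  proof (cases "f \<in> W22_0 {0..h} \<and> g \<in> W22_0 {0..1}")
    case True
    obtain f1 f2 where f: "H2 h f f1 f2" using W22_0_imp_H2 True by blast
    obtain g1 g2 where g: "H2 1 g g1 g2" using W22_0_imp_H2 True by blast
    have n: "nsq (leb {0..h}) f = 1" "nsq I01 g = 1"
      using fg L2_norm_sq[of "{0..h}" f] L2_norm_sq[of "{0..1}" g] by auto
    have "m \<le> product_energy h (h^4 * nsq (leb {0..h}) f2, h\<^sup>2 * nsq (leb {0..h}) f1) (nsq I01 g2, nsq I01 g1)"
      by (rule low[OF energies_scale_to[OF h f n(1)]]) (use g n(2) in \<open>auto simp: energies_def\<close>)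
    also have "\<dots> = nsq (leb {0..h}) f2 + nsq I01 g2 + 2 * nsq (leb {0..h}) f1 * nsq I01 g1"
      using h by (simp add: product_energy_def)
    finally show ?thesis using tensor_energy_eq[OF f g] n by (simp add: y)
  next
    case False
    thus ?thesis by (auto simp: y tensor_energy_def)
  qed
next
  fix y assume le: "\<And>i. i \<in> {tensor_energy h f g | f g. f \<in> L2 {0..h} \<and> g \<in> L2 {0..1} \<and> L2_norm {0..h} f = 1 \<and> L2_norm {0..1} g = 1} \<Longrightarrow> y \<le> i"
  obtain A B where e1: "p = (A, B)" by (cases p)
    obtain A' B' where e2: "q = (A', B')" by (cases q)
    note e = e1 e2
  obtain f f1 f2 where f: "H2 h f f1 f2" "nsq (leb {0..h}) f = 1" "nsq (leb {0..h}) f2 = A / h^4" "nsq (leb {0..h}) f1 = B / h\<^sup>2"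
    by (rule energies_scale_from[OF h att(1)[unfolded e]])
  obtain g g1 g2 where g: "H2 1 g g1 g2" "nsq I01 g = 1" "A' = nsq I01 g2" "B' = nsq I01 g1"
    using att(2) by (auto simp: e energies_def)
  have "tensor_energy h f g = ereal m"
    using att(3) by (simp add: tensor_energy_eq[OF f(1) g(1)] f(2-4) g(2) g(3,4)[symmetric] e product_energy_def)
  moreover have "f \<in> L2 {0..h}" "g \<in> L2 {0..1}" using H2_sq_int(1)[OF f(1)] H2_sq_int(1)[OF g(1)] by (auto simp: L2_iff)
  moreover have "L2_norm {0..h} f = 1" "L2_norm {0..1} g = 1"
    using f(2) g(2) by (simp_all add: L2_norm_def set_lint_leb nsq_def)
  ultimately have "\<exists>f g. ereal m = tensor_energy h f g \<and> f \<in> L2 {0..h} \<and> g \<in> L2 {0..1} \<and>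
      L2_norm {0..h} f = 1 \<and> L2_norm {0..1} g = 1"
    by (intro exI[of _ f] exI[of _ g]) simp
  thus "y \<le> ereal m" by (intro le CollectI)
qed

theorem theorem7:
  fixes h :: real
  assumes "h > 0"
  shows "\<exists>\<alpha>\<in>{pi\<^sup>2..d_const * c_const\<^sup>2}.
           2 * \<alpha> = deriv rho1 (1/2 * deriv rho1 (h\<^sup>2 * \<alpha>) / h\<^sup>2) \<and>
           nu1 h = ereal (rho1 (h\<^sup>2 * \<alpha>) / h^4
                     + rho1 (1/2 * deriv rho1 (h\<^sup>2 * \<alpha>) / h\<^sup>2)
                     - deriv rho1 (h\<^sup>2 * \<alpha>) / h\<^sup>2 * \<alpha>)"
proof -
  obtain s t where st: "s \<ge> 0" "t \<ge> 0" "slope s = slope (h\<^sup>2 * slope t)" "slope t = slope (slope s / h\<^sup>2)"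
    and low: "\<And>p q. p \<in> energies \<Longrightarrow> q \<in> energies \<Longrightarrow>
      mu (h\<^sup>2 * slope t) / h^4 + mu (slope s / h\<^sup>2) - 2 * (slope s * slope t / h\<^sup>2) \<le> product_energy h p q"
    and att: "\<exists>p\<in>energies. \<exists>q\<in>energies. product_energy h p q =
      mu (h\<^sup>2 * slope t) / h^4 + mu (slope s / h\<^sup>2) - 2 * (slope s * slope t / h\<^sup>2)"
    by (rule product_energy_minimum[OF assms], rule that)
  have sp: "slope r > 0" if "r \<ge> 0" for r
    using slope_bounds(1)[OF that] by (rule less_le_trans[rotated]) simp
  have p1: "h\<^sup>2 * slope t > 0" and p2: "slope s / h\<^sup>2 > 0" using sp[OF st(1)] sp[OF st(2)] assms by auto
  \<comment> \<open>Half of this derivative over h^2 is \<open>slope s / h\<^sup>2\<close>, the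
    inner argument in the equation for \<alpha>.\<close>
  have d1: "deriv rho1 (h\<^sup>2 * slope t) = 2 * slope s" using deriv_rho1[OF p1] st(3) by simp
  have d2: "deriv rho1 (slope s / h\<^sup>2) = 2 * slope t" using deriv_rho1[OF p2] st(4) by simp
  have nu: "nu1 h = ereal (mu (h\<^sup>2 * slope t) / h^4 + mu (slope s / h\<^sup>2) - 2 * (slope s * slope t / h\<^sup>2))"
    using nu1_eq[OF assms low] att by blast
  show ?thesis
  \<comment> \<open>The witness is |g'|^2 for the second member of the minimising pair.\<close>
  proof (intro bexI[of _ "slope t"] conjI)
    show "slope t \<in> {pi\<^sup>2..d_const * c_const\<^sup>2}" using slope_bounds[OF st(2)] by simp
    show "2 * slope t = deriv rho1 (1/2 * deriv rho1 (h\<^sup>2 * slope t) / h\<^sup>2)" using d2 by (simp add: d1)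
    show "nu1 h = ereal (rho1 (h\<^sup>2 * slope t) / h^4
                     + rho1 (1/2 * deriv rho1 (h\<^sup>2 * slope t) / h\<^sup>2)
                     - deriv rho1 (h\<^sup>2 * slope t) / h\<^sup>2 * slope t)"
      using p1 p2 by (simp add: nu d1 rho1_eq_mu)
  qed
qed

end
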